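(* Let $f\ge 1$ and $\alpha\in\mathrm{GF}(2^f)$ be such that the graph $\Gamma=\Gamma(f,\alpha)=\mathrm{Cos}(G,L,Lg_\alpha L)$ is connected, and let $A=\mathrm{Aut}(\Gamma)$. Then $G$ is an index two subgroup of $A$, $\Gamma$ is $(A,3)$-arc-transitive, $A$ is not biquasiprimitive on the vertices of $\Gamma$, and $A^+$ is quasiprimitive on each bipartite half of $\Gamma$.
   Context: Let $T=\mathrm{PSL}(2,2^f)$, viewed as the group of permutations $t_{p,q,r,s}:x\mapsto \frac{px+q}{rx+s}$ of $\mathrm{GF}(2^f)\cup\{\infty\}$ with $p,q,r,s\in\mathrm{GF}(2^f)$, $ps-qr\neq0$ (usual conventions for $\infty$). Permutations act on the right, and $x^y=y^{-1}xy$. Put $a=t_{1,1,1,0}$, $b=t_{1,1,0,1}$ (so $\langle a,b\rangle=\mathrm{PSL}(2,2)\cong S_3$) and $u_\alpha=t_{1,\alpha,0,1}$ for $\alpha\in\mathrm{GF}(2^f)$. Let $G=T^2\rtimes\langle\pi\rangle$, where $\pi$ has order $2$ and $(x,y)^\pi=(y,x)$ for $(x,y)\in T^2$; let $L=\langle(a,a),(b,b)\rangle<T^2$ and $g_\alpha=(u_\alpha,bu_\alpha)\pi\in G$; then $Lg_\alpha L=Lg_\alpha^{-1}L$. For a group $X$, subgroup $Y$ and $g\in X$ with $YgY=Yg^{-1}Y$, the coset graph $\mathrm{Cos}(X,Y,YgY)$ has as vertices the right cosets of $Y$ in $X$, with $Yx_1,Yx_2$ adjacent iff $x_2x_1^{-1}\in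 YgY$. The graph $\Gamma(f,\alpha)=\mathrm{Cos}(G,L,Lg_\alpha L)$ is bipartite and cubic; $G$ acts on it faithfully by right multiplication and is regarded as a subgroup of $\mathrm{Aut}(\Gamma)$. An $s$-arc is an $(s+1)$-tuple $(v_0,\dots,v_s)$ of vertices with consecutive vertices adjacent and $v_{j-1}\ne v_{j+1}$ for $1\le j\le s-1$. A connected graph $\Gamma$ is $(A,s)$-arc transitive if it has an $s$-arc and $A$ is transitive on the set of $i$-arcs for each $1\le i\le s$. A transitive permutation group is quasiprimitive if all its nontrivial normal subgroups are transitive; it is biquasiprimitive if it is not quasiprimitive and all its nontrivial normal subgroups have at most two orbits. For a vertex-transitive group $A$ of automorphisms of a connected bipartite graph, $A^+$ is the subgroup generated by the vertex stabilisers $A_v$; it has index $2$ when $A$ is arc-transitive, and its orbits are then the bipartite halves. *)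

theory Defs
  imports
    "HOL-Library.Cardinality"
    "HOL-Algebra.Group_Action"
    "HOL-Algebra.Generated_Groups"
    "Graph_Theory.Digraph_Component"
begin

section \<open>Permutation groups acting on the right\<close>

text \<open>Permutations of \<open>\<Omega>\<close> are elements of \<^const>\<open>Bij\<close>, i.e. they are extensional outside \<open>\<Omega>\<close>.
  The product \<open>g \<otimes> h\<close> means "first \<open>g\<close>, then \<open>h\<close>", which is the opposite of
  \<^const>\<open>BijGroup\<close>.\<close>

definition sym_group :: "'b set \<Rightarrow> ('b \<Rightarrow> 'b) monoid" where
  "sym_group \<Omega> = \<lparr>carrier = Bij \<Omega>, monoid.mult = (\<lambda>g h. compose \<Omega> h g), one = (\<lambda>\<omega>\<in>\<Omega>. \<omega>)\<rparr>"

text \<open>The permutation group on \<open>\<Omega>\<close> with underlying set \<open>H\<close>.\<close>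

abbreviation perm_group :: "'b set \<Rightarrow> ('b \<Rightarrow> 'b) set \<Rightarrow> ('b \<Rightarrow> 'b) monoid" where
  "perm_group \<Omega> H \<equiv> (sym_group \<Omega>)\<lparr>carrier := H\<rparr>"

definition transitive_on :: "'b set \<Rightarrow> ('b \<Rightarrow> 'b) set \<Rightarrow> bool" where
  "transitive_on \<Omega> H \<longleftrightarrow> (\<forall>v\<in>\<Omega>. \<forall>w\<in>\<Omega>. \<exists>h\<in>H. h v = w)"

definition transitive_perm_group :: "'b set \<Rightarrow> ('b \<Rightarrow> 'b) set \<Rightarrow> bool" where
  "transitive_perm_group \<Omega> H \<longleftrightarrow> subgroup H (sym_group \<Omega>) \<and> transitive_on \<Omega> H"

definition quasiprimitive :: "'b set \<Rightarrow> ('b \<Rightarrow> 'b) set \<Rightarrow> bool" where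
  "quasiprimitive \<Omega> H \<longleftrightarrow> transitive_perm_group \<Omega> H \<and>
     (\<forall>N. N \<lhd> perm_group \<Omega> H \<and> N \<noteq> {\<one>\<^bsub>sym_group \<Omega>\<^esub>} \<longrightarrow> transitive_on \<Omega> N)"

definition biquasiprimitive :: "'b set \<Rightarrow> ('b \<Rightarrow> 'b) set \<Rightarrow> bool" where
  "biquasiprimitive \<Omega> H \<longleftrightarrow> transitive_perm_group \<Omega> H \<and> \<not> quasiprimitive \<Omega> H \<and>
     (\<forall>N. N \<lhd> perm_group \<Omega> H \<and> N \<noteq> {\<one>\<^bsub>sym_group \<Omega>\<^esub>} \<longrightarrow>
        finite (orbits (perm_group \<Omega> N) \<Omega> (\<lambda>h. h)) \<and>
        card (orbits (perm_group \<Omega> N) \<Omega> (\<lambda>h. h)) \<le> 2)"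

text \<open>The permutation group induced on an invariant subset \<open>\<Delta>\<close>.\<close>

definition induced_on :: "'b set \<Rightarrow> ('b \<Rightarrow> 'b) set \<Rightarrow> ('b \<Rightarrow> 'b) set" where
  "induced_on \<Delta> H = (\<lambda>h. restrict h \<Delta>) ` H"

text \<open>The subgroup generated by the point stabilisers (written \<open>H\<^sup>+\<close> on paper).\<close>

definition plus_subgroup :: "'b set \<Rightarrow> ('b \<Rightarrow> 'b) set \<Rightarrow> ('b \<Rightarrow> 'b) set" where
  "plus_subgroup \<Omega> H =
     generate (perm_group \<Omega> H) (\<Union>v\<in>\<Omega>. stabilizer (perm_group \<Omega> H) (\<lambda>h. h) v)"


section \<open>Graphs\<close>

text \<open>An undirected graph is a digraph whose arc relation \<^const>\<open>parcs\<close> is symmetric.\<close>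

definition graph_aut :: "'b pair_pre_digraph \<Rightarrow> ('b \<Rightarrow> 'b) set" where
  "graph_aut \<Gamma> = {h \<in> Bij (pverts \<Gamma>).
     \<forall>v\<in>pverts \<Gamma>. \<forall>w\<in>pverts \<Gamma>. (v, w) \<in> parcs \<Gamma> \<longleftrightarrow> (h v, h w) \<in> parcs \<Gamma>}"

abbreviation Aut :: "'b pair_pre_digraph \<Rightarrow> ('b \<Rightarrow> 'b) monoid" where
  "Aut \<Gamma> \<equiv> perm_group (pverts \<Gamma>) (graph_aut \<Gamma>)"

definition s_arc :: "'b pair_pre_digraph \<Rightarrow> nat \<Rightarrow> 'b list \<Rightarrow> bool" where
  "s_arc \<Gamma> s vs \<longleftrightarrow> length vs = s + 1 \<and> set vs \<subseteq> pverts \<Gamma> \<and>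
     (\<forall>j<s. (vs ! j, vs ! (j + 1)) \<in> parcs \<Gamma>) \<and>
     (\<forall>j. 1 \<le> j \<and> j + 1 \<le> s \<longrightarrow> vs ! (j - 1) \<noteq> vs ! (j + 1))"

definition arc_transitive :: "'b pair_pre_digraph \<Rightarrow> ('b \<Rightarrow> 'b) set \<Rightarrow> nat \<Rightarrow> bool" where
  "arc_transitive \<Gamma> H s \<longleftrightarrow> connected (with_proj \<Gamma>) \<and> (\<exists>vs. s_arc \<Gamma> s vs) \<and>
     (\<forall>i\<in>{1..s}. \<forall>vs ws. s_arc \<Gamma> i vs \<and> s_arc \<Gamma> i ws \<longrightarrow> (\<exists>h\<in>H. map h vs = ws))"

text \<open>A connected bipartite graph with at least one edge has exactly two such sets.\<close>

definition bipartite_half :: "'b pair_pre_digraph \<Rightarrow> 'b set \<Rightarrow> bool" where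
  "bipartite_half \<Gamma> \<Delta> \<longleftrightarrow>
     \<Delta> \<subseteq> pverts \<Gamma> \<and> (\<forall>(v, w)\<in>parcs \<Gamma>. v \<in> \<Delta> \<longleftrightarrow> w \<notin> \<Delta>)"


section \<open>Coset graphs\<close>

definition double_coset :: "('b, 'c) monoid_scheme \<Rightarrow> 'b set \<Rightarrow> 'b \<Rightarrow> 'b set" where
  "double_coset X Y g = (Y #>\<^bsub>X\<^esub> g) <#>\<^bsub>X\<^esub> Y"

definition coset_graph :: "('b, 'c) monoid_scheme \<Rightarrow> 'b set \<Rightarrow> 'b set \<Rightarrow> 'b set pair_pre_digraph" where
  "coset_graph X Y D =
     \<lparr>pverts = rcosets\<^bsub>X\<^esub> Y,
      parcs = {(Y #>\<^bsub>X\<^esub> x1, Y #>\<^bsub>X\<^esub> x2) | x1 x2.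
                 x1 \<in> carrier X \<and> x2 \<in> carrier X \<and> x2 \<otimes>\<^bsub>X\<^esub> inv\<^bsub>X\<^esub> x1 \<in> D}\<rparr>"

definition right_mult_action :: "('b, 'c) monoid_scheme \<Rightarrow> 'b set \<Rightarrow> 'b \<Rightarrow> 'b set \<Rightarrow> 'b set" where
  "right_mult_action X Y x = (\<lambda>C\<in>rcosets\<^bsub>X\<^esub> Y. C #>\<^bsub>X\<^esub> x)"


section \<open>The groups \<open>T\<close>, \<open>G\<close>, \<open>L\<close> and the graph \<open>\<Gamma>\<close>\<close>

text \<open>The projective line over \<open>'a\<close> is \<^typ>\<open>'a option\<close>, with \<^const>\<open>None\<close> as \<open>\<infinity>\<close>.\<close>

fun mobius :: "'a::field \<Rightarrow> 'a \<Rightarrow> 'a \<Rightarrow> 'a \<Rightarrow> 'a option \<Rightarrow> 'a option" where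
  "mobius p q r s (Some x) = (if r * x + s = 0 then None else Some ((p * x + q) / (r * x + s)))"
| "mobius p q r s None = (if r = 0 then None else Some (p / r))"

definition T_group :: "('a::field option \<Rightarrow> 'a option) monoid" where
  "T_group = perm_group UNIV {mobius p q r s | p q r s. p * s - q * r \<noteq> 0}"

text \<open>\<open>N\<^sup>2 \<rtimes> \<langle>\<pi>\<rangle>\<close> with \<open>\<pi>\<close> of order 2 swapping the two factors: the pair \<open>(n, e)\<close> stands
  for \<open>n \<pi>\<^sup>e\<close>, where \<open>e\<close> is an exponent modulo 2 (\<^const>\<open>True\<close> being 1), so that
  \<open>n \<pi>\<^sup>e m \<pi>\<^sup>d = n (\<pi>\<^sup>e m \<pi>\<^sup>-\<^sup>e) \<pi>\<^sup>e\<^sup>+\<^sup>d\<close>.\<close>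

definition swap_extension :: "('b, 'c) monoid_scheme \<Rightarrow> (('b \<times> 'b) \<times> bool) monoid" where
  "swap_extension N =
     \<lparr>carrier = carrier (N \<times>\<times> N) \<times> UNIV,
      monoid.mult = (\<lambda>(n, e) (m, d). (n \<otimes>\<^bsub>N \<times>\<times> N\<^esub> (if e then prod.swap m else m), e \<noteq> d)),
      one = (\<one>\<^bsub>N \<times>\<times> N\<^esub>, False)\<rparr>"

type_synonym 'a G_elem =
  "(('a option \<Rightarrow> 'a option) \<times> ('a option \<Rightarrow> 'a option)) \<times> bool"

definition G_group :: "'a::field G_elem monoid" where
  "G_group = swap_extension T_group"

definition pi_elt :: "'a::field G_elem" where
  "pi_elt = (\<one>\<^bsub>T_group \<times>\<times> T_group\<^esub>, True)"

definition a_elt :: "'a::field option \<Rightarrow> 'a option" where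
  "a_elt = mobius 1 1 1 0"

definition b_elt :: "'a::field option \<Rightarrow> 'a option" where
  "b_elt = mobius 1 1 0 1"

definition u_elt :: "'a::field \<Rightarrow> 'a option \<Rightarrow> 'a option" where
  "u_elt \<alpha> = mobius 1 \<alpha> 0 1"

definition L_subgroup :: "'a::field G_elem set" where
  "L_subgroup = generate G_group {((a_elt, a_elt), False), ((b_elt, b_elt), False)}"

definition g_elt :: "'a::field \<Rightarrow> 'a G_elem" where
  "g_elt \<alpha> = ((u_elt \<alpha>, b_elt \<otimes>\<^bsub>T_group\<^esub> u_elt \<alpha>), False) \<otimes>\<^bsub>G_group\<^esub> pi_elt"

definition Gamma :: "'a::field \<Rightarrow> 'a G_elem set pair_pre_digraph" where
  "Gamma \<alpha> = coset_graph G_group L_subgroup (double_coset G_group L_subgroup (g_elt \<alpha>))"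

text \<open>The embedding of \<open>G\<close> into \<open>Aut(\<Gamma>)\<close> by right multiplication on the cosets of \<open>L\<close>.\<close>

definition G_action :: "'a::field G_elem \<Rightarrow> 'a G_elem set \<Rightarrow> 'a G_elem set" where
  "G_action = right_mult_action G_group L_subgroup"


section \<open>The groups are groups, and \<open>\<Gamma>\<close> is bipartite\<close>

lemma group_sym_group: "group (sym_group \<Omega>)"
proof (rule groupI)
  fix x assume "x \<in> carrier (sym_group \<Omega>)"
  then have "compose \<Omega> x (\<lambda>\<omega>\<in>\<Omega>. \<omega>) = x"
    by (auto simp: sym_group_def Bij_def extensional_def compose_def fun_eq_iff)
  then show "\<one>\<^bsub>sym_group \<Omega>\<^esub> \<otimes>\<^bsub>sym_group \<Omega>\<^esub> x = x"
    by (simp add: sym_group_def)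
next
  fix x assume "x \<in> carrier (sym_group \<Omega>)"
  then have x: "x \<in> Bij \<Omega>" by (simp add: sym_group_def)
  then have "compose \<Omega> x (\<lambda>y\<in>\<Omega>. inv_into \<Omega> x y) = (\<lambda>\<omega>\<in>\<Omega>. \<omega>)"
    by (auto simp: Bij_def bij_betw_def compose_def f_inv_into_f)
  with restrict_inv_into_Bij[OF x]
  show "\<exists>y\<in>carrier (sym_group \<Omega>). y \<otimes>\<^bsub>sym_group \<Omega>\<^esub> x = \<one>\<^bsub>sym_group \<Omega>\<^esub>"
    by (auto simp: sym_group_def)
qed (auto simp: sym_group_def compose_Bij id_Bij Bij_imp_extensional Bij_imp_funcset
    compose_assoc)

lemma mobius_comp:
  assumes "p * s - q * r \<noteq> (0::'a::field)" "p' * s' - q' * r' \<noteq> 0"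
  shows "mobius p' q' r' s' \<circ> mobius p q r s =
    mobius (p' * p + q' * r) (p' * q + q' * s) (r' * p + s' * r) (r' * q + s' * s)"
proof
  fix z
  show "(mobius p' q' r' s' \<circ> mobius p q r s) z =
    mobius (p' * p + q' * r) (p' * q + q' * s) (r' * p + s' * r) (r' * q + s' * s) z"
  proof (cases z)
    case None
    show ?thesis
    proof (cases "r = 0")
      case False
      then have "p' * (p / r) + q' = (p' * p + q' * r) / r"
        "r' * (p / r) + s' = (r' * p + s' * r) / r"
        by (simp_all add: field_simps)
      with None False show ?thesis by (simp add: divide_simps)
    qed (use None assms in auto)
  next
    case (Some x)
    define m n where "m = p * x + q" and "n = r * x + s"
    have eqs: "(p' * p + q' * r) * x + (p' * q + q' * s) = p' * m + q' * n"
      "(r' * p + s' * r) * x + (r' * q + s' * s) = r' * m + s' * n"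
      by (simp_all add: m_def n_def algebra_simps)
    have "p * n - r * m = p * s - q * r"
      by (simp add: m_def n_def algebra_simps)
    then have "m \<noteq> 0 \<or> n \<noteq> 0" using assms(1) by auto
    have lhs: "mobius p q r s z = (if n = 0 then None else Some (m / n))"
      by (simp add: Some m_def n_def)
    have rhs: "mobius (p' * p + q' * r) (p' * q + q' * s) (r' * p + s' * r) (r' * q + s' * s) z
      = (if r' * m + s' * n = 0 then None else Some ((p' * m + q' * n) / (r' * m + s' * n)))"
      by (simp add: Some eqs)
    show ?thesis
    proof (cases "n = 0")
      case False
      then have "p' * (m / n) + q' = (p' * m + q' * n) / n"
        "r' * (m / n) + s' = (r' * m + s' * n) / n"
        by (simp_all add: field_simps)
      with False show ?thesis unfolding comp_apply lhs rhs by (simp add: divide_simps)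
    qed (use \<open>m \<noteq> 0 \<or> n \<noteq> 0\<close> in \<open>simp add: lhs rhs\<close>)
  qed
qed

lemma mobius_scalar: "d \<noteq> 0 \<Longrightarrow> mobius d 0 0 d = id"
proof
  fix x assume "d \<noteq> 0" then show "mobius d 0 0 d x = id x" by (cases x) auto
qed

lemma mobius_inverse:
  assumes "p * s - q * r \<noteq> (0::'a::field)"
  shows "mobius s (-q) (-r) p \<circ> mobius p q r s = id"
    and "mobius p q r s \<circ> mobius s (-q) (-r) p = id"
proof -
  have "s * p - (-q) * (-r) \<noteq> 0" using assms by (simp add: algebra_simps)
  from mobius_comp[OF assms this] mobius_comp[OF this assms] mobius_scalar[OF assms]
  show "mobius s (-q) (-r) p \<circ> mobius p q r s = id"
    "mobius p q r s \<circ> mobius s (-q) (-r) p = id"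
    by (simp_all add: algebra_simps)
qed

lemma subgroup_T:
  "subgroup {mobius p q r s | p q r s. p * s - q * r \<noteq> (0::'a::field)} (sym_group UNIV)"
  (is "subgroup ?T _")
proof -
  interpret S: group "sym_group (UNIV :: 'a option set)" by (rule group_sym_group)
  have mult: "g \<otimes>\<^bsub>sym_group UNIV\<^esub> h = h \<circ> g" for g h :: "'a option \<Rightarrow> 'a option"
    by (auto simp: sym_group_def compose_def)
  have one: "\<one>\<^bsub>sym_group UNIV\<^esub> = (id :: 'a option \<Rightarrow> 'a option)"
    by (auto simp: sym_group_def)
  have sub: "?T \<subseteq> carrier (sym_group UNIV)"
    using mobius_inverse by (fastforce simp: sym_group_def Bij_def intro: o_bij)
  show ?thesis
  proof (rule S.subgroupI[OF sub])
    have "mobius 1 0 0 1 \<in> ?T"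
      by (intro CollectI exI[of _ "1::'a"] exI[of _ "0::'a"]
          conjI refl) simp
    then show "?T \<noteq> {}" by blast
  next
    fix x assume "x \<in> ?T"
    then obtain p q r s where x: "x = mobius p q r s" "p * s - q * r \<noteq> 0" by auto
    have y: "mobius s (-q) (-r) p \<in> ?T" using x(2)
      by (intro CollectI exI[of _ s] exI[of _ "-q"] exI[of _ "-r"] exI[of _ p])
         (simp add: algebra_simps)
    have "x \<in> carrier (sym_group UNIV)" "mobius s (-q) (-r) p \<in> carrier (sym_group UNIV)"
      using \<open>x \<in> ?T\<close> y sub by blast+
    then have "inv\<^bsub>sym_group UNIV\<^esub> x = mobius s (-q) (-r) p"
      by (rule S.inv_unique'[symmetric]) (simp_all only: mult one x(1) mobius_inverse[OF x(2)])
    with y show "inv\<^bsub>sym_group UNIV\<^esub> x \<in> ?T" by simp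
  next
    fix x y assume "x \<in> ?T" "y \<in> ?T"
    then obtain p q r s p' q' r' s' where xy: "x = mobius p q r s" "y = mobius p' q' r' s'"
      and d: "p * s - q * r \<noteq> 0" "p' * s' - q' * r' \<noteq> 0" by auto
    have "(p' * p + q' * r) * (r' * q + s' * s) - (p' * q + q' * s) * (r' * p + s' * r)
        = (p * s - q * r) * (p' * s' - q' * r')" by (simp add: algebra_simps)
    with d have "(p' * p + q' * r) * (r' * q + s' * s) - (p' * q + q' * s) * (r' * p + s' * r) \<noteq> 0"
      by simp
    then show "x \<otimes>\<^bsub>sym_group UNIV\<^esub> y \<in> ?T"
      unfolding mult xy mobius_comp[OF d] by blast
  qed
qed

lemma group_T: "group T_group"
  unfolding T_group_def by (rule group.subgroup_imp_group[OF group_sym_group subgroup_T])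

lemma group_swap_extension:
  assumes "group N" shows "group (swap_extension N)"
proof -
  interpret N: group N by fact
  show ?thesis
  proof (rule groupI)
    fix x assume "x \<in> carrier (swap_extension N)"
    then obtain n1 n2 e where x: "x = ((n1, n2), e)" "n1 \<in> carrier N" "n2 \<in> carrier N"
      by (auto simp: swap_extension_def DirProd_def)
    then show "\<exists>y\<in>carrier (swap_extension N). y \<otimes>\<^bsub>swap_extension N\<^esub> x = \<one>\<^bsub>swap_extension N\<^esub>"
      by (intro bexI[of _ "(if e then (inv\<^bsub>N\<^esub> n2, inv\<^bsub>N\<^esub> n1) else (inv\<^bsub>N\<^esub> n1, inv\<^bsub>N\<^esub> n2), e)"])
         (auto simp: swap_extension_def DirProd_def)
  qed (auto simp: swap_extension_def DirProd_def N.m_assoc split: if_splits)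
qed

lemma group_G: "group G_group"
  unfolding G_group_def by (rule group_swap_extension[OF group_T])

lemma snd_mult_G [simp]: "snd (x \<otimes>\<^bsub>G_group\<^esub> y) = (snd x \<noteq> snd y)"
  by (simp add: G_group_def swap_extension_def split: prod.splits)

lemma snd_one_G [simp]: "\<not> snd \<one>\<^bsub>G_group\<^esub>"
  by (simp add: G_group_def swap_extension_def)

lemma snd_inv_G: "x \<in> carrier G_group \<Longrightarrow> snd (inv\<^bsub>G_group\<^esub> x) = snd x"
proof -
  assume "x \<in> carrier G_group"
  then have "snd (inv\<^bsub>G_group\<^esub> x \<otimes>\<^bsub>G_group\<^esub> x) = snd (\<one>\<^bsub>G_group\<^esub> :: 'a G_elem)"
    by (simp add: group.l_inv[OF group_G])
  then show ?thesis by simp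
qed

lemma L_generators:
  "{((a_elt, a_elt), False), ((b_elt, b_elt), False)} \<subseteq> carrier (G_group :: 'a::field G_elem monoid)"
proof -
  have "a_elt \<in> carrier (T_group :: ('a option \<Rightarrow> _) monoid)"
    unfolding T_group_def a_elt_def
    by (simp, intro exI[of _ "1::'a"] exI[of _ "0::'a"]) auto
  moreover have "b_elt \<in> carrier (T_group :: ('a option \<Rightarrow> _) monoid)"
    unfolding T_group_def b_elt_def
    by (simp, rule exI[of _ "1::'a"], rule exI[of _ "1::'a"], rule exI[of _ "0::'a"],
        rule exI[of _ "1::'a"]) auto
  ultimately show ?thesis by (auto simp: G_group_def swap_extension_def DirProd_def)
qed

lemma snd_L: "l \<in> L_subgroup \<Longrightarrow> \<not> snd l"
  unfolding L_subgroup_def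
proof (induction rule: generate.induct)
  case one
  then show ?case by (simp add: G_group_def swap_extension_def)
next
  case (inv h)
  then have "h \<in> carrier G_group" using L_generators by blast
  from snd_inv_G[OF this] inv show ?case by auto
qed auto

lemma bipartite_half_Gamma:
  "bipartite_half (Gamma \<alpha>) {C \<in> pverts (Gamma \<alpha>). \<exists>x\<in>C. \<not> snd x}"
proof -
  have one: "\<one>\<^bsub>G_group\<^esub> \<in> (L_subgroup :: 'a G_elem set)"
    unfolding L_subgroup_def by (rule generate.one)
  have half: "(\<exists>y\<in>L_subgroup #>\<^bsub>G_group\<^esub> x. \<not> snd y) \<longleftrightarrow> \<not> snd x" for x :: "'a G_elem"
    using one snd_L unfolding r_coset_def by (simp del: split_paired_Ex) blast
  have D: "snd d" if d: "d \<in> double_coset G_group L_subgroup (g_elt \<alpha>)" for d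
  proof -
    obtain l k where "l \<in> L_subgroup" "k \<in> L_subgroup"
      and "d = l \<otimes>\<^bsub>G_group\<^esub> g_elt \<alpha> \<otimes>\<^bsub>G_group\<^esub> k"
      using d unfolding double_coset_def r_coset_def set_mult_def by blast
    then show ?thesis using snd_L[of l] snd_L[of k] by (simp add: g_elt_def pi_elt_def)
  qed
  show ?thesis
    unfolding bipartite_half_def
  proof (intro conjI ballI, blast, clarify)
    fix v w assume "(v, w) \<in> parcs (Gamma \<alpha>)"
    then obtain x1 x2 where vw: "v = L_subgroup #>\<^bsub>G_group\<^esub> x1" "w = L_subgroup #>\<^bsub>G_group\<^esub> x2"
      and x: "x1 \<in> carrier G_group" "x2 \<in> carrier G_group"
        "x2 \<otimes>\<^bsub>G_group\<^esub> inv\<^bsub>G_group\<^esub> x1 \<in> double_coset G_group L_subgroup (g_elt \<alpha>)"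
      by (auto simp: Gamma_def coset_graph_def)
    from x have "snd x1 \<noteq> snd x2" using D[OF x(3)] snd_inv_G[OF x(1)] by auto
    moreover have "v \<in> pverts (Gamma \<alpha>)" "w \<in> pverts (Gamma \<alpha>)"
      using x vw by (auto simp: Gamma_def coset_graph_def RCOSETS_def)
    ultimately show "(v \<in> {C \<in> pverts (Gamma \<alpha>). \<exists>x\<in>C. \<not> snd x}) =
        (w \<notin> {C \<in> pverts (Gamma \<alpha>). \<exists>x\<in>C. \<not> snd x})"
      using half by (auto simp: vw)
  qed
qed

end

theory Submission
  imports Defs "HOL-Combinatorics.Permutations"
begin

text \<open>The map \<open>z: L x \<mapsto> L \<pi> x\<close> is an automorphism of \<open>\<Gamma>\<close> commuting with \<open>G\<close>, because \<open>\<pi>\<close>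
  centralises \<open>L\<close> and \<open>\<pi> g\<^sub>\<alpha> \<pi> = (b, b) g\<^sub>\<alpha>\<close>. The group \<open>G \<times> \<langle>z\<rangle>\<close> is transitive on 3-arcs, so
  everything rests on the fact that an automorphism fixing a 3-arc is trivial. If \<open>s\<close> is the length
  of the shortest arcs with trivial pointwise stabiliser and \<open>s \<ge> 4\<close>, then the involutions \<open>x\<^sub>i\<close>
  fixing the \<open>(s-1)\<close>-arcs of a line can be analysed as in Tutte's theorem: the least \<open>\<lambda>\<close> such
  that \<open>x\<^sub>0\<close> and \<open>x\<^sub>\<lambda>\<close> do not commute satisfies \<open>2 s - 2 \<le> 3 \<lambda>\<close> and \<open>2 \<lambda> \<le> s + 1\<close>, which leaves
  \<open>s - 1 - \<lambda> \<in> {1, 2}\<close>. An element whose fixed part of the line is exactly an arc of length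
  \<open>s - 1 - \<lambda>\<close> cannot be an involution, but \<open>(b, b)\<close> and \<open>L x \<mapsto> L \<pi> x \<pi>\<close> are involutions with
  fixed parts of length 1 and 2. Hence \<open>Aut(\<Gamma>) = G \<times> \<langle>z\<rangle>\<close>. The orbits of \<open>\<langle>z\<rangle>\<close> refute
  biquasiprimitivity, and \<open>A\<^sup>+ \<cong> T\<^sup>2 \<rtimes> C\<^sub>2\<close> has \<open>T\<^sup>2\<close> as its least nontrivial normal subgroup
  because \<open>T\<close> is simple for \<open>f \<ge> 2\<close>; for \<open>f = 1\<close> the graph is not connected.\<close>

section \<open>Finite cubic graphs with a line of vertices\<close>

text \<open>Write l for \<lambda>. The two inequalities leave only (s, l) = (4, 2), (5, 3) and (7,
  4), so by themselves they do not bring s down to 3: the involution with fixed part of length 1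
  rules out the first two pairs, the one with fixed part of length 2 the third. The upper bound on l
  comes from the middle involution: an element that fixes an edge and commutes with enough of the
  \<open>x i\<close> is trivial. The lower bound comes from the commutator of \<open>x 0\<close> and
  \<open>x l\<close>: it is not trivial, so it cannot fix an arc of length s, although it fixes more
  than the overlap of the arcs of its two factors. The number s - 1 - l is the length of that
  overlap, which is why an element fixing exactly such an arc can be compared with the product of
  \<open>x 0\<close> and \<open>x l\<close>. The line may repeat vertices, so every argument is
  local: valency three leaves a single vertex to which the next vertex after a fixed arc can be
  moved. No automorphism reversing the line is assumed, so the mirror image of the commutator
  estimate comes from applying the locales to the reversed line.\<close>

text \<open>The vertices \<open>a i\<close> need not be distinct: in the application the line winds around a cycle
  of a finite graph. The assumption \<open>rigid\<close> combines connectedness with faithfulness.\<close>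

locale cubic_line =
  fixes E :: "'v \<Rightarrow> 'v \<Rightarrow> bool" and A :: "('v \<Rightarrow> 'v) set" and a :: "int \<Rightarrow> 'v"
  assumes adj_sym: "E v w \<Longrightarrow> E w v"
    and cubic: "\<lbrakk>E v p; E v q; E v r; E v t; p \<noteq> q; p \<noteq> r; p \<noteq> t; q \<noteq> r; q \<noteq> t\<rbrakk> \<Longrightarrow> r = t"
    and finite_A: "finite A"
    and id_A: "id \<in> A"
    and comp_A: "\<lbrakk>h \<in> A; k \<in> A\<rbrakk> \<Longrightarrow> h \<circ> k \<in> A"
    and inv_A: "h \<in> A \<Longrightarrow> \<exists>k\<in>A. h \<circ> k = id \<and> k \<circ> h = id"
    and adj_A: "\<lbrakk>h \<in> A; E v w\<rbrakk> \<Longrightarrow> E (h v) (h w)"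
    and line_adj: "E (a i) (a (i + 1))"
    and line_arc: "a (i - 1) \<noteq> a (i + 1)"
    and shunt: "\<exists>k\<in>A. \<forall>j. k (a j) = a (i + j)"
    and rigid: "\<lbrakk>h \<in> A; a 0 \<in> W; \<And>v w. v \<in> W \<Longrightarrow> E v w \<Longrightarrow> w \<in> W; \<And>v. v \<in> W \<Longrightarrow> h v = v\<rbrakk> \<Longrightarrow> h = id"
begin

definition fixes_arc :: "('v \<Rightarrow> 'v) \<Rightarrow> int \<Rightarrow> int \<Rightarrow> bool" where
  "fixes_arc h i j \<longleftrightarrow> h \<in> A \<and> (\<forall>t. i \<le> t \<and> t \<le> j \<longrightarrow> h (a t) = a t)"

lemma fixes_arcD: "\<lbrakk>fixes_arc h i j; i \<le> t; t \<le> j\<rbrakk> \<Longrightarrow> h (a t) = a t"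
  by (simp add: fixes_arc_def)

lemma fixes_arc_A: "fixes_arc h i j \<Longrightarrow> h \<in> A"
  by (simp add: fixes_arc_def)

lemma fixes_arc_comp: "\<lbrakk>fixes_arc h i j; fixes_arc k i j\<rbrakk> \<Longrightarrow> fixes_arc (h \<circ> k) i j"
  by (simp add: fixes_arc_def comp_A)

lemma fixes_arc_mono: "\<lbrakk>fixes_arc h i j; i \<le> i'; j' \<le> j\<rbrakk> \<Longrightarrow> fixes_arc h i' j'"
  by (simp add: fixes_arc_def)

lemma fixes_arc_right:
  assumes "fixes_arc h i j" "h (a (j + 1)) = a (j + 1)"
  shows "fixes_arc h i (j + 1)"
  unfolding fixes_arc_def
proof (intro conjI allI impI)
  fix t assume "i \<le> t \<and> t \<le> j + 1"
  then have "t = j + 1 \<or> i \<le> t \<and> t \<le> j" by linarith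
  then show "h (a t) = a t" using assms by (auto simp: fixes_arc_def)
qed (use assms in \<open>simp add: fixes_arc_def\<close>)

lemma fixes_arc_left:
  assumes "fixes_arc h i j" "h (a (i - 1)) = a (i - 1)"
  shows "fixes_arc h (i - 1) j"
  unfolding fixes_arc_def
proof (intro conjI allI impI)
  fix t assume "i - 1 \<le> t \<and> t \<le> j"
  then have "t = i - 1 \<or> i \<le> t \<and> t \<le> j" by linarith
  then show "h (a t) = a t" using assms by (auto simp: fixes_arc_def)
qed (use assms in \<open>simp add: fixes_arc_def\<close>)

lemma inj_A: "\<lbrakk>h \<in> A; h v = h w\<rbrakk> \<Longrightarrow> v = w"
  by (metis inv_A comp_apply id_apply)

lemma line_adj': "E (a i) (a (i - 1))"
  using line_adj[of "i - 1"] adj_sym by simp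

lemma line_arc': "a (i + 1) \<noteq> a (i - 1)"
  using line_arc by metis

lemma fixes_arc_inv:
  assumes "fixes_arc h i j" "k \<in> A" "k \<circ> h = id"
  shows "fixes_arc k i j"
  unfolding fixes_arc_def
proof (intro conjI allI impI)
  fix t assume "i \<le> t \<and> t \<le> j"
  then have "k (a t) = (k \<circ> h) (a t)" using assms(1) by (simp add: fixes_arc_def)
  then show "k (a t) = a t" by (simp add: assms)
qed (rule assms)

lemma fixes_arc_shift:
  assumes h: "fixes_arc h i j" and k: "k \<in> A" "\<And>t. k (a t) = a (d + t)"
    and k': "k' \<in> A" "k \<circ> k' = id" "k' \<circ> k = id"
  shows "fixes_arc (k \<circ> h \<circ> k') (d + i) (d + j)"
  unfolding fixes_arc_def
proof (intro conjI allI impI)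
  fix t assume t: "d + i \<le> t \<and> t \<le> d + j"
  have "k' (a t) = k' (k (a (t - d)))" by (simp add: k)
  also have "\<dots> = a (t - d)" using k'(3) by (metis comp_apply id_apply)
  finally show "(k \<circ> h \<circ> k') (a t) = a t"
    using t h by (simp add: fixes_arc_def k)
qed (use assms in \<open>simp add: fixes_arc_def comp_A\<close>)

lemma shunt_inv:
  obtains k k' where "k \<in> A" "\<And>t. k (a t) = a (d + t)" "k' \<in> A" "k \<circ> k' = id" "k' \<circ> k = id"
    "\<And>t. k' (a t) = a (t - d)"
proof -
  obtain k where k: "k \<in> A" "\<And>t. k (a t) = a (d + t)" using shunt[of d] by auto
  obtain k' where k': "k' \<in> A" "k \<circ> k' = id" "k' \<circ> k = id" using inv_A[OF k(1)] by auto
  have "k' (a t) = a (t - d)" for t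
    using k(2)[of "t - d"] fun_cong[OF k'(3), of "a (t - d)"] by simp
  with k k' that show ?thesis by blast
qed

text \<open>Among the at most three neighbours of \<open>a j\<close>, \<open>a (j - 1)\<close> is
  fixed and \<open>a (j + 1)\<close> is moved, so both maps must send \<open>a (j + 1)\<close> to
  the one that remains. All later cancellations of one automorphism against another rest on
  this.\<close>

lemma move_right_unique:
  assumes "fixes_arc h (j - 1) j" "fixes_arc k (j - 1) j"
    "h (a (j + 1)) \<noteq> a (j + 1)" "k (a (j + 1)) \<noteq> a (j + 1)"
  shows "h (a (j + 1)) = k (a (j + 1))"
proof -
  have f: "h (a j) = a j" "k (a j) = a j" "h (a (j - 1)) = a (j - 1)" "k (a (j - 1)) = a (j - 1)"
    using assms(1,2) by (simp_all add: fixes_arc_def)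
  have A: "h \<in> A" "k \<in> A" using assms(1,2) by (simp_all add: fixes_arc_def)
  have "E (a j) (h (a (j + 1)))" "E (a j) (k (a (j + 1)))"
    using adj_A[OF A(1) line_adj[of j]] adj_A[OF A(2) line_adj[of j]] f by simp_all
  moreover have "a (j - 1) \<noteq> h (a (j + 1))" "a (j - 1) \<noteq> k (a (j + 1))"
    using inj_A[OF A(1), of "a (j - 1)" "a (j + 1)"] inj_A[OF A(2), of "a (j - 1)" "a (j + 1)"]
      line_arc[of j] f by auto
  ultimately show ?thesis
    using cubic[of "a j" "a (j - 1)" "a (j + 1)" "h (a (j + 1))" "k (a (j + 1))"]
      line_adj[of j] line_adj'[of j] assms(3,4) line_arc[of j] by simp
qed

lemma move_left_unique:
  assumes "fixes_arc h j (j + 1)" "fixes_arc k j (j + 1)"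
    "h (a (j - 1)) \<noteq> a (j - 1)" "k (a (j - 1)) \<noteq> a (j - 1)"
  shows "h (a (j - 1)) = k (a (j - 1))"
proof -
  have f: "h (a j) = a j" "k (a j) = a j" "h (a (j + 1)) = a (j + 1)" "k (a (j + 1)) = a (j + 1)"
    using assms(1,2) by (simp_all add: fixes_arc_def)
  have A: "h \<in> A" "k \<in> A" using assms(1,2) by (simp_all add: fixes_arc_def)
  have "E (a j) (h (a (j - 1)))" "E (a j) (k (a (j - 1)))"
    using adj_A[OF A(1) line_adj'[of j]] adj_A[OF A(2) line_adj'[of j]] f by simp_all
  moreover have "a (j + 1) \<noteq> h (a (j - 1))" "a (j + 1) \<noteq> k (a (j - 1))"
    using inj_A[OF A(1), of "a (j + 1)" "a (j - 1)"] inj_A[OF A(2), of "a (j + 1)" "a (j - 1)"]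
      line_arc[of j] f by auto
  ultimately show ?thesis
    using cubic[of "a j" "a (j + 1)" "a (j - 1)" "h (a (j - 1))" "k (a (j - 1))"]
      line_adj[of j] line_adj'[of j] assms(3,4) line_arc'[of j] by simp
qed

text \<open>A set closed under adjacency contains the whole line as soon as it contains one
  \<open>a i\<close>, so the base vertex of \<open>rigid\<close> may be any vertex of the
  line.\<close>

lemma rigid':
  assumes "h \<in> A" "a i \<in> W" "\<And>v w. v \<in> W \<Longrightarrow> E v w \<Longrightarrow> w \<in> W" "\<And>v. v \<in> W \<Longrightarrow> h v = v"
  shows "h = id"
proof (rule rigid[OF assms(1) _ assms(3,4)])
  have up: "a (i + int n) \<in> W" for n
  proof (induction n)
    case (Suc n)
    then show ?case using assms(3)[OF Suc line_adj] by (simp add: algebra_simps)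
  qed (simp add: assms)
  have down: "a (i - int n) \<in> W" for n
  proof (induction n)
    case (Suc n)
    then show ?case using assms(3)[OF Suc line_adj'] by (simp add: algebra_simps)
  qed (simp add: assms)
  show "a 0 \<in> W" using up[of "nat (- i)"] down[of "nat i"] by (cases "i \<le> 0") auto
qed

text \<open>The group need not contain a map that reverses the line; the left-right symmetry lies in
  the assumptions, not in an automorphism.\<close>

lemma reflect_cubic_line: "cubic_line E A (\<lambda>i. a (- i))"
proof
  fix i :: int
  have e: "- (i + 1) = - i - 1" "- (i - 1) = - i + 1" by simp_all
  show "E (a (- i)) (a (- (i + 1)))" unfolding e by (rule line_adj')
  show "a (- (i - 1)) \<noteq> a (- (i + 1))" unfolding e by (rule line_arc')
next
  fix i :: int
  obtain k where k: "k \<in> A" "\<And>j. k (a j) = a (- i + j)" using shunt[of "- i"] by blast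
  have "k (a (- j)) = a (- (i + j))" for j
  proof -
    have "- i + - j = - (i + j)" by simp
    then show ?thesis using k(2)[of "- j"] by metis
  qed
  with k(1) show "\<exists>k\<in>A. \<forall>j. k (a (- j)) = a (- (i + j))" by blast
next
  show "\<And>h W. \<lbrakk>h \<in> A; a (- 0) \<in> W; \<And>v w. v \<in> W \<Longrightarrow> E v w \<Longrightarrow> w \<in> W; \<And>v. v \<in> W \<Longrightarrow> h v = v\<rbrakk> \<Longrightarrow> h = id"
    using rigid by simp
  show "\<And>v p q r t. \<lbrakk>E v p; E v q; E v r; E v t; p \<noteq> q; p \<noteq> r; p \<noteq> t; q \<noteq> r; q \<noteq> t\<rbrakk> \<Longrightarrow> r = t"
    by (rule cubic)
qed (simp_all add: adj_sym finite_A id_A comp_A inv_A adj_A)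

lemma fixes_arc_reflect:
  "cubic_line.fixes_arc A (\<lambda>i. a (- i)) h i j \<longleftrightarrow> fixes_arc h (- j) (- i)"
proof -
  interpret R: cubic_line E A "\<lambda>i. a (- i)" by (rule reflect_cubic_line)
  have "(\<forall>t. i \<le> t \<and> t \<le> j \<longrightarrow> P (- t)) \<longleftrightarrow> (\<forall>t. - j \<le> t \<and> t \<le> - i \<longrightarrow> P t)" for P
    by (metis minus_le_iff neg_le_iff_le minus_minus)
  from this[of "\<lambda>t. h (a t) = a t"] show ?thesis
    unfolding R.fixes_arc_def fixes_arc_def by simp
qed

end

text \<open>Here \<open>s\<close> is the least length of an arc with trivial pointwise stabiliser, and \<open>x i\<close> is the
  nontrivial element of the stabiliser of \<open>(a i, \<dots>, a (i + s - 1))\<close>.\<close>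

locale tutte_line = cubic_line +
  fixes s :: int and x :: "int \<Rightarrow> 'a \<Rightarrow> 'a"
  assumes s4: "4 \<le> s"
    and x_fixes: "fixes_arc (x i) i (i + s - 1)"
    and x_right: "x i (a (i + s)) \<noteq> a (i + s)"
    and x_left: "x i (a (i - 1)) \<noteq> a (i - 1)"
    and arc_trivial: "fixes_arc h i (i + s) \<Longrightarrow> h = id"
begin

lemma x_A: "x i \<in> A"
  by (rule fixes_arc_A[OF x_fixes])

lemma x_fix: "\<lbrakk>i \<le> t; t \<le> i + s - 1\<rbrakk> \<Longrightarrow> x i (a t) = a t"
  by (rule fixes_arcD[OF x_fixes])

lemma arc_trivial': "\<lbrakk>fixes_arc h i j; i + s \<le> j\<rbrakk> \<Longrightarrow> h = id"
  by (rule arc_trivial[of h i]) (rule fixes_arc_mono, auto)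

text \<open>On the reversed line the arc from index \<open>i\<close> to \<open>i + s - 1\<close> is
  the old arc from \<open>1 - s - i\<close> to \<open>- i\<close>, whence the new numbering of the
  involutions.\<close>

lemma reflect: "tutte_line E A (\<lambda>i. a (- i)) s (\<lambda>i. x (1 - s - i))"
proof -
  interpret R: cubic_line E A "\<lambda>i. a (- i)" by (rule reflect_cubic_line)
  show ?thesis
  proof
    show "R.fixes_arc (x (1 - s - i)) i (i + s - 1)" for i
      using x_fixes[of "1 - s - i"] by (simp add: fixes_arc_reflect algebra_simps)
    show "x (1 - s - i) (a (- (i + s))) \<noteq> a (- (i + s))" for i
      using x_left[of "1 - s - i"] by (simp add: algebra_simps)
    show "x (1 - s - i) (a (- (i - 1))) \<noteq> a (- (i - 1))" for i
      using x_right[of "1 - s - i"] by (simp add: algebra_simps)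
    show "R.fixes_arc h i (i + s) \<Longrightarrow> h = id" for h i
      using arc_trivial[of h "- i - s"] by (simp add: fixes_arc_reflect)
  qed (rule s4)
qed

text \<open>\<open>x i\<close> and its inverse both move \<open>a (i + s)\<close>, and there is only
  one vertex to move it to; hence the square fixes \<open>a (i + s)\<close> too, and with it an arc
  of length \<open>s\<close>.\<close>

lemma x_invol: "x i \<circ> x i = id"
proof -
  obtain y where y: "y \<in> A" "x i \<circ> y = id" "y \<circ> x i = id" using inv_A[OF x_A] by blast
  have fy: "fixes_arc y i (i + s - 1)" by (rule fixes_arc_inv[OF x_fixes y(1,3)])
  have xy: "x i (y v) = v" for v using y(2) by (metis comp_apply id_apply)
  have "y (a (i + s)) \<noteq> a (i + s)"
    using xy[of "a (i + s)"] x_right[of i] by auto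
  then have "y (a (i + s)) = x i (a (i + s))"
    using move_right_unique[of y "i + s - 1" "x i"] fixes_arc_mono[OF fy, of "i + s - 2" "i + s - 1"]
      fixes_arc_mono[OF x_fixes[of i], of "i + s - 2" "i + s - 1"] s4 x_right[of i] xy[of "a (i + s)"]
    by auto
  then have "(x i \<circ> x i) (a (i + s)) = a (i + s)" using xy[of "a (i + s)"] by simp
  then have "fixes_arc (x i \<circ> x i) i (i + s)"
    using fixes_arc_right[OF fixes_arc_comp[OF x_fixes x_fixes], of i] by simp
  then show ?thesis by (rule arc_trivial)
qed

lemma x_x [simp]: "x i (x i v) = v"
  using x_invol by (metis comp_apply id_apply)

text \<open>Both maps send \<open>a (i + s)\<close> to the same vertex, so the involution
  \<open>x i\<close> moves it back. The bound \<open>q \<le> i + s - 2\<close> guarantees the two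
  fixed vertices that \<open>move_right_unique\<close> needs.\<close>

lemma reduce_right:
  assumes h: "fixes_arc h q (i + s - 1)" and "i \<le> q" "q \<le> i + s - 2" and m: "h (a (i + s)) \<noteq> a (i + s)"
  shows "fixes_arc (x i \<circ> h) q (i + s)"
proof -
  have "h (a (i + s)) = x i (a (i + s))"
    using move_right_unique[of h "i + s - 1" "x i"] fixes_arc_mono[OF h, of "i + s - 2" "i + s - 1"]
      fixes_arc_mono[OF x_fixes[of i], of "i + s - 2" "i + s - 1"] s4 x_right[of i] m assms(2,3)
    by auto
  then have "(x i \<circ> h) (a (i + s)) = a (i + s)" by simp
  moreover have "fixes_arc (x i \<circ> h) q (i + s - 1)"
    using fixes_arc_comp[OF _ h, of "x i"] fixes_arc_mono[OF x_fixes[of i]] assms(2) by blast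
  ultimately show ?thesis using fixes_arc_right[of _ q "i + s - 1"] by simp
qed

lemma reduce_left:
  assumes h: "fixes_arc h i q" and "q \<le> i + s - 1" "i + 1 \<le> q" and m: "h (a (i - 1)) \<noteq> a (i - 1)"
  shows "fixes_arc (x i \<circ> h) (i - 1) q"
proof -
  have "h (a (i - 1)) = x i (a (i - 1))"
    using move_left_unique[of h i "x i"] fixes_arc_mono[OF h, of i "i + 1"]
      fixes_arc_mono[OF x_fixes[of i], of i "i + 1"] s4 x_left[of i] m assms(2,3)
    by auto
  then have "(x i \<circ> h) (a (i - 1)) = a (i - 1)" by simp
  moreover have "fixes_arc (x i \<circ> h) i q"
    using fixes_arc_comp[OF _ h, of "x i"] fixes_arc_mono[OF x_fixes[of i]] assms(2) by blast
  ultimately show ?thesis by (rule fixes_arc_left[rotated])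
qed

lemma x_unique:
  assumes "fixes_arc h i (i + s - 1)" "h \<noteq> id"
  shows "h = x i"
proof -
  have "h (a (i + s)) \<noteq> a (i + s)"
    using arc_trivial[of h i] fixes_arc_right[OF assms(1)] assms(2) by auto
  then have "x i \<circ> h = id" using arc_trivial[OF reduce_right[of h i i]] assms s4 by simp
  then have "x i \<circ> (x i \<circ> h) = x i" by simp
  then show ?thesis by (simp add: fun_eq_iff)
qed

text \<open>The stabiliser of \<open>a q, ..., a (p + s - 1)\<close> is generated by
  \<open>x p, ..., x q\<close>: composing with \<open>x p\<close>, if necessary, fixes one vertex
  more, and for \<open>p = q + 1\<close> the arc has length \<open>s\<close> and only
  \<open>id\<close> is left. The induction rule takes the place of the generated subgroup.\<close>

lemma stab_induct:
  assumes "fixes_arc h q (p + s - 1)" "p \<le> q + 1" "q \<le> p + s - 2"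
    and "P id" "\<And>t k. \<lbrakk>p \<le> t; t \<le> q; k \<in> A; P k\<rbrakk> \<Longrightarrow> P (x t \<circ> k)"
  shows "P h"
  using assms
proof (induction "nat (q + 1 - p)" arbitrary: p h)
  case 0
  then have "h = id" using arc_trivial'[of h q "p + s - 1"] by simp
  with 0 show ?case by simp
next
  case (Suc n)
  have IH: "P k" if k: "fixes_arc k q (p + s)" for k
  proof (rule Suc.hyps(1)[of "p + 1"])
    show "n = nat (q + 1 - (p + 1))" using Suc.hyps(2) by linarith
    show "fixes_arc k q (p + 1 + s - 1)" using k by (simp add: algebra_simps)
    show "p + 1 \<le> q + 1" using Suc.hyps(2) by linarith
    show "q \<le> p + 1 + s - 2" using Suc.prems by linarith
    show "P id" by (rule Suc.prems)
    show "P (x t \<circ> k)" if "p + 1 \<le> t" "t \<le> q" "k \<in> A" "P k" for t k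
      using Suc.prems(5)[of t k] that by simp
  qed
  have pq: "p \<le> q" using Suc.hyps(2) by linarith
  show ?case
  proof (cases "h (a (p + s)) = a (p + s)")
    case True
    then show ?thesis using IH[of h] fixes_arc_right[OF Suc.prems(1)] by simp
  next
    case False
    have f: "fixes_arc (x p \<circ> h) q (p + s)"
      by (rule reduce_right) (use Suc.prems pq False in auto)
    have "P (x p \<circ> (x p \<circ> h))"
      using Suc.prems(5)[OF order_refl pq fixes_arc_A[OF f] IH[OF f]] .
    moreover have "x p \<circ> (x p \<circ> h) = h" by (simp add: fun_eq_iff)
    ultimately show ?thesis by simp
  qed
qed

lemma commute_stab:
  assumes "fixes_arc h q (p + s - 1)" "p \<le> q + 1" "q \<le> p + s - 2"
    and "\<And>t. \<lbrakk>p \<le> t; t \<le> q\<rbrakk> \<Longrightarrow> y \<circ> x t = x t \<circ> y"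
  shows "y \<circ> h = h \<circ> y"
  using assms(1-3)
proof (rule stab_induct)
  fix t k assume t: "p \<le> t" "t \<le> q" and k: "y \<circ> k = k \<circ> y"
  have "y \<circ> (x t \<circ> k) = x t \<circ> (y \<circ> k)" using assms(4)[OF t] by (metis comp_assoc)
  then show "y \<circ> (x t \<circ> k) = x t \<circ> k \<circ> y" using k by (metis comp_assoc)
qed simp

text \<open>Commuting involutions generate an elementary abelian 2-group. The induction also carries
  along that the element commutes with every generator.\<close>

lemma square_stab:
  assumes "fixes_arc h q (p + s - 1)" "p \<le> q + 1" "q \<le> p + s - 2"
    and "\<And>t u. \<lbrakk>p \<le> t; t \<le> q; p \<le> u; u \<le> q\<rbrakk> \<Longrightarrow> x t \<circ> x u = x u \<circ> x t"
  shows "h \<circ> h = id"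
proof -
  have "(\<forall>t. p \<le> t \<and> t \<le> q \<longrightarrow> x t \<circ> h = h \<circ> x t) \<and> h \<circ> h = id"
    using assms(1-3)
  proof (rule stab_induct)
    fix t k assume t: "p \<le> t" "t \<le> q"
      and k: "(\<forall>t. p \<le> t \<and> t \<le> q \<longrightarrow> x t \<circ> k = k \<circ> x t) \<and> k \<circ> k = id"
    have "x u \<circ> (x t \<circ> k) = x t \<circ> k \<circ> x u" if u: "p \<le> u" "u \<le> q" for u
    proof -
      have "x u \<circ> (x t \<circ> k) = x t \<circ> (x u \<circ> k)" using assms(4)[OF u t] by (metis comp_assoc)
      then show ?thesis using k u by (metis comp_assoc)
    qed
    moreover have "(x t \<circ> k) \<circ> (x t \<circ> k) = id"
    proof -
      have "(x t \<circ> k) \<circ> (x t \<circ> k) = x t \<circ> (k \<circ> x t) \<circ> k" by (simp add: comp_assoc)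
      also have "\<dots> = (x t \<circ> x t) \<circ> (k \<circ> k)" using k t by (metis comp_assoc)
      finally show ?thesis using k by (simp add: x_invol)
    qed
    ultimately show "(\<forall>u. p \<le> u \<and> u \<le> q \<longrightarrow> x u \<circ> (x t \<circ> k) = x t \<circ> k \<circ> x u) \<and>
        (x t \<circ> k) \<circ> (x t \<circ> k) = id" by blast
  qed simp
  then show ?thesis by blast
qed

section \<open>Commutation among the involutions \<open>x i\<close>\<close>

lemma x_shift:
  assumes "k \<in> A" "\<And>t. k (a t) = a (d + t)" "k' \<in> A" "k \<circ> k' = id" "k' \<circ> k = id"
  shows "x (d + i) = k \<circ> x i \<circ> k'"
proof (rule x_unique[symmetric])
  show "fixes_arc (k \<circ> x i \<circ> k') (d + i) (d + i + s - 1)"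
    using fixes_arc_shift[OF x_fixes[of i] assms] by (simp add: algebra_simps)
  show "k \<circ> x i \<circ> k' \<noteq> id"
  proof
    assume "k \<circ> x i \<circ> k' = id"
    then have "k' \<circ> (k \<circ> x i \<circ> k') \<circ> k = id" using assms by simp
    then have "x i = id" using assms(5) by (metis comp_assoc comp_id id_comp)
    then show False using x_right[of i] by simp
  qed
qed

text \<open>The shunt makes commutation of \<open>x i\<close> and \<open>x j\<close> depend on
  \<open>j - i\<close> only, so one integer argument suffices; see \<open>com_iff\<close>.\<close>

definition com :: "int \<Rightarrow> bool" where
  "com n \<longleftrightarrow> x 0 \<circ> x n = x n \<circ> x 0"

lemma com_iff: "x i \<circ> x j = x j \<circ> x i \<longleftrightarrow> com (j - i)"
proof -
  obtain k k' where k: "k \<in> A" "\<And>t. k (a t) = a (i + t)" "k' \<in> A" "k \<circ> k' = id" "k' \<circ> k = id"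
    using shunt_inv[of i] by metis
  have kk: "k (k' v) = v" "k' (k v) = v" for v using k(4,5) by (metis comp_apply id_apply)+
  have "x i = k \<circ> x 0 \<circ> k'" "x j = k \<circ> x (j - i) \<circ> k'"
    using x_shift[OF k, of 0] x_shift[OF k, of "j - i"] by simp_all
  then show ?thesis unfolding com_def fun_eq_iff comp_apply by (metis kk)
qed

lemma com_minus: "com (- n) \<longleftrightarrow> com n"
  using com_iff[of 0 n] com_iff[of n 0] by auto

text \<open>Let \<open>C\<close> be the centraliser of \<open>y\<close>. Then \<open>y\<close> fixes
  pointwise the \<open>C\<close>-orbit \<open>W\<close> of the two ends of the edge from
  \<open>a (s - 1)\<close> to \<open>a s\<close>. The four involutions in \<open>C\<close> already
  carry these ends to all their neighbours, so \<open>W\<close> is closed under adjacency and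
  \<open>rigid'\<close> applies.\<close>

lemma centralizer_trivial:
  assumes y: "y \<in> A" "y (a (s - 1)) = a (s - 1)" "y (a s) = a s"
    and com: "\<And>t. t \<in> {0, 1, s - 1, s} \<Longrightarrow> y \<circ> x t = x t \<circ> y"
  shows "y = id"
proof -
  define C where "C = {h \<in> A. y \<circ> h = h \<circ> y}"
  define W where "W = {h v | h v. h \<in> C \<and> v \<in> {a (s - 1), a s}}"
  have C_comp: "h \<circ> k \<in> C" if "h \<in> C" "k \<in> C" for h k
    using that unfolding C_def by (simp add: comp_A) (metis comp_assoc)
  have xC: "x t \<in> C" if "t \<in> {0, 1, s - 1, s}" for t
    using com[OF that] x_A by (simp add: C_def)
  have idC: "id \<in> C" by (simp add: C_def id_A)
  have "v \<in> W" if "v \<in> {a (s - 1), a s}" for v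
    using idC that unfolding W_def by (intro CollectI exI[of _ id] exI[of _ v]) simp
  then have W0: "a (s - 1) \<in> W" "a s \<in> W" by simp_all
  have WC: "h v \<in> W" if "h \<in> C" "v \<in> W" for h v
  proof -
    from that(2) obtain k u where "k \<in> C" "u \<in> {a (s - 1), a s}" "v = k u"
      unfolding W_def by blast
    then have "h v = (h \<circ> k) u" "h \<circ> k \<in> C" "u \<in> {a (s - 1), a s}" using C_comp that by auto
    then show ?thesis unfolding W_def by blast
  qed
  have nb1: "w \<in> W" if "E (a (s - 1)) w" for w
  proof (rule ccontr)
    assume nw: "w \<notin> W"
    have E1: "E (a (s - 1)) (a s)" using line_adj[of "s - 1"] by simp
    have E2: "E (a (s - 1)) (x 0 (a s))"
      using adj_A[OF x_A[of 0] E1] x_fix[of 0 "s - 1"] s4 by simp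
    have E3: "E (a (s - 1)) (a (s - 2))" using line_adj'[of "s - 1"] by simp
    have d: "a s \<noteq> x 0 (a s)" using x_right[of 0] by simp
    have x0W: "x 0 (a s) \<in> W" using WC[OF xC[of 0] W0(2)] by simp
    \<comment> \<open>\<open>x (s - 1)\<close> interchanges \<open>a (s - 2)\<close> with the third
      neighbour of \<open>a (s - 1)\<close>. That third neighbour is \<open>x 0 (a s)\<close>, which
      is already in \<open>W\<close>.\<close>
    have "x (s - 1) (a (s - 2)) \<in> W"
    proof -
      have fs: "x (s - 1) (a s) = a s" "x (s - 1) (a (s - 1)) = a (s - 1)"
        using x_fix[of "s - 1"] s4 by simp_all
      have "E (a (s - 1)) (x (s - 1) (a (s - 2)))"
        using adj_A[OF x_A[of "s - 1"] E3] fs by simp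
      moreover have "x (s - 1) (a (s - 2)) \<noteq> a (s - 2)" using x_left[of "s - 1"] by simp
      moreover have "x (s - 1) (a (s - 2)) \<noteq> a s"
        using inj_A[OF x_A, of "s - 1" "a (s - 2)" "a s"] fs line_arc[of "s - 1"] by auto
      moreover have "a (s - 2) \<noteq> a s" using line_arc[of "s - 1"] by simp
      moreover have "a (s - 2) \<noteq> x 0 (a s)"
        using inj_A[OF x_A, of 0 "a (s - 2)" "a s"] x_fix[of 0 "s - 2"] s4 calculation(4) by auto
      ultimately have "x (s - 1) (a (s - 2)) = x 0 (a s)"
        using cubic[OF E3 E1, of "x (s - 1) (a (s - 2))" "x 0 (a s)"] E2 d by auto
      then show ?thesis using x0W by simp
    qed
    then have "x (s - 1) (x (s - 1) (a (s - 2))) \<in> W"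
      using WC[OF xC[of "s - 1"]] by blast
    then have "a (s - 2) \<in> W" by simp
    moreover have "a (s - 2) \<noteq> a s" using line_arc[of "s - 1"] by simp
    moreover have "a (s - 2) \<noteq> x 0 (a s)"
      using inj_A[OF x_A, of 0 "a (s - 2)" "a s"] x_fix[of 0 "s - 2"] s4 calculation(2) by auto
    ultimately have "w = a s"
      using cubic[OF E3 E2, of w "a s"] E1 that d nw x0W by metis
    then show False using nw W0 by simp
  qed
  have nb2: "w \<in> W" if "E (a s) w" for w
  proof (rule ccontr)
    assume nw: "w \<notin> W"
    have E1: "E (a s) (a (s + 1))" by (rule line_adj)
    have E3: "E (a s) (a (s - 1))" by (rule line_adj')
    have fs: "x 1 (a s) = a s" "x 1 (a (s - 1)) = a (s - 1)" "x s (a s) = a s" "x s (a (s + 1)) = a (s + 1)"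
      using x_fix[of 1] x_fix[of s] s4 by simp_all
    have E2: "E (a s) (x 1 (a (s + 1)))"
      using adj_A[OF x_A[of 1] E1] fs by simp
    have E4: "E (a s) (x s (a (s - 1)))"
      using adj_A[OF x_A[of s] E3] fs by simp
    have d: "a (s + 1) \<noteq> x 1 (a (s + 1))" using x_right[of 1] by (simp add: add.commute)
    have d': "x s (a (s - 1)) \<noteq> a (s - 1)" using x_left[of s] by simp
    have n: "a (s - 1) \<noteq> a (s + 1)" by (rule line_arc)
    have n2: "a (s - 1) \<noteq> x 1 (a (s + 1))"
      using inj_A[OF x_A, of 1 "a (s - 1)" "a (s + 1)"] fs n by auto
    have n3: "x s (a (s - 1)) \<noteq> a (s + 1)"
      using inj_A[OF x_A, of s "a (s - 1)" "a (s + 1)"] fs n by auto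
    \<comment> \<open>The third neighbour of \<open>a s\<close> is reached from both sides:
      \<open>x s\<close> carries \<open>a (s - 1)\<close> to it, and \<open>x 1\<close> then carries
      it on to \<open>a (s + 1)\<close>.\<close>
    have eq: "x s (a (s - 1)) = x 1 (a (s + 1))"
      using cubic[OF E3 E1 E4 E2] n n2 n3 d d' by auto
    have "x s (a (s - 1)) \<in> W" using WC[OF xC[of s] W0(1)] by simp
    then have "x 1 (x 1 (a (s + 1))) \<in> W" unfolding eq using WC[OF xC[of 1]] by blast
    then have s1: "a (s + 1) \<in> W" by simp
    have x1W: "x 1 (a (s + 1)) \<in> W" using WC[OF xC[of 1] s1] by simp
    have "w = a (s + 1)"
      using cubic[OF E3 E2 that E1] n n2 d nw s1 x1W W0 by metis
    then show False using nw s1 by simp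
  qed
  have nbr: "w \<in> W" if "v \<in> {a (s - 1), a s}" "E v w" for v w
    using that nb1 nb2 by blast
  show ?thesis
  proof (rule rigid'[OF y(1) W0(2)])
    fix v w assume "v \<in> W" and E: "E v w"
    then obtain h u where h: "h \<in> C" "u \<in> {a (s - 1), a s}" "v = h u" unfolding W_def by blast
    then obtain k where k: "k \<in> A" "h \<circ> k = id" "k \<circ> h = id" using inv_A unfolding C_def by blast
    have hk: "h (k z) = z" "k (h z) = z" for z using k by (metis comp_apply id_apply)+
    have "E u (k w)" using adj_A[OF k(1) E] h(3) hk by simp
    then have "k w \<in> W" using nbr h(2) by blast
    then have "h (k w) \<in> W" by (rule WC[OF h(1)])
    then show "w \<in> W" by (simp add: hk)
  next
    fix v assume "v \<in> W"
    then obtain h u where h: "h \<in> C" "u \<in> {a (s - 1), a s}" "v = h u" unfolding W_def by blast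
    have "y v = (y \<circ> h) u" by (simp add: h)
    also have "\<dots> = (h \<circ> y) u" using h(1) by (simp add: C_def)
    finally show "y v = v" using h(2,3) y by auto
  qed
qed

text \<open>Otherwise the middle involution \<open>x (s div 2)\<close> would commute with
  \<open>x 0\<close>, \<open>x 1\<close>, \<open>x (s - 1)\<close> and \<open>x s\<close>, since
  these indices differ from \<open>s div 2\<close> by at most half of \<open>s + 1\<close>. As it
  also fixes \<open>a (s - 1)\<close> and \<open>a s\<close>, it would be trivial.\<close>

lemma least_noncommuting:
  obtains l where "1 \<le> l" "2 * l \<le> s + 1" "\<not> com l" "\<And>k. \<bar>k\<bar> < l \<Longrightarrow> com k"
proof -
  have "\<exists>n::nat. 1 \<le> n \<and> 2 * int n \<le> s + 1 \<and> \<not> com (int n)"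
  proof (rule ccontr)
    assume "\<not> ?thesis"
    then have c1: "com (int n)" if "1 \<le> n" "2 * int n \<le> s + 1" for n :: nat using that by blast
    have c: "com k" if "2 * \<bar>k\<bar> \<le> s + 1" for k
    proof -
      consider "k = 0" | "k = int (nat \<bar>k\<bar>)" "1 \<le> nat \<bar>k\<bar>" | "k = - int (nat \<bar>k\<bar>)" "1 \<le> nat \<bar>k\<bar>"
        by linarith
      then show ?thesis
      proof cases
        case 1 then show ?thesis by (simp add: com_def)
      next
        case 2
        then have "com (int (nat \<bar>k\<bar>))" using that by (intro c1) simp_all
        with 2 show ?thesis by metis
      next
        case 3
        then have "com (int (nat \<bar>k\<bar>))" using that by (intro c1) simp_all
        with 3 show ?thesis by (metis com_minus)
      qed
    qed
    have "x (s div 2) = id"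
    proof (rule centralizer_trivial)
      show "x (s div 2) (a (s - 1)) = a (s - 1)" "x (s div 2) (a s) = a s"
        using s4 by (auto intro!: x_fix)
      show "x (s div 2) \<circ> x t = x t \<circ> x (s div 2)" if "t \<in> {0, 1, s - 1, s}" for t
        unfolding com_iff by (rule c) (use that s4 in auto)
    qed (rule x_A)
    then show False using x_right[of "s div 2"] by simp
  qed
  then obtain n :: nat where n: "1 \<le> n \<and> 2 * int n \<le> s + 1 \<and> \<not> com (int n)"
    and least: "\<And>m. m < n \<Longrightarrow> \<not> (1 \<le> m \<and> 2 * int m \<le> s + 1 \<and> \<not> com (int m))"
    using exists_least_iff[of "\<lambda>n::nat. 1 \<le> n \<and> 2 * int n \<le> s + 1 \<and> \<not> com (int n)"] by blast
  have "com k" if "\<bar>k\<bar> < int n" for k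
  proof -
    consider "k = 0" | "k = int (nat \<bar>k\<bar>)" "1 \<le> nat \<bar>k\<bar>" | "k = - int (nat \<bar>k\<bar>)" "1 \<le> nat \<bar>k\<bar>"
      by linarith
    then show ?thesis
    proof cases
      case 1 then show ?thesis by (simp add: com_def)
    next
      case 2
      then have "com (int (nat \<bar>k\<bar>))" using least[of "nat \<bar>k\<bar>"] n that by simp
      with 2 show ?thesis by metis
    next
      case 3
      then have "com (int (nat \<bar>k\<bar>))" using least[of "nat \<bar>k\<bar>"] n that by simp
      with 3 show ?thesis by (metis com_minus)
    qed
  qed
  with n that[of "int n"] show ?thesis by simp
qed

section \<open>Commutators of the involutions and the lower bound for the first noncommuting
  distance\<close>

definition commut :: "int \<Rightarrow> int \<Rightarrow> 'a \<Rightarrow> 'a" where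
  "commut i j = x i \<circ> x j \<circ> x i \<circ> x j"

lemma commut_A: "commut i j \<in> A"
  by (simp add: commut_def comp_A x_A)

lemma commut_id_iff: "commut i j = id \<longleftrightarrow> x i \<circ> x j = x j \<circ> x i"
  unfolding commut_def fun_eq_iff comp_apply id_apply by (metis x_x)

text \<open>Both factors fix the arc from \<open>n\<close> to \<open>s - 1\<close>. At each end one
  further vertex is gained: one factor moves it to a third neighbour, and the other factor fixes
  that neighbour because it fixes the centre and its two neighbours on the line. The bound
  \<open>n \<le> s - 2\<close> provides these three fixed vertices.\<close>

lemma commut_fixes:
  assumes "1 \<le> n" "n \<le> s - 2"
  shows "fixes_arc (commut 0 n) (n - 1) s"
  unfolding fixes_arc_def
proof (intro conjI allI impI commut_A)
  fix t assume t: "n - 1 \<le> t \<and> t \<le> s"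
  consider "t = n - 1" | "t = s" | "n \<le> t" "t \<le> s - 1" using t by linarith
  then show "commut 0 n (a t) = a t"
  proof cases
    case 1
    let ?b = "x n (a (n - 1))"
    have nb: "E (a n) ?b" using adj_A[OF x_A[of n] line_adj'[of n]] x_fix[of n n] s4 by simp
    have f0: "x 0 (a (n - 1)) = a (n - 1)" "x 0 (a n) = a n" "x 0 (a (n + 1)) = a (n + 1)"
      using assms by (auto intro!: x_fix)
    have "x 0 ?b = ?b"
    proof (rule ccontr)
      assume ne: "x 0 ?b \<noteq> ?b"
      have "E (a n) (x 0 ?b)" using adj_A[OF x_A[of 0] nb] f0 by simp
      moreover have "a (n - 1) \<noteq> ?b" using x_left[of n] by simp
      moreover have "a (n + 1) \<noteq> ?b"
        using inj_A[OF x_A, of n "a (n + 1)" "a (n - 1)"] x_fix[of n "n + 1"] s4 line_arc[of n] by auto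
      moreover have "a (n - 1) \<noteq> x 0 ?b" "a (n + 1) \<noteq> x 0 ?b"
        using inj_A[OF x_A, of 0 _ ?b] f0 calculation by metis+
      ultimately show False
        using cubic[OF line_adj'[of n] line_adj[of n] nb, of "x 0 ?b"] line_arc[of n] ne by auto
    qed
    then show ?thesis by (simp add: commut_def 1 f0)
  next
    case 2
    let ?b = "x 0 (a s)"
    have nb: "E (a (s - 1)) ?b"
      using adj_A[OF x_A[of 0] line_adj[of "s - 1"]] x_fix[of 0 "s - 1"] s4 by simp
    have fn: "x n (a s) = a s" "x n (a (s - 1)) = a (s - 1)" "x n (a (s - 2)) = a (s - 2)"
      using assms by (auto intro!: x_fix)
    have arc: "a (s - 2) \<noteq> a s" using line_arc[of "s - 1"] by simp
    have E1: "E (a (s - 1)) (a s)" "E (a (s - 1)) (a (s - 2))"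
      using line_adj[of "s - 1"] line_adj'[of "s - 1"] by simp_all
    have "x n ?b = ?b"
    proof (rule ccontr)
      assume ne: "x n ?b \<noteq> ?b"
      have "E (a (s - 1)) (x n ?b)" using adj_A[OF x_A[of n] nb] fn by simp
      moreover have "a s \<noteq> ?b" using x_right[of 0] by simp
      moreover have "a (s - 2) \<noteq> ?b"
        using inj_A[OF x_A, of 0 "a (s - 2)" "a s"] x_fix[of 0 "s - 2"] s4 arc by auto
      moreover have "a s \<noteq> x n ?b" "a (s - 2) \<noteq> x n ?b"
        using inj_A[OF x_A, of n _ ?b] fn calculation by metis+
      ultimately show False
        using cubic[OF E1 nb, of "x n ?b"] arc ne by auto
    qed
    then show ?thesis by (simp add: commut_def 2 fn)
  next
    case 3
    then show ?thesis using assms by (simp add: commut_def x_fix)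
  qed
qed

text \<open>The fixed arc is extended one vertex at a time. A first moved vertex
  \<open>a (r + 1)\<close> would be repaired by a suitable \<open>x \<mu>\<close>; then
  \<open>x (l + \<mu>)\<close> commutes with the repaired commutator and with the commutator itself,
  hence with \<open>x \<mu>\<close>, against the choice of \<open>l\<close>.\<close>

lemma commut_fixes_long:
  assumes l: "1 \<le> l" "l \<le> s - 2" "\<not> com l" and least: "\<And>k. \<bar>k\<bar> < l \<Longrightarrow> com k"
  shows "fixes_arc (commut 0 l) (l - 1) (2 * s - 2 - l)"
proof -
  define c where "c = commut 0 l"
  have c1: "c \<noteq> id" using l(3) by (simp add: c_def commut_id_iff com_def)
  have base: "fixes_arc c (l - 1) s" unfolding c_def by (rule commut_fixes[OF l(1,2)])
  have step: "c (a (r + 1)) = a (r + 1)" if r: "fixes_arc c (l - 1) r" "s \<le> r" "r < 2 * s - 2 - l" for r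
  proof (rule ccontr)
    assume mv: "c (a (r + 1)) \<noteq> a (r + 1)"
    \<comment> \<open>The arc of \<open>x \<mu>\<close> ends exactly at index \<open>r\<close>, and
      \<open>n\<close> is the index at the noncommuting distance \<open>l\<close> from
      \<open>\<mu>\<close>. The limit on \<open>r\<close> is what gives
      \<open>n \<le> s - 2\<close>.\<close>
    define \<mu> where "\<mu> = r - s + 1"
    define n where "n = l + \<mu>"
    have rl: "r < l - 1 + s" using arc_trivial'[OF r(1)] c1 by linarith
    have \<mu>: "1 \<le> \<mu>" "\<mu> \<le> l - 1" "n \<le> s - 2" "r = \<mu> + s - 1"
      using r rl by (auto simp: \<mu>_def n_def)
    have xcom: "x t \<circ> x u = x u \<circ> x t" if "\<bar>u - t\<bar> < l" for t u
      unfolding com_iff by (rule least[OF that])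
    have d: "fixes_arc (x \<mu> \<circ> c) (l - 1) (\<mu> + s)"
      by (rule reduce_right) (use r mv \<mu> l in \<open>auto simp: add.commute\<close>)
    have nd: "x n \<circ> (x \<mu> \<circ> c) = (x \<mu> \<circ> c) \<circ> x n"
    proof (rule commute_stab[of _ "l - 1" "\<mu> + 1"])
      show "fixes_arc (x \<mu> \<circ> c) (l - 1) (\<mu> + 1 + s - 1)" using d by (simp add: algebra_simps)
      show "x n \<circ> x t = x t \<circ> x n" if "\<mu> + 1 \<le> t" "t \<le> l - 1" for t
        by (rule xcom) (use that \<mu> l in \<open>auto simp: n_def\<close>)
    qed (use \<mu> l in auto)
    \<comment> \<open>\<open>commut 0 n\<close> is a product of involutions among
      \<open>x 1, ..., x (n - 1)\<close>, and all these indices lie at distance less than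
      \<open>l\<close> from \<open>l\<close>.\<close>
    have w: "x l \<circ> commut 0 n = commut 0 n \<circ> x l"
    proof (rule commute_stab[of _ "n - 1" 1])
      show "fixes_arc (commut 0 n) (n - 1) (1 + s - 1)"
        using commut_fixes[of n] \<mu> l by (simp add: n_def)
      show "x l \<circ> x t = x t \<circ> x l" if "1 \<le> t" "t \<le> n - 1" for t
        by (rule xcom) (use that \<mu> l in \<open>auto simp: n_def\<close>)
    qed (use \<mu> l in \<open>auto simp: n_def\<close>)
    have nl: "x n (x l v) = x l (x n v)" for v
      using xcom[of l n] \<mu> l by (simp add: n_def fun_eq_iff)
    have w': "x l (x 0 (x n (x 0 (x n v)))) = x 0 (x n (x 0 (x n (x l v))))" for v
      using w by (simp add: commut_def fun_eq_iff)
    have w2: "x l (x 0 (x n (x 0 v))) = x 0 (x n (x 0 (x l v)))" for v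
      using w'[of "x n v"] by (simp add: nl)
    \<comment> \<open>Conjugation by \<open>x 0\<close> exchanges the roles: that \<open>x l\<close>
      commutes with the conjugate of \<open>x n\<close> means that \<open>x n\<close> commutes with
      the conjugate of \<open>x l\<close>.\<close>
    have nxlx: "x n (x 0 (x l (x 0 v))) = x 0 (x l (x 0 (x n v)))" for v
      using w2[of "x 0 v"] by (metis x_x)
    have nc: "x n \<circ> c = c \<circ> x n"
      by (simp add: c_def commut_def fun_eq_iff nxlx nl)
    have "x n (x \<mu> v) = x \<mu> (x n v)" for v
    proof -
      obtain c' where c': "c \<circ> c' = id" using inv_A[of c] commut_A by (auto simp: c_def)
      have cc: "c (c' v) = v" using c' by (metis comp_apply id_apply)
      have "x n (x \<mu> (c (c' v))) = x \<mu> (c (x n (c' v)))" using nd by (simp add: fun_eq_iff)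
      also have "\<dots> = x \<mu> (x n (c (c' v)))" using nc by (simp add: fun_eq_iff)
      finally show ?thesis by (simp add: cc)
    qed
    then have "x \<mu> \<circ> x n = x n \<circ> x \<mu>" by (simp add: fun_eq_iff)
    then show False using l(3) by (simp add: com_iff n_def)
  qed
  have "fixes_arc c (l - 1) (s + int m)" if "s + int m \<le> 2 * s - 2 - l" for m
    using that
  proof (induction m)
    case (Suc m)
    then have "fixes_arc c (l - 1) (s + int m)" by simp
    from fixes_arc_right[OF this step[OF this]] Suc.prems show ?case by (simp add: algebra_simps)
  qed (simp add: base)
  moreover have "s + int (nat (s - 2 - l)) = 2 * s - 2 - l" using l by simp
  ultimately show ?thesis unfolding c_def by (metis order_refl)
qed

lemma commut_shift:
  assumes "fixes_arc (commut 0 j) p q"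
  shows "fixes_arc (commut i (i + j)) (i + p) (i + q)"
proof -
  obtain k k' where k: "k \<in> A" "\<And>t. k (a t) = a (i + t)" "k' \<in> A" "k \<circ> k' = id" "k' \<circ> k = id"
    using shunt_inv[of i] by metis
  have kk: "k' (k v) = v" for v using k(5) by (metis comp_apply id_apply)
  have "commut i (i + j) = k \<circ> commut 0 j \<circ> k'"
    using x_shift[OF k, of 0] x_shift[OF k, of j] by (simp add: commut_def fun_eq_iff kk)
  then show ?thesis using fixes_arc_shift[OF assms k] by simp
qed

text \<open>The commutator fixes everything up to \<open>2 * s - 2 - l\<close> on the right and, by
  reflection, everything from \<open>2 * l - s + 1\<close> on the left. It is not trivial, so this
  arc is shorter than \<open>s\<close>.\<close>

lemma noncommuting_bound:
  assumes l: "1 \<le> l" "l \<le> s - 2" "\<not> com l" and least: "\<And>k. \<bar>k\<bar> < l \<Longrightarrow> com k"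
  shows "2 * s - 2 \<le> 3 * l"
proof -
  interpret R: tutte_line E A "\<lambda>i. a (- i)" s "\<lambda>i. x (1 - s - i)" by (rule reflect)
  have Rcom: "R.com k \<longleftrightarrow> com k" for k
  proof -
    have "R.com k \<longleftrightarrow> x (1 - s) \<circ> x (1 - s - k) = x (1 - s - k) \<circ> x (1 - s)" by (simp add: R.com_def)
    also have "\<dots> \<longleftrightarrow> com k" unfolding com_iff by (simp add: com_minus)
    finally show ?thesis .
  qed
  have r: "fixes_arc (commut 0 l) (l - 1) (2 * s - 2 - l)"
    by (rule commut_fixes_long[OF l least])
  have "R.fixes_arc (R.commut 0 l) (l - 1) (2 * s - 2 - l)"
    by (rule R.commut_fixes_long) (use l least in \<open>auto simp: Rcom\<close>)
  \<comment> \<open>On the reversed line \<open>x l\<close> and \<open>x 0\<close> have indices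
    \<open>1 - s - l\<close> and \<open>1 - s\<close>. The commutator appears with its entries
    exchanged, that is, inverted, which leaves its fixed vertices unchanged.\<close>
  from R.commut_shift[OF this, of "1 - s - l"]
  have "R.fixes_arc (R.commut (1 - s - l) (1 - s - l + l)) (- s) (s - 2 * l - 1)"
    by (simp add: algebra_simps)
  moreover have "R.commut (1 - s - l) (1 - s - l + l) = commut l 0"
    unfolding R.commut_def commut_def by simp
  moreover have "- (s - 2 * l - 1) = 2 * l - s + 1" "- (- s) = s" by simp_all
  ultimately have "fixes_arc (commut l 0) (2 * l - s + 1) s"
    by (metis fixes_arc_reflect)
  moreover have "commut 0 l \<circ> commut l 0 = id" by (simp add: commut_def fun_eq_iff)
  ultimately have m: "fixes_arc (commut 0 l) (2 * l - s + 1) s"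
    by (intro fixes_arc_inv[OF _ commut_A])
  have "fixes_arc (commut 0 l) (2 * l - s + 1) (2 * s - 2 - l)"
    unfolding fixes_arc_def
  proof (intro conjI allI impI commut_A)
    fix t assume "2 * l - s + 1 \<le> t \<and> t \<le> 2 * s - 2 - l"
    then show "commut 0 l (a t) = a t"
      using fixes_arcD[OF r, of t] fixes_arcD[OF m, of t] l by (cases "t \<le> s") auto
  qed
  then have "\<not> 2 * l - s + 1 + s \<le> 2 * s - 2 - l"
    using arc_trivial' l(3) by (metis com_def commut_id_iff)
  then show ?thesis by linarith
qed

text \<open>Shifted so that its fixed arc runs from \<open>l\<close> to \<open>s - 1\<close>, the
  map becomes \<open>x 0 \<circ> x l \<circ> d\<close>, where \<open>d\<close> fixes one vertex more
  at each end. Then \<open>d\<close> is a product of involutions among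
  \<open>x 1, ..., x (l - 1)\<close>, so it squares to the identity and commutes with
  \<open>x 0\<close> and \<open>x l\<close>; the square is that of \<open>x 0 \<circ> x l\<close>,
  which is not trivial.\<close>

lemma no_exact_involution:
  assumes l: "1 \<le> l" "l \<le> s - 2" "\<not> com l" and least: "\<And>k. \<bar>k\<bar> < l \<Longrightarrow> com k"
    and h: "fixes_arc h i j" "h (a (i - 1)) \<noteq> a (i - 1)" "h (a (j + 1)) \<noteq> a (j + 1)"
    and len: "j - i = s - 1 - l"
  shows "h \<circ> h \<noteq> id"
proof
  assume hh: "h \<circ> h = id"
  obtain k k' where k: "k \<in> A" "\<And>t. k (a t) = a (l - i + t)" "k' \<in> A" "k \<circ> k' = id" "k' \<circ> k = id"
    "\<And>t. k' (a t) = a (t - (l - i))"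
    using shunt_inv[of "l - i"] by metis
  have kk: "k (k' v) = v" "k' (k v) = v" for v using k(4,5) by (metis comp_apply id_apply)+
  define g where "g = k \<circ> h \<circ> k'"
  have "l - i + i = l" "l - i + j = s - 1" using len by simp_all
  then have g: "fixes_arc g l (s - 1)" using fixes_arc_shift[OF h(1) k(1-5)] by (simp add: g_def)
  have inj: "k v = k w \<Longrightarrow> v = w" for v w by (metis kk)
  have ka: "a (l - 1) = k (a (i - 1))" "a s = k (a (j + 1))" using len by (simp_all add: k(2) algebra_simps)
  have gl: "g (a (l - 1)) \<noteq> a (l - 1)" unfolding ka using h(2) inj by (auto simp: g_def kk)
  have gs: "g (a s) \<noteq> a s" unfolding ka using h(3) inj by (auto simp: g_def kk)
  have gg: "g (g v) = v" for v using hh by (simp add: g_def kk fun_eq_iff)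
  have g1: "fixes_arc (x 0 \<circ> g) l s"
    using reduce_right[of g l 0] g gs l by simp
  \<comment> \<open>\<open>x 0\<close> fixes \<open>a (l - 1)\<close>, so repairing the right end
    leaves the left end moved, and \<open>x l\<close> is needed as well.\<close>
  have "(x 0 \<circ> g) (a (l - 1)) \<noteq> a (l - 1)"
  proof
    assume "(x 0 \<circ> g) (a (l - 1)) = a (l - 1)"
    then have "g (a (l - 1)) = x 0 (a (l - 1))" by (metis comp_apply x_x)
    also have "\<dots> = a (l - 1)" using l by (intro x_fix) auto
    finally show False using gl by simp
  qed
  then have d: "fixes_arc (x l \<circ> (x 0 \<circ> g)) (l - 1) s"
    using reduce_left[OF g1] l by simp
  define d where "d = x l \<circ> (x 0 \<circ> g)"
  have d': "fixes_arc d (l - 1) (1 + s - 1)" using d by (simp add: d_def)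
  have xcom: "x t \<circ> x u = x u \<circ> x t" if "\<bar>u - t\<bar> < l" for t u
    unfolding com_iff by (rule least[OF that])
  have dd: "d \<circ> d = id"
    by (rule square_stab[OF d']) (use l in \<open>auto intro!: xcom\<close>)
  have d0: "x 0 \<circ> d = d \<circ> x 0"
    by (rule commute_stab[OF d']) (use l in \<open>auto intro!: xcom\<close>)
  have dl: "x l \<circ> d = d \<circ> x l"
    by (rule commute_stab[OF d']) (use l in \<open>auto intro!: xcom\<close>)
  have gd: "g v = x 0 (x l (d v))" for v by (simp add: d_def)
  have ds: "x 0 (d v) = d (x 0 v)" "x l (d v) = d (x l v)" "d (d v) = v" for v
    using d0 dl dd by (simp_all add: fun_eq_iff)
  have "x 0 (x l (x 0 (x l v))) = v" for v
    using gg[of v] by (simp add: gd ds)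
  then have "commut 0 l = id" by (simp add: commut_def fun_eq_iff)
  then show False using l(3) by (simp add: commut_id_iff com_def)
qed

theorem no_short_exact_involutions:
  assumes h1: "fixes_arc h i (i + 1)" "h (a (i - 1)) \<noteq> a (i - 1)" "h (a (i + 2)) \<noteq> a (i + 2)" "h \<circ> h = id"
    and h2: "fixes_arc k j (j + 2)" "k (a (j - 1)) \<noteq> a (j - 1)" "k (a (j + 3)) \<noteq> a (j + 3)" "k \<circ> k = id"
  shows False
proof -
  obtain l where l: "1 \<le> l" "2 * l \<le> s + 1" "\<not> com l" and least: "\<And>k. \<bar>k\<bar> < l \<Longrightarrow> com k"
    using least_noncommuting by metis
  have l2: "l \<le> s - 2" using l(2) s4 by linarith
  have "2 * s - 2 \<le> 3 * l" by (rule noncommuting_bound[OF l(1) l2 l(3) least])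
  then have "s - 1 - l = 1 \<or> s - 1 - l = 2" using l s4 by linarith
  then show False
  proof
    assume "s - 1 - l = 1"
    then show False
      using no_exact_involution[OF l(1) l2 l(3) least, of h i "i + 1"] h1 by (simp add: add.commute)
  next
    assume "s - 1 - l = 2"
    then show False
      using no_exact_involution[OF l(1) l2 l(3) least, of k j "j + 2"] h2 by (simp add: add.commute)
  qed
qed

end

section \<open>Stabilisers of growing arcs and rigidity of 3-arcs\<close>

context cubic_line
begin

text \<open>The stabiliser of \<open>(a 0, \<dots>, a s)\<close> is normalised by the shunt \<open>k\<close> and by \<open>y k\<close>, where \<open>y\<close>
  fixes \<open>a 1, \<dots>, a s\<close> and moves \<open>a (s + 1)\<close>; these two generate a vertex-transitive group.\<close>

lemma stab_trivial:
  assumes s: "2 \<le> s"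
    and stable: "\<And>h. fixes_arc h 0 s \<Longrightarrow> h (a (s + 1)) = a (s + 1)"
    and y0: "fixes_arc y0 0 (s - 1)" "y0 (a s) \<noteq> a s"
    and h: "fixes_arc h 0 s"
  shows "h = id"
proof -
  define S where "S = {h. fixes_arc h 0 s}"
  have finS: "finite S" by (rule finite_subset[OF _ finite_A]) (auto simp: S_def fixes_arc_A)
  \<comment> \<open>This is the normaliser of \<open>S\<close>, with each element paired with its
    inverse. As \<open>S\<close> is finite, mapping \<open>S\<close> into itself is enough for
    membership (\<open>NI\<close>).\<close>
  define N where "N = {(g, g'). g \<in> A \<and> g' \<in> A \<and> g \<circ> g' = id \<and> g' \<circ> g = id \<and> (\<lambda>h. g' \<circ> h \<circ> g) ` S = S}"
  have NI: "(g, g') \<in> N" if g: "g \<in> A" "g' \<in> A" "g \<circ> g' = id" "g' \<circ> g = id"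
    and sub: "\<And>h. h \<in> S \<Longrightarrow> g' \<circ> h \<circ> g \<in> S" for g g'
  proof -
    have "inj_on (\<lambda>h. g' \<circ> h \<circ> g) S"
    proof (rule inj_onI)
      fix h k assume "g' \<circ> h \<circ> g = g' \<circ> k \<circ> g"
      then have "g \<circ> (g' \<circ> h \<circ> g) \<circ> g' = g \<circ> (g' \<circ> k \<circ> g) \<circ> g'" by simp
      then show "h = k" using g(3) by (metis comp_assoc comp_id id_comp)
    qed
    then have "(\<lambda>h. g' \<circ> h \<circ> g) ` S = S"
      using sub finS by (intro card_subset_eq) (auto simp: card_image)
    with g show ?thesis by (simp add: N_def)
  qed
  have N_inv: "(g', g) \<in> N" if "(g, g') \<in> N" for g g'
  proof -
    have g: "g \<in> A" "g' \<in> A" "g \<circ> g' = id" "g' \<circ> g = id" and im: "(\<lambda>h. g' \<circ> h \<circ> g) ` S = S"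
      using that by (auto simp: N_def)
    show ?thesis
    proof (rule NI)
      fix h assume "h \<in> S"
      then obtain k where k: "k \<in> S" "h = g' \<circ> k \<circ> g" using im by blast
      then have "g \<circ> h \<circ> g' = k" using g(3) by (metis comp_assoc comp_id id_comp)
      with k show "g \<circ> h \<circ> g' \<in> S" by simp
    qed (use g in auto)
  qed
  have N_comp: "(g \<circ> k, k' \<circ> g') \<in> N" if "(g, g') \<in> N" "(k, k') \<in> N" for g g' k k'
  proof (rule NI)
    have g: "g \<in> A" "g' \<in> A" "g \<circ> g' = id" "g' \<circ> g = id" and img: "(\<lambda>h. g' \<circ> h \<circ> g) ` S = S"
      and k: "k \<in> A" "k' \<in> A" "k \<circ> k' = id" "k' \<circ> k = id" and imk: "(\<lambda>h. k' \<circ> h \<circ> k) ` S = S"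
      using that by (auto simp: N_def)
    show "g \<circ> k \<in> A" "k' \<circ> g' \<in> A" using g k by (auto intro: comp_A)
    show "g \<circ> k \<circ> (k' \<circ> g') = id" "k' \<circ> g' \<circ> (g \<circ> k) = id"
      using g k by (metis comp_assoc comp_id id_comp)+
    fix h assume "h \<in> S"
    then have "g' \<circ> h \<circ> g \<in> S" using img by blast
    then have "k' \<circ> (g' \<circ> h \<circ> g) \<circ> k \<in> S" using imk by blast
    then show "k' \<circ> g' \<circ> h \<circ> (g \<circ> k) \<in> S" by (simp add: comp_assoc)
  qed
  obtain k k' where k: "k \<in> A" "\<And>t. k (a t) = a (1 + t)" "k' \<in> A" "k \<circ> k' = id" "k' \<circ> k = id"
    "\<And>t. k' (a t) = a (t - 1)"
    using shunt_inv[of 1] by metis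
  have kk: "k (k' v) = v" "k' (k v) = v" for v using k(4,5) by (metis comp_apply id_apply)+
  have Sfix: "h (a t) = a t" if "h \<in> S" "0 \<le> t" "t \<le> s + 1" for h t
    using stable[of h] that by (cases "t = s + 1") (auto simp: S_def fixes_arc_def)
  have kN: "(k, k') \<in> N"
  proof (rule NI)
    fix h assume h: "h \<in> S"
    then have "(k' \<circ> h \<circ> k) (a t) = a t" if "0 \<le> t" "t \<le> s" for t
      using that Sfix[OF h, of "1 + t"] by (simp add: k)
    then show "k' \<circ> h \<circ> k \<in> S"
      using h k by (simp add: S_def fixes_arc_def comp_A)
  qed (use k in auto)
  define y where "y = k \<circ> y0 \<circ> k'"
  have y: "fixes_arc y 1 s" using fixes_arc_shift[OF y0(1) k(1-5)] by (simp add: y_def)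
  have ym: "y (a (s + 1)) \<noteq> a (s + 1)"
  proof
    assume "y (a (s + 1)) = a (s + 1)"
    then have "k (y0 (a s)) = a (s + 1)" by (simp add: y_def k(6))
    then have "k' (k (y0 (a s))) = k' (a (s + 1))" by simp
    then show False using y0(2) by (simp add: kk k(6))
  qed
  define b where "b = y (a (s + 1))"
  have yA: "y \<in> A" by (rule fixes_arc_A[OF y])
  obtain y' where y': "y' \<in> A" "y \<circ> y' = id" "y' \<circ> y = id" using inv_A[OF yA] by blast
  have yf: "y (a s) = a s" "y (a (s - 1)) = a (s - 1)" using y s by (auto simp: fixes_arc_def)
  have Eb: "E (a s) b" using adj_A[OF yA line_adj[of s]] yf by (simp add: b_def)
  have b1: "a (s - 1) \<noteq> b"
    using inj_A[OF yA, of "a (s - 1)" "a (s + 1)"] yf line_arc[of s] by (auto simp: b_def)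
  have b2: "a (s + 1) \<noteq> b" using ym by (simp add: b_def)
  \<comment> \<open>\<open>S\<close> fixes \<open>a s\<close> and two of its neighbours, hence also
    the third. So \<open>S\<close> fixes the second continuation of the arc as well as the
    first.\<close>
  have Sb: "h b = b" if h: "h \<in> S" for h
  proof (rule ccontr)
    assume ne: "h b \<noteq> b"
    have hA: "h \<in> A" using h by (simp add: S_def fixes_arc_A)
    have hf: "h (a s) = a s" "h (a (s - 1)) = a (s - 1)" "h (a (s + 1)) = a (s + 1)"
      using Sfix[OF h] s by simp_all
    have "E (a s) (h b)" using adj_A[OF hA Eb] hf by simp
    moreover have "a (s - 1) \<noteq> h b" "a (s + 1) \<noteq> h b"
      using inj_A[OF hA, of _ b] hf b1 b2 by metis+
    ultimately show False
      using cubic[OF line_adj'[of s] line_adj[of s] Eb, of "h b"] b1 b2 ne line_arc[of s] by auto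
  qed
  have mN: "(y \<circ> k, k' \<circ> y') \<in> N"
  proof (rule NI)
    show "y \<circ> k \<in> A" "k' \<circ> y' \<in> A" using yA y' k by (auto intro: comp_A)
    show "y \<circ> k \<circ> (k' \<circ> y') = id" "k' \<circ> y' \<circ> (y \<circ> k) = id"
      using y' k by (metis comp_assoc comp_id id_comp)+
    fix h assume h: "h \<in> S"
    have "(k' \<circ> y' \<circ> h \<circ> (y \<circ> k)) (a t) = a t" if t: "0 \<le> t" "t \<le> s" for t
    proof -
      have "h (y (k (a t))) = y (k (a t))"
      proof (cases "t = s")
        case True
        then show ?thesis using Sb[OF h] by (simp add: k(2) b_def add.commute)
      next
        case False
        then have "y (a (1 + t)) = a (1 + t)" using fixes_arcD[OF y, of "1 + t"] t by simp
        then show ?thesis using Sfix[OF h, of "1 + t"] t by (simp add: k(2))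
      qed
      moreover have "y' (y v) = v" for v using y'(3) by (metis comp_apply id_apply)
      ultimately show ?thesis by (simp add: kk)
    qed
    moreover have "k' \<circ> y' \<circ> h \<circ> (y \<circ> k) \<in> A"
      using h yA y' k by (simp add: S_def fixes_arc_A comp_A)
    ultimately show "k' \<circ> y' \<circ> h \<circ> (y \<circ> k) \<in> S" by (simp add: S_def fixes_arc_def)
  qed
  define W where "W = {g (a s) | g g'. (g, g') \<in> N}"
  have WI: "g (a s) \<in> W" if "(g, g') \<in> N" for g g' using that unfolding W_def by blast
  have WC: "g v \<in> W" if g: "(g, g') \<in> N" and "v \<in> W" for g g' v
  proof -
    from that(2) obtain f f' where f: "(f, f') \<in> N" "v = f (a s)" unfolding W_def by blast
    then show ?thesis using WI[OF N_comp[OF g f(1)]] by simp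
  qed
  \<comment> \<open>The three neighbours of \<open>a s\<close> are its images under
    \<open>k\<close>, under \<open>y \<circ> k\<close> and under the inverse of
    \<open>k\<close>.\<close>
  have nW: "w \<in> W" if Ew: "E (a s) w" for w
  proof (rule ccontr)
    assume nw: "w \<notin> W"
    have 1: "a (s + 1) \<in> W" using WI[OF kN] by (simp add: k(2) add.commute)
    have 2: "b \<in> W" using WI[OF mN] by (simp add: k(2) b_def add.commute)
    have 3: "a (s - 1) \<in> W" using WI[OF N_inv[OF kN]] by (simp add: k(6))
    have "w \<noteq> a (s - 1)" "w \<noteq> a (s + 1)" "w \<noteq> b" using 1 2 3 nw by blast+
    then show False
      using cubic[OF line_adj'[of s] line_adj[of s] Eb Ew] b1 b2 line_arc[of s] by auto
  qed
  show ?thesis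
  proof (rule rigid')
    show "h \<in> A" by (rule fixes_arc_A[OF h])
    have "(id, id) \<in> N" by (rule NI) (auto simp: id_A)
    then show "a s \<in> W" using WI by fastforce
  next
    fix v w assume "v \<in> W" and E: "E v w"
    then obtain g g' where g: "(g, g') \<in> N" "v = g (a s)" unfolding W_def by blast
    have gA: "g' \<in> A" "g \<circ> g' = id" "g' \<circ> g = id" using g(1) by (auto simp: N_def)
    have gg: "g (g' z) = z" "g' (g z) = z" for z using gA by (metis comp_apply id_apply)+
    have "E (a s) (g' w)" using adj_A[OF gA(1) E] by (simp add: g(2) gg)
    then have "g (g' w) \<in> W" by (intro WC[OF g(1)] nW)
    then show "w \<in> W" by (simp add: gg)
  next
    fix v assume "v \<in> W"
    then obtain g g' where g: "(g, g') \<in> N" "v = g (a s)" unfolding W_def by blast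
    have gA: "g \<circ> g' = id" "(\<lambda>h. g' \<circ> h \<circ> g) ` S = S" using g(1) by (auto simp: N_def)
    have gg: "g (g' z) = z" for z using gA(1) by (metis comp_apply id_apply)
    have "g' \<circ> h \<circ> g \<in> S" using gA(2) h by (auto simp: S_def)
    then have "(g' \<circ> h \<circ> g) (a s) = a s" using s by (auto simp: S_def fixes_arc_def)
    then have "g (g' (h (g (a s)))) = g (a s)" by simp
    then show "h v = v" by (simp add: g(2) gg)
  qed
qed

lemma shift_witness:
  assumes h: "fixes_arc h i j"
  obtains h' where "fixes_arc h' (d + i) (d + j)"
    "\<And>t. h' (a (d + t)) = a (d + t) \<longleftrightarrow> h (a t) = a t" "h' = id \<longleftrightarrow> h = id"
proof -
  obtain k k' where k: "k \<in> A" "\<And>t. k (a t) = a (d + t)" "k' \<in> A" "k \<circ> k' = id" "k' \<circ> k = id"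
    using shunt_inv[of d] by metis
  have kk: "k (k' v) = v" "k' (k v) = v" for v using k(4,5) by (metis comp_apply id_apply)+
  show ?thesis
  proof (rule that[of "k \<circ> h \<circ> k'"])
    show "fixes_arc (k \<circ> h \<circ> k') (d + i) (d + j)" by (rule fixes_arc_shift[OF h k])
    show "(k \<circ> h \<circ> k') (a (d + t)) = a (d + t) \<longleftrightarrow> h (a t) = a t" for t
      unfolding k(2)[symmetric] comp_apply kk by (metis kk)
    show "k \<circ> h \<circ> k' = id \<longleftrightarrow> h = id"
      unfolding fun_eq_iff comp_apply id_apply by (metis kk)
  qed
qed

text \<open>The stabilisers of \<open>a 0, ..., a m\<close> form a descending chain in a finite
  group; the first repetition at some \<open>m \<ge> 1\<close> defines \<open>s\<close>, and there
  the stabiliser is already trivial. The maps \<open>h\<close> and \<open>k\<close> make the chain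
  drop at \<open>m = 1\<close> and \<open>m = 2\<close>, so \<open>s \<ge> 3\<close>, and the same
  two maps exclude \<open>s \<ge> 4\<close>.\<close>

theorem three_arc_rigid:
  assumes h1: "fixes_arc h i (i + 1)" "h (a (i - 1)) \<noteq> a (i - 1)" "h (a (i + 2)) \<noteq> a (i + 2)" "h \<circ> h = id"
    and h2: "fixes_arc k j (j + 2)" "k (a (j - 1)) \<noteq> a (j - 1)" "k (a (j + 3)) \<noteq> a (j + 3)" "k \<circ> k = id"
    and g: "fixes_arc g n (n + 3)"
  shows "g = id"
proof -
  define S where "S m = {h. fixes_arc h 0 (int m)}" for m :: nat
  have finS: "finite (S m)" for m
    by (rule finite_subset[OF _ finite_A]) (auto simp: S_def fixes_arc_A)
  have sub: "S (Suc m) \<subseteq> S m" for m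
    by (auto simp: S_def intro: fixes_arc_mono)
  have "\<exists>m\<ge>1. S (Suc m) = S m"
  proof (rule ccontr)
    assume "\<not> ?thesis"
    then have less: "card (S (Suc m)) < card (S m)" if "1 \<le> m" for m
      using that sub[of m] finS[of m] by (metis psubset_card_mono psubsetI)
    have "card (S (Suc m)) + m \<le> card (S 1)" for m
    proof (induction m)
      case (Suc m) then show ?case using less[of "Suc m"] by simp
    qed simp
    from this[of "Suc (card (S 1))"] show False by simp
  qed
  then obtain m where m: "1 \<le> m" "S (Suc m) = S m" and least: "\<And>p. p < m \<Longrightarrow> \<not> (1 \<le> p \<and> S (Suc p) = S p)"
    using exists_least_iff[of "\<lambda>m. 1 \<le> m \<and> S (Suc m) = S m"] by blast
  define s where "s = int m"
  have S1: "S 2 \<noteq> S 1"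
  proof -
    obtain h' where "fixes_arc h' (- i + i) (- i + (i + 1))"
      "\<And>t. h' (a (- i + t)) = a (- i + t) \<longleftrightarrow> h (a t) = a t"
      by (rule shift_witness[OF h1(1)]) blast
    from this(1) this(2)[of "i + 2"] h1(3) have "h' \<in> S 1" "h' \<notin> S 2"
      by (auto simp: S_def fixes_arc_def)
    then show ?thesis by blast
  qed
  have S2: "S 3 \<noteq> S 2"
  proof -
    obtain h' where "fixes_arc h' (- j + j) (- j + (j + 2))"
      "\<And>t. h' (a (- j + t)) = a (- j + t) \<longleftrightarrow> k (a t) = a t"
      by (rule shift_witness[OF h2(1)]) blast
    from this(1) this(2)[of "j + 3"] h2(3) have "h' \<in> S 2" "h' \<notin> S 3"
      by (auto simp: S_def fixes_arc_def)
    then show ?thesis by blast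
  qed
  have "m \<noteq> 1" "m \<noteq> 2" using S1 S2 m by (auto simp: numeral_2_eq_2 numeral_3_eq_3)
  then have s3: "3 \<le> s" using m(1) by (simp add: s_def)
  have stable: "h (a (s + 1)) = a (s + 1)" if "fixes_arc h 0 s" for h
  proof -
    have "h \<in> S (Suc m)" using that m(2) by (simp add: S_def s_def)
    then show ?thesis using s3 by (simp add: S_def fixes_arc_def s_def)
  qed
  have "S (Suc (m - 1)) \<noteq> S (m - 1)" using least[of "m - 1"] s3 by (simp add: s_def)
  moreover have "Suc (m - 1) = m" using m(1) by simp
  ultimately obtain y where y: "y \<in> S (m - 1)" "y \<notin> S m" using sub[of "m - 1"] by auto
  have y1: "fixes_arc y 0 (s - 1)" using y(1) m(1) by (simp add: S_def s_def of_nat_diff)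
  have y2: "y (a s) \<noteq> a s"
    using fixes_arc_right[OF y1] y(2) by (auto simp: S_def s_def)
  have triv0: "h = id" if "fixes_arc h 0 s" for h
    by (rule stab_trivial[of s y h]) (use s3 stable y1 y2 that in auto)
  have triv: "h = id" if h: "fixes_arc h i (i + s)" for h i
  proof -
    obtain h' where "fixes_arc h' (- i + i) (- i + (i + s))" "h' = id \<longleftrightarrow> h = id"
      by (rule shift_witness[OF h]) blast
    then show ?thesis using triv0[of h'] by simp
  qed
  have ex: "\<exists>x. fixes_arc x i (i + s - 1) \<and> x (a (i + s)) \<noteq> a (i + s) \<and> x (a (i - 1)) \<noteq> a (i - 1)" for i
  proof -
    obtain x where x: "fixes_arc x (i + 0) (i + (s - 1))"
      "\<And>t. x (a (i + t)) = a (i + t) \<longleftrightarrow> y (a t) = a t"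
      by (rule shift_witness[OF y1]) blast
    have 1: "x (a (i + s)) \<noteq> a (i + s)" using x(2)[of s] y2 by simp
    have "x (a (i - 1)) \<noteq> a (i - 1)"
    proof
      assume "x (a (i - 1)) = a (i - 1)"
      then have "fixes_arc x (i - 1) (i + (s - 1))" using fixes_arc_left[of x i] x(1) by simp
      then have "x = id" using triv[of x "i - 1"] by (simp add: algebra_simps)
      then show False using 1 by simp
    qed
    with 1 x(1) show ?thesis by (intro exI[of _ x]) (simp add: algebra_simps)
  qed
  then obtain x where x: "\<And>i. fixes_arc (x i) i (i + s - 1) \<and> x i (a (i + s)) \<noteq> a (i + s) \<and>
      x i (a (i - 1)) \<noteq> a (i - 1)"
    by metis
  have "\<not> 4 \<le> s"
  proof
    assume "4 \<le> s"
    then interpret tutte_line E A a s x by unfold_locales (use x triv in blast)+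
    show False by (rule no_short_exact_involutions[OF h1 h2])
  qed
  then have "s = 3" using s3 by linarith
  then show ?thesis using triv[of g n] g by simp
qed

end

section \<open>Automorphisms of coset graphs\<close>

lemma connected_closed:
  assumes "connected (with_proj \<Gamma>)" "u \<in> pverts \<Gamma>" "u \<in> W"
    and "\<And>v w. \<lbrakk>v \<in> W; (v, w) \<in> parcs \<Gamma> \<or> (w, v) \<in> parcs \<Gamma>\<rbrakk> \<Longrightarrow> w \<in> W"
  shows "pverts \<Gamma> \<subseteq> W"
proof
  fix v assume "v \<in> pverts \<Gamma>"
  then have "(u, v) \<in> rtrancl_on (pverts \<Gamma>) (\<Union>e\<in>parcs \<Gamma>. {(fst e, snd e), (snd e, fst e)})"
    using assms(1,2) unfolding connected_def strongly_connected_def reachable_def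
    by (simp add: mk_symmetric_def)
  then show "v \<in> W"
  proof (induction rule: rtrancl_on_induct)
    case (step y z)
    then show ?case using assms(4)[of y z] by auto
  qed (rule assms(3))
qed

text \<open>The elements of \<^const>\<open>graph_aut\<close> are extensional; extending them by the identity makes
  the group operation the composition of functions.\<close>

definition total_aut :: "'b pair_pre_digraph \<Rightarrow> ('b \<Rightarrow> 'b) set" where
  "total_aut \<Gamma> = {h. h permutes pverts \<Gamma> \<and>
     (\<forall>v\<in>pverts \<Gamma>. \<forall>w\<in>pverts \<Gamma>. (v, w) \<in> parcs \<Gamma> \<longleftrightarrow> (h v, h w) \<in> parcs \<Gamma>)}"

lemma id_total_aut: "id \<in> total_aut \<Gamma>"
  by (simp add: total_aut_def permutes_id)

lemma comp_total_aut: "\<lbrakk>h \<in> total_aut \<Gamma>; k \<in> total_aut \<Gamma>\<rbrakk> \<Longrightarrow> h \<circ> k \<in> total_aut \<Gamma>"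
  unfolding total_aut_def by (simp add: permutes_compose) (meson permutes_in_image)

lemma inv_total_aut:
  assumes "h \<in> total_aut \<Gamma>" shows "\<exists>k\<in>total_aut \<Gamma>. h \<circ> k = id \<and> k \<circ> h = id"
proof (intro bexI conjI)
  have h: "h permutes pverts \<Gamma>"
    "\<And>v w. v \<in> pverts \<Gamma> \<Longrightarrow> w \<in> pverts \<Gamma> \<Longrightarrow> (v, w) \<in> parcs \<Gamma> \<longleftrightarrow> (h v, h w) \<in> parcs \<Gamma>"
    using assms by (auto simp: total_aut_def)
  show "h \<circ> inv_into UNIV h = id" "inv_into UNIV h \<circ> h = id" using permutes_inv_o[OF h(1)] by auto
  have "(v, w) \<in> parcs \<Gamma> \<longleftrightarrow> (inv_into UNIV h v, inv_into UNIV h w) \<in> parcs \<Gamma>" if "v \<in> pverts \<Gamma>" "w \<in> pverts \<Gamma>" for v w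
    using h(2)[of "inv_into UNIV h v" "inv_into UNIV h w"] that permutes_in_image[OF permutes_inv[OF h(1)]]
    by (simp add: permutes_inverses[OF h(1)])
  then show "inv_into UNIV h \<in> total_aut \<Gamma>" by (simp add: total_aut_def permutes_inv[OF h(1)])
qed

lemma finite_total_aut: "finite (pverts \<Gamma>) \<Longrightarrow> finite (total_aut \<Gamma>)"
  by (rule finite_subset[OF _ finite_permutations[of "pverts \<Gamma>"]]) (auto simp: total_aut_def)

lemma graph_aut_total:
  assumes "h \<in> graph_aut \<Gamma>"
  shows "\<exists>k\<in>total_aut \<Gamma>. h = restrict k (pverts \<Gamma>)"
proof
  let ?k = "\<lambda>v. if v \<in> pverts \<Gamma> then h v else v"
  have b: "bij_betw h (pverts \<Gamma>) (pverts \<Gamma>)" "h \<in> extensional (pverts \<Gamma>)"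
    using assms by (auto simp: graph_aut_def Bij_def)
  then show "h = restrict ?k (pverts \<Gamma>)" by (auto simp: extensional_def restrict_def)
  have "bij_betw ?k (pverts \<Gamma>) (pverts \<Gamma>)" using b(1) by (subst bij_betw_cong[of _ _ h]) auto
  then have "?k permutes pverts \<Gamma>" by (rule bij_imp_permutes) simp
  then show "?k \<in> total_aut \<Gamma>" using assms by (simp add: total_aut_def graph_aut_def)
qed

lemma restrict_total_aut:
  assumes "k \<in> total_aut \<Gamma>" shows "restrict k (pverts \<Gamma>) \<in> graph_aut \<Gamma>"
proof -
  have "bij_betw k (pverts \<Gamma>) (pverts \<Gamma>)" using assms by (simp add: total_aut_def permutes_imp_bij)
  then have "bij_betw (restrict k (pverts \<Gamma>)) (pverts \<Gamma>) (pverts \<Gamma>)"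
    by (subst bij_betw_cong[of _ _ k]) auto
  then show ?thesis using assms by (simp add: graph_aut_def Bij_def total_aut_def)
qed

text \<open>An abstraction of \<open>L\<close>, \<open>(a, a)\<close>, \<open>(b, b)\<close>, \<open>g\<^sub>\<alpha>\<close>, \<open>\<pi>\<close> and \<open>K = T\<^sup>2\<close> in \<open>G\<close>.\<close>

locale cubic_amalgam = group G for G (structure) +
  fixes L :: "'a set" and a b g p :: 'a and K :: "'a set"
  assumes finite_G: "finite (carrier G)"
    and subgroup_L: "subgroup L G"
    and L_eq: "L = {\<one>, a, a \<otimes> a, b, b \<otimes> a, b \<otimes> (a \<otimes> a)}"
    and g_carrier: "g \<in> carrier G" and p_carrier: "p \<in> carrier G"
    and aaa: "a \<otimes> (a \<otimes> a) = \<one>" and bb: "b \<otimes> b = \<one>" and ab: "a \<otimes> b = b \<otimes> (a \<otimes> a)"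
    and a_ne: "a \<noteq> \<one>" and b_ne: "b \<noteq> \<one>"
    and gg: "g \<otimes> g = b" and pp: "p \<otimes> p = \<one>"
    and p_L: "l \<in> L \<Longrightarrow> p \<otimes> l = l \<otimes> p" and pg: "p \<otimes> g = b \<otimes> (g \<otimes> p)"
    and g_L: "\<lbrakk>l \<in> L; g \<otimes> (l \<otimes> inv g) \<in> L\<rbrakk> \<Longrightarrow> l = \<one> \<or> l = b"
    and subgroup_K: "subgroup K G" and L_K: "L \<subseteq> K" and g_K: "g \<notin> K" and p_K: "p \<notin> K"
    and K_index: "\<lbrakk>x \<in> carrier G; y \<in> carrier G; x \<notin> K; y \<notin> K\<rbrakk> \<Longrightarrow> x \<otimes> y \<in> K"
    and minimal_normal: "\<lbrakk>subgroup M G; M \<subseteq> K; M \<noteq> {\<one>};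
        \<And>x m. x \<in> K \<Longrightarrow> m \<in> M \<Longrightarrow> x \<otimes> m \<otimes> inv x \<in> M; \<And>m. m \<in> M \<Longrightarrow> p \<otimes> m \<otimes> p \<in> M\<rbrakk> \<Longrightarrow> M = K"
    and faithful_K: "\<lbrakk>y \<in> carrier G; y \<notin> K; \<And>k. k \<in> K \<Longrightarrow> y \<otimes> k = k \<otimes> y\<rbrakk> \<Longrightarrow> False"
    and connected: "connected (with_proj (coset_graph G L (double_coset G L g)))"
begin

definition \<Gamma> :: "'a set pair_pre_digraph" where
  "\<Gamma> = coset_graph G L (double_coset G L g)"

abbreviation V where "V \<equiv> pverts \<Gamma>"

definition vx :: "'a \<Rightarrow> 'a set" where
  "vx x = L #> x"

lemma L_carrier: "l \<in> L \<Longrightarrow> l \<in> carrier G"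
  using subgroup_L subgroup.subset by blast

lemma ab_carrier [simp]: "a \<in> carrier G" "b \<in> carrier G" "a \<in> L" "b \<in> L" "\<one> \<in> L" "a \<otimes> a \<in> L"
proof -
  show L: "a \<in> L" "b \<in> L" "\<one> \<in> L" "a \<otimes> a \<in> L" unfolding L_eq by blast+
  show "a \<in> carrier G" "b \<in> carrier G" using L L_carrier by blast+
qed

declare g_carrier [simp] p_carrier [simp]

lemma L_closed: "\<lbrakk>l \<in> L; m \<in> L\<rbrakk> \<Longrightarrow> l \<otimes> m \<in> L" "l \<in> L \<Longrightarrow> inv l \<in> L"
  using subgroup_L by (auto simp: subgroup.m_closed subgroup.m_inv_closed)

lemma gb: "g \<otimes> b = b \<otimes> g"
  using gg m_assoc[of g g g] by simp

lemma rels0: "a \<otimes> (a \<otimes> a) = \<one>" "b \<otimes> b = \<one>" "a \<otimes> b = b \<otimes> (a \<otimes> a)" "g \<otimes> g = b" "p \<otimes> p = \<one>"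
  "p \<otimes> a = a \<otimes> p" "p \<otimes> b = b \<otimes> p" "p \<otimes> g = b \<otimes> (g \<otimes> p)" "g \<otimes> b = b \<otimes> g"
  by (simp_all add: aaa bb ab gg pp pg gb p_L)

lemma rels1:
  assumes x: "x \<in> carrier G"
  shows "a \<otimes> (a \<otimes> (a \<otimes> x)) = x" "b \<otimes> (b \<otimes> x) = x" "a \<otimes> (b \<otimes> x) = b \<otimes> (a \<otimes> (a \<otimes> x))"
    "g \<otimes> (g \<otimes> x) = b \<otimes> x" "p \<otimes> (p \<otimes> x) = x"
    "p \<otimes> (a \<otimes> x) = a \<otimes> (p \<otimes> x)" "p \<otimes> (b \<otimes> x) = b \<otimes> (p \<otimes> x)"
    "p \<otimes> (g \<otimes> x) = b \<otimes> (g \<otimes> (p \<otimes> x))" "g \<otimes> (b \<otimes> x) = b \<otimes> (g \<otimes> x)"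
proof -
  have "r \<otimes> x = s \<otimes> x" if "r = s" for r s using that by simp
  note * = rels0[THEN this]
  show "a \<otimes> (a \<otimes> (a \<otimes> x)) = x" "b \<otimes> (b \<otimes> x) = x" "a \<otimes> (b \<otimes> x) = b \<otimes> (a \<otimes> (a \<otimes> x))"
    "g \<otimes> (g \<otimes> x) = b \<otimes> x" "p \<otimes> (p \<otimes> x) = x"
    "p \<otimes> (a \<otimes> x) = a \<otimes> (p \<otimes> x)" "p \<otimes> (b \<otimes> x) = b \<otimes> (p \<otimes> x)"
    "p \<otimes> (g \<otimes> x) = b \<otimes> (g \<otimes> (p \<otimes> x))" "g \<otimes> (b \<otimes> x) = b \<otimes> (g \<otimes> x)"
    using * x by (simp_all add: m_assoc)
qed

lemma invs: "inv a = a \<otimes> a" "inv b = b" "inv g = b \<otimes> g" "inv p = p"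
proof -
  show "inv a = a \<otimes> a" by (rule inv_equality) (simp_all add: rels0 m_assoc)
  show "inv b = b" by (rule inv_equality) (simp_all add: rels0)
  show "inv g = b \<otimes> g" by (rule inv_equality) (simp_all add: rels0 m_assoc)
  show "inv p = p" by (rule inv_equality) (simp_all add: rels0)
qed

text \<open>Rewriting with these equations moves \<open>b\<close> to the left and \<open>p\<close> to the right.\<close>

lemmas rels = rels0 rels1 invs inv_mult_group m_assoc

text \<open>The inverse of \<open>g\<close> is \<open>b \<otimes> g\<close>, so this is
  \<open>g_L\<close> applied to \<open>l \<otimes> b\<close>.\<close>

lemma gLg: "\<lbrakk>l \<in> L; g \<otimes> (l \<otimes> g) \<in> L\<rbrakk> \<Longrightarrow> l = \<one> \<or> l = b"
proof -
  assume l: "l \<in> L" "g \<otimes> (l \<otimes> g) \<in> L"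
  have lc: "l \<in> carrier G" using l L_carrier by blast
  have "g \<otimes> ((l \<otimes> b) \<otimes> inv g) = g \<otimes> (l \<otimes> g)" using lc by (simp add: rels)
  then have "l \<otimes> b = \<one> \<or> l \<otimes> b = b" using g_L[of "l \<otimes> b"] l L_closed(1)[OF l(1)] by simp
  then show ?thesis
  proof
    assume "l \<otimes> b = \<one>"
    then have "l \<otimes> b \<otimes> b = b" by simp
    then show ?thesis using lc by (simp add: rels)
  next
    assume "l \<otimes> b = b"
    then show ?thesis using lc by simp
  qed
qed

lemma a_ne_b: "a \<noteq> b"
proof
  assume "a = b"
  then have "a \<otimes> (a \<otimes> a) = a" by (simp add: bb)
  then show False using aaa a_ne by simp
qed

lemma aa_ne: "a \<otimes> a \<noteq> \<one>" "a \<otimes> a \<noteq> b"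
proof -
  show "a \<otimes> a \<noteq> \<one>" using aaa a_ne by auto
  show "a \<otimes> a \<noteq> b"
  proof
    assume "a \<otimes> a = b"
    then have "a \<otimes> b = \<one>" using aaa by simp
    then have "a \<otimes> b \<otimes> b = b" by simp
    then show False using a_ne_b by (simp add: rels)
  qed
qed

text \<open>Once \<open>rels\<close> has brought a quotient of representatives into normal form, the
  distinctness of vertices around the line reduces to these two facts.\<close>

lemma gag: "g \<otimes> (a \<otimes> g) \<notin> L" "g \<otimes> (a \<otimes> (a \<otimes> g)) \<notin> L"
  using gLg[of a] gLg[of "a \<otimes> a"] a_ne a_ne_b aa_ne by (auto simp: m_assoc)

lemma bL: "x \<in> carrier G \<Longrightarrow> b \<otimes> x \<in> L \<longleftrightarrow> x \<in> L"
proof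
  assume "x \<in> carrier G" "b \<otimes> x \<in> L"
  then have "b \<otimes> (b \<otimes> x) \<in> L" by (simp add: L_closed)
  then show "x \<in> L" using \<open>x \<in> carrier G\<close> by (simp add: rels)
qed (simp add: L_closed)

section \<open>Vertices and adjacency of the coset graph\<close>

lemma vx_eq: "\<lbrakk>x \<in> carrier G; y \<in> carrier G\<rbrakk> \<Longrightarrow> vx x = vx y \<longleftrightarrow> x \<otimes> inv y \<in> L"
proof
  assume x: "x \<in> carrier G" "y \<in> carrier G" and "vx x = vx y"
  then have "x \<in> L #> y" using rcos_self[OF x(1) subgroup_L] by (simp add: vx_def)
  then obtain l where "l \<in> L" "x = l \<otimes> y" by (auto simp: r_coset_def)
  then show "x \<otimes> inv y \<in> L" using x L_carrier by (simp add: m_assoc)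
next
  assume x: "x \<in> carrier G" "y \<in> carrier G" and l: "x \<otimes> inv y \<in> L"
  then have "x = (x \<otimes> inv y) \<otimes> y" by (simp add: m_assoc)
  then have "x \<in> L #> y" unfolding r_coset_def using l by blast
  then show "vx x = vx y" using repr_independence[OF _ x(2) subgroup_L] by (simp add: vx_def)
qed

lemma vx_absorb: "\<lbrakk>l \<in> L; x \<in> carrier G\<rbrakk> \<Longrightarrow> vx (l \<otimes> x) = vx x"
  using L_carrier by (simp add: vx_eq m_assoc)

lemma V_eq: "V = vx ` carrier G"
  by (auto simp: \<Gamma>_def coset_graph_def RCOSETS_def vx_def)

lemma vx_V [simp]: "x \<in> carrier G \<Longrightarrow> vx x \<in> V"
  by (simp add: V_eq)

lemma finite_V: "finite V"
  by (simp add: V_eq finite_G)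

lemma arcs_iff:
  assumes x: "x \<in> carrier G"
  shows "(vx x, w) \<in> parcs \<Gamma> \<longleftrightarrow> (\<exists>l\<in>L. w = vx (g \<otimes> (l \<otimes> x)))"
proof
  assume "(vx x, w) \<in> parcs \<Gamma>"
  then obtain x1 x2 where h: "vx x = vx x1" "w = vx x2" "x1 \<in> carrier G" "x2 \<in> carrier G"
    "x2 \<otimes> inv x1 \<in> double_coset G L g"
    by (auto simp: \<Gamma>_def coset_graph_def vx_def)
  then obtain l m where lm: "l \<in> L" "m \<in> L" "x2 \<otimes> inv x1 = l \<otimes> g \<otimes> m"
    unfolding double_coset_def r_coset_def set_mult_def by blast
  have lc: "l \<in> carrier G" "m \<in> carrier G" using lm L_carrier by auto
  have "x2 = (x2 \<otimes> inv x1) \<otimes> x1" using h by (simp add: m_assoc)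
  then have x2: "x2 = l \<otimes> (g \<otimes> (m \<otimes> x1))" using lm lc h by (simp add: m_assoc)
  have n: "x1 \<otimes> inv x \<in> L" using h vx_eq[of x1 x] x by simp
  have "x1 = (x1 \<otimes> inv x) \<otimes> x" using h x by (simp add: m_assoc)
  then have "m \<otimes> x1 = (m \<otimes> (x1 \<otimes> inv x)) \<otimes> x" using h x lc by (simp add: m_assoc)
  moreover have "w = vx (g \<otimes> (m \<otimes> x1))"
    using vx_absorb[OF lm(1), of "g \<otimes> (m \<otimes> x1)"] lc h(2,3) x2 by simp
  ultimately have "w = vx (g \<otimes> ((m \<otimes> (x1 \<otimes> inv x)) \<otimes> x))" by simp
  moreover have "m \<otimes> (x1 \<otimes> inv x) \<in> L" using lm n L_closed by blast
  ultimately show "\<exists>l\<in>L. w = vx (g \<otimes> (l \<otimes> x))" by blast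
next
  assume "\<exists>l\<in>L. w = vx (g \<otimes> (l \<otimes> x))"
  then obtain l where l: "l \<in> L" "w = vx (g \<otimes> (l \<otimes> x))" by blast
  have lc: "l \<in> carrier G" using l L_carrier by auto
  have "g \<otimes> (l \<otimes> x) \<otimes> inv x = \<one> \<otimes> g \<otimes> l" using x lc by (simp add: m_assoc)
  also have "\<dots> \<in> double_coset G L g"
    unfolding double_coset_def r_coset_def set_mult_def using l(1) ab_carrier(5) by blast
  finally show "(vx x, w) \<in> parcs \<Gamma>"
    using l(2) x lc unfolding \<Gamma>_def coset_graph_def vx_def pair_pre_digraph.simps
    by (intro CollectI exI[of _ x] exI[of _ "g \<otimes> (l \<otimes> x)"]) simp
qed

lemma arcsD: "(v, w) \<in> parcs \<Gamma> \<Longrightarrow> v \<in> V \<and> w \<in> V"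
  by (auto simp: \<Gamma>_def coset_graph_def RCOSETS_def)

text \<open>Of the six elements of \<open>L\<close> only the three powers of \<open>a\<close>
  matter: \<open>b\<close> commutes with \<open>g\<close> and is then absorbed by the coset.\<close>

lemma arcs_cases:
  assumes "(vx x, w) \<in> parcs \<Gamma>" and x: "x \<in> carrier G"
  shows "w = vx (g \<otimes> x) \<or> w = vx (g \<otimes> (a \<otimes> x)) \<or> w = vx (g \<otimes> (a \<otimes> (a \<otimes> x)))"
proof -
  obtain l where l: "l \<in> L" "w = vx (g \<otimes> (l \<otimes> x))" using assms arcs_iff by blast
  have "l \<in> {\<one>, a, a \<otimes> a} \<or> (\<exists>m\<in>{\<one>, a, a \<otimes> a}. l = b \<otimes> m)"
    using l(1) unfolding L_eq by simp
  then consider "l \<in> {\<one>, a, a \<otimes> a}" | m where "m \<in> {\<one>, a, a \<otimes> a}" "l = b \<otimes> m"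
    by blast
  then show ?thesis
  proof cases
    case 1
    then show ?thesis using l(2) x by (auto simp: m_assoc)
  next
    case 2
    then have m: "m \<in> carrier G" by auto
    have "g \<otimes> (l \<otimes> x) = b \<otimes> (g \<otimes> (m \<otimes> x))" using x m by (simp add: 2(2) rels)
    then have "w = vx (g \<otimes> (m \<otimes> x))" using l(2) x m by (simp add: vx_absorb)
    then show ?thesis using 2(1) x by (auto simp: m_assoc)
  qed
qed

text \<open>Two successive steps by \<open>g\<close> amount to \<open>b\<close>, which lies in
  \<open>L\<close>, so the second step leads back.\<close>

lemma arcs_sym: "(v, w) \<in> parcs \<Gamma> \<Longrightarrow> (w, v) \<in> parcs \<Gamma>"
proof -
  assume vw: "(v, w) \<in> parcs \<Gamma>"
  then obtain x where x: "x \<in> carrier G" "v = vx x" using arcsD V_eq by blast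
  then obtain l where l: "l \<in> L" "w = vx (g \<otimes> (l \<otimes> x))" using vw arcs_iff by blast
  have lc: "l \<in> carrier G" using l L_carrier by auto
  have "vx x = vx (g \<otimes> (\<one> \<otimes> (g \<otimes> (l \<otimes> x))))"
    using vx_absorb[of "b \<otimes> l" x] l x lc by (simp add: L_closed rels)
  then show "(w, v) \<in> parcs \<Gamma>"
    unfolding l(2) x(2) using ab_carrier(5) x(1) lc by (subst arcs_iff) (simp, blast)
qed

text \<open>For \<open>e \<in> {\<one>, p}\<close> the map \<open>L x \<mapsto> L e x y\<close> is well defined since \<open>p\<close> centralises \<open>L\<close>.\<close>

definition act :: "'a \<Rightarrow> 'a \<Rightarrow> 'a set \<Rightarrow> 'a set" where
  "act e y v = (if v \<in> V then e <# (v #> y) else v)"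

lemma ep: "e \<in> {\<one>, p} \<Longrightarrow> e \<in> carrier G \<and> e \<otimes> e = \<one>"
  by (auto simp: rels)

lemma ep_L: "\<lbrakk>e \<in> {\<one>, p}; l \<in> L\<rbrakk> \<Longrightarrow> e \<otimes> l = l \<otimes> e"
  using p_L L_carrier by auto

lemma ep_closed: "\<lbrakk>e \<in> {\<one>, p}; f \<in> {\<one>, p}\<rbrakk> \<Longrightarrow> e \<otimes> f \<in> {\<one>, p}"
  by (auto simp: rels)

lemma act_vx:
  assumes e: "e \<in> {\<one>, p}" and x: "x \<in> carrier G" and y: "y \<in> carrier G"
  shows "act e y (vx x) = vx (e \<otimes> (x \<otimes> y))"
proof -
  have ec: "e \<in> carrier G" using e by auto
  have Lc: "L \<subseteq> carrier G" using L_carrier by auto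
  have "act e y (vx x) = e <# (L #> (x \<otimes> y))"
    using x y Lc by (simp add: act_def vx_def[symmetric]) (simp add: vx_def coset_mult_assoc)
  also have "\<dots> = (\<lambda>l. e \<otimes> (l \<otimes> (x \<otimes> y))) ` L" by (auto simp: l_coset_def r_coset_def)
  also have "\<dots> = (\<lambda>l. l \<otimes> (e \<otimes> (x \<otimes> y))) ` L"
  proof (rule image_cong[OF refl])
    fix l assume l: "l \<in> L"
    have lc: "l \<in> carrier G" using l L_carrier by auto
    have "e \<otimes> (l \<otimes> (x \<otimes> y)) = (e \<otimes> l) \<otimes> (x \<otimes> y)" using ec lc x y by (simp add: m_assoc)
    also have "\<dots> = l \<otimes> (e \<otimes> (x \<otimes> y))" using ep_L[OF e l] ec lc x y by (simp add: m_assoc)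
    finally show "e \<otimes> (l \<otimes> (x \<otimes> y)) = l \<otimes> (e \<otimes> (x \<otimes> y))" .
  qed
  also have "\<dots> = vx (e \<otimes> (x \<otimes> y))" by (auto simp: vx_def r_coset_def)
  finally show ?thesis .
qed

lemma act_outside: "v \<notin> V \<Longrightarrow> act e y v = v"
  by (simp add: act_def)

text \<open>Right multiplications compose in the opposite order. The components from
  \<open>{\<one>, p}\<close> act on the left and commute with each other.\<close>

lemma act_comp:
  assumes e: "e \<in> {\<one>, p}" "f \<in> {\<one>, p}" and y: "y \<in> carrier G" "z \<in> carrier G"
  shows "act e y \<circ> act f z = act (e \<otimes> f) (z \<otimes> y)"
proof
  fix v show "(act e y \<circ> act f z) v = act (e \<otimes> f) (z \<otimes> y) v"
  proof (cases "v \<in> V")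
    case True
    then obtain x where x: "x \<in> carrier G" "v = vx x" using V_eq by blast
    then show ?thesis
      using e y ep[OF e(1)] ep[OF e(2)] ep_closed[OF e] by (simp add: act_vx m_assoc)
  qed (simp add: act_outside)
qed

lemma act_one: "act \<one> \<one> = id"
proof
  fix v show "act \<one> \<one> v = id v"
  proof (cases "v \<in> V")
    case True
    then obtain x where x: "x \<in> carrier G" "v = vx x" using V_eq by blast
    then show ?thesis by (simp add: act_vx)
  qed (simp add: act_outside)
qed

lemma act_inverse:
  assumes e: "e \<in> {\<one>, p}" and y: "y \<in> carrier G"
  shows "act e y \<circ> act e (inv y) = id" "act e (inv y) \<circ> act e y = id"
  using act_comp[OF e e] y ep[OF e] by (simp_all add: act_one)

lemma act_arc:
  assumes e: "e \<in> {\<one>, p}" and y: "y \<in> carrier G" and vw: "(v, w) \<in> parcs \<Gamma>"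
  shows "(act e y v, act e y w) \<in> parcs \<Gamma>"
proof -
  obtain x where x: "x \<in> carrier G" "v = vx x" using vw arcsD V_eq by blast
  then obtain l where l: "l \<in> L" "w = vx (g \<otimes> (l \<otimes> x))" using vw arcs_iff by blast
  have lc: "l \<in> carrier G" using l L_carrier by auto
  have ec: "e \<in> carrier G" using ep[OF e] by blast
  have "act e y w = vx (e \<otimes> ((g \<otimes> (l \<otimes> x)) \<otimes> y))" using l x y lc by (simp add: act_vx[OF e])
  also have "\<dots> = vx (g \<otimes> (l \<otimes> (e \<otimes> (x \<otimes> y))))"
  proof (cases "e = p")
    case True
    have pl: "p \<otimes> (l \<otimes> (x \<otimes> y)) = l \<otimes> (p \<otimes> (x \<otimes> y))"
      using ep_L[of p l] l(1) lc x y by (metis insertCI m_assoc m_closed p_carrier)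
    \<comment> \<open>Moving \<open>p\<close> past \<open>g\<close> costs a factor \<open>b\<close>
      on the far left, which the coset absorbs.\<close>
    show ?thesis using x y lc vx_absorb[of b] by (simp add: True rels pl)
  next
    case False
    then show ?thesis using e x y lc by (simp add: m_assoc)
  qed
  finally show ?thesis
    using x y l(1) ec arcs_iff[of "e \<otimes> (x \<otimes> y)"] by (auto simp: act_vx[OF e])
qed

lemma act_total_aut:
  assumes e: "e \<in> {\<one>, p}" and y: "y \<in> carrier G"
  shows "act e y \<in> total_aut \<Gamma>"
proof -
  have y': "inv y \<in> carrier G" using y by simp
  have in_V: "act e z v \<in> V" if "v \<in> V" "z \<in> carrier G" for v z
    using that e ep[OF e] unfolding V_eq by (auto simp: act_vx)
  have inv: "act e (inv y) (act e y v) = v" for v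
    using act_inverse(2)[OF e y] by (metis comp_apply id_apply)
  have "bij (act e y)" using act_inverse[OF e y] by (intro o_bij)
  then have "act e y permutes V" using act_outside by (auto simp: permutes_def bij_iff)
  moreover have "(v, w) \<in> parcs \<Gamma> \<longleftrightarrow> (act e y v, act e y w) \<in> parcs \<Gamma>" for v w
    using act_arc[OF e y, of v w] act_arc[OF e y', of "act e y v" "act e y w"] by (auto simp: inv)
  ultimately show ?thesis by (simp add: total_aut_def)
qed

section \<open>A line of cosets and the rigidity of its 3-arcs\<close>

lemma closed_V:
  assumes "vx \<one> \<in> W" "\<And>v w. v \<in> W \<Longrightarrow> (v, w) \<in> parcs \<Gamma> \<Longrightarrow> w \<in> W"
  shows "V \<subseteq> W"
  using connected_closed[OF connected, folded \<Gamma>_def, of "vx \<one>" W] assms arcs_sym by auto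

abbreviation k where "k \<equiv> g \<otimes> a"

text \<open>Since \<open>k [^] (i + 1)\<close> is \<open>g \<otimes> a\<close> times
  \<open>k [^] i\<close>, consecutive cosets are adjacent, and right multiplication by
  \<open>k\<close> is the shunt. The factor \<open>a\<close> prevents turning back: powers of
  \<open>g\<close> alone would alternate between two vertices, as
  \<open>g \<otimes> g = b\<close>.\<close>

definition line :: "int \<Rightarrow> 'a set" where
  "line i = vx (k [^] i)"

lemma k_pow: "k [^] (i + 1) = g \<otimes> (a \<otimes> k [^] i)" for i :: int
proof -
  have "k [^] (i + 1) = k [^] (1 + i)" by (simp add: add.commute)
  also have "\<dots> = k \<otimes> k [^] i" by (subst int_pow_mult) simp_all
  finally show ?thesis by (simp add: m_assoc)
qed

lemma line_values: "line 0 = vx \<one>" "line 1 = vx (g \<otimes> a)" "line 2 = vx (g \<otimes> (a \<otimes> (g \<otimes> a)))"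
  "line (-1) = vx g" "line (-2) = vx (g \<otimes> (a \<otimes> (a \<otimes> (b \<otimes> g))))"
proof -
  show "line 0 = vx \<one>" by (simp add: line_def)
  show "line 1 = vx (g \<otimes> a)" by (simp add: line_def int_pow_1)
  have "k [^] (2::int) = g \<otimes> (a \<otimes> (g \<otimes> a))" using k_pow[of 1] by (simp add: int_pow_1)
  then show "line 2 = vx (g \<otimes> (a \<otimes> (g \<otimes> a)))" by (simp add: line_def)
  have m1: "k [^] (-1::int) = inv k" by (simp add: int_pow_neg int_pow_1)
  have "vx (inv k) = vx g" by (subst vx_eq) (simp_all add: rels L_closed bL)
  then show "line (-1) = vx g" by (simp add: line_def m1)
  have "k [^] (-2::int) = k [^] (-1 + -1 :: int)" by simp
  also have "\<dots> = inv k \<otimes> inv k" by (subst int_pow_mult) (simp_all add: m1)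
  finally have m2: "k [^] (-2::int) = inv k \<otimes> inv k" .
  have "vx (inv k \<otimes> inv k) = vx (g \<otimes> (a \<otimes> (a \<otimes> (b \<otimes> g))))" by (subst vx_eq) (simp_all add: rels L_closed bL)
  then show "line (-2) = vx (g \<otimes> (a \<otimes> (a \<otimes> (b \<otimes> g))))" by (simp add: line_def m2)
qed

sublocale cubic_line "\<lambda>v w. (v, w) \<in> parcs \<Gamma>" "total_aut \<Gamma>" line
proof
  show "(v, w) \<in> parcs \<Gamma> \<Longrightarrow> (w, v) \<in> parcs \<Gamma>" for v w by (rule arcs_sym)
  show "r = t" if E: "(v, p') \<in> parcs \<Gamma>" "(v, q) \<in> parcs \<Gamma>" "(v, r) \<in> parcs \<Gamma>" "(v, t) \<in> parcs \<Gamma>"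
    and d: "p' \<noteq> q" "p' \<noteq> r" "p' \<noteq> t" "q \<noteq> r" "q \<noteq> t" for v p' q r t
  proof -
    obtain x where x: "x \<in> carrier G" "v = vx x" using E arcsD V_eq by blast
    note c = arcs_cases[OF _ x(1), folded x(2)]
    show ?thesis using c[OF E(1)] c[OF E(2)] c[OF E(3)] c[OF E(4)] d by metis
  qed
  show "finite (total_aut \<Gamma>)" by (rule finite_total_aut[OF finite_V])
  show "id \<in> total_aut \<Gamma>" by (rule id_total_aut)
  show "h \<circ> k \<in> total_aut \<Gamma>" if "h \<in> total_aut \<Gamma>" "k \<in> total_aut \<Gamma>" for h k
    by (rule comp_total_aut[OF that])
  show "\<exists>k\<in>total_aut \<Gamma>. h \<circ> k = id \<and> k \<circ> h = id" if "h \<in> total_aut \<Gamma>" for h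
    by (rule inv_total_aut[OF that])
  show "(h v, h w) \<in> parcs \<Gamma>" if "h \<in> total_aut \<Gamma>" "(v, w) \<in> parcs \<Gamma>" for h v w
    using that arcsD[OF that(2)] by (simp add: total_aut_def)
  fix i :: int
  have kc: "k [^] i \<in> carrier G" by simp
  show "(line i, line (i + 1)) \<in> parcs \<Gamma>"
    unfolding line_def arcs_iff[OF kc] k_pow using ab_carrier(3) by blast
  show "line (i - 1) \<noteq> line (i + 1)"
  proof
    have c: "k [^] (i - 1) \<in> carrier G" by simp
    have e: "k [^] (i + 1) = g \<otimes> (a \<otimes> (g \<otimes> (a \<otimes> k [^] (i - 1))))"
      using k_pow[of i] k_pow[of "i - 1"] by simp
    assume "line (i - 1) = line (i + 1)"
    then have "k [^] (i + 1) \<otimes> inv (k [^] (i - 1)) \<in> L" using vx_eq[of "k [^] (i + 1)" "k [^] (i - 1)"]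
      by (simp add: line_def)
    then have "g \<otimes> (a \<otimes> (g \<otimes> a)) \<in> L" unfolding e using c by (simp add: m_assoc)
    then have "g \<otimes> (a \<otimes> (g \<otimes> a)) \<otimes> (a \<otimes> a) \<in> L" by (rule L_closed) simp
    then show False using gag by (simp add: rels)
  qed
  show "\<exists>h\<in>total_aut \<Gamma>. \<forall>j. h (line j) = line (i + j)"
  proof (intro bexI allI)
    fix j :: int
    have "k [^] j \<otimes> k [^] i = k [^] (i + j)" by (subst int_pow_mult[symmetric]) (simp_all add: add.commute)
    then show "act \<one> (k [^] i) (line j) = line (i + j)" by (simp add: line_def act_vx)
  qed (simp add: act_total_aut)
next
  fix h W assume h: "h \<in> total_aut \<Gamma>" and W: "line 0 \<in> W"
    "\<And>v w. v \<in> W \<Longrightarrow> (v, w) \<in> parcs \<Gamma> \<Longrightarrow> w \<in> W" "\<And>v. v \<in> W \<Longrightarrow> h v = v"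
  have "V \<subseteq> W" by (rule closed_V) (use W in \<open>auto simp: line_values\<close>)
  then show "h = id"
    using h W(3) by (auto simp: total_aut_def permutes_def fun_eq_iff)
qed

text \<open>The two involutions required by \<open>three_arc_rigid\<close>:
  \<open>act \<one> b\<close> fixes the line at -1 and 0 but not at -2 and 1, and
  \<open>act p p\<close> fixes it from -1 to 1 but not at -2 and 2.\<close>

lemma fixes_three_arc_imp_id:
  assumes "h \<in> total_aut \<Gamma>" "\<And>i. 0 \<le> i \<Longrightarrow> i \<le> 3 \<Longrightarrow> h (line i) = line i"
  shows "h = id"
proof (rule three_arc_rigid)
  have ln: "line (- 1 - 1) = line (-2)" "line (- 1 + 2) = line 1" "line (-1 + 3) = line 2" by simp_all
  show "fixes_arc (act \<one> b) (-1) (-1 + 1)" unfolding fixes_arc_def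
  proof (intro conjI allI impI)
    fix t :: int assume "- 1 \<le> t \<and> t \<le> - 1 + 1"
    then consider "t = - 1" | "t = 0" by linarith
    then show "act \<one> b (line t) = line t"
      by cases (simp_all add: act_vx line_values vx_eq rels bL)
  qed (simp add: act_total_aut)
  show "act \<one> b (line (-1 - 1)) \<noteq> line (-1 - 1)" "act \<one> b (line (-1 + 2)) \<noteq> line (-1 + 2)"
    unfolding ln by (simp_all add: act_vx line_values vx_eq rels bL gag)
  show "act \<one> b \<circ> act \<one> b = id" by (subst act_comp) (simp_all add: act_one rels)
  show "fixes_arc (act p p) (-1) (-1 + 2)" unfolding fixes_arc_def
  proof (intro conjI allI impI)
    fix t :: int assume "- 1 \<le> t \<and> t \<le> - 1 + 2"
    then consider "t = - 1" | "t = 0" | "t = 1" by linarith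
    then show "act p p (line t) = line t"
      by cases (simp_all add: act_vx line_values vx_eq rels bL)
  qed (simp add: act_total_aut)
  show "act p p (line (-1 - 1)) \<noteq> line (-1 - 1)" "act p p (line (-1 + 3)) \<noteq> line (-1 + 3)"
    unfolding ln by (simp_all add: act_vx line_values vx_eq rels bL gag)
  show "act p p \<circ> act p p = id" by (subst act_comp) (simp_all add: act_one rels)
  show "fixes_arc h 0 (0 + 3)" using assms by (simp add: fixes_arc_def)
qed

end

section \<open>Transitivity on arcs from local data along a line\<close>

context cubic_line
begin

text \<open>Induction on the length: the next vertex of the target is pulled back by the map found
  so far. It becomes \<open>a (i + 1)\<close> or the third neighbour of \<open>a i\<close>, and in
  the second case an element supplied by \<open>moves\<close> carries \<open>a (i + 1)\<close>
  there.\<close>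

lemma arc_transitive_subset:
  assumes B: "B \<subseteq> A" "\<And>h k. h \<in> B \<Longrightarrow> k \<in> B \<Longrightarrow> h \<circ> k \<in> B"
    and vertex: "\<exists>h\<in>B. h (a 0) = f 0"
    and nbr: "\<And>w. E (a 0) w \<Longrightarrow> \<exists>h\<in>B. h (a 0) = a 0 \<and> h (a 1) = w"
    and moves: "\<And>m. \<lbrakk>1 \<le> m; m < s\<rbrakk> \<Longrightarrow> \<exists>h\<in>B. fixes_arc h 0 (int m) \<and> h (a (int m + 1)) \<noteq> a (int m + 1)"
    and f: "\<And>j. j < i \<Longrightarrow> E (f j) (f (Suc j))" "\<And>j. Suc j < i \<Longrightarrow> f j \<noteq> f (Suc (Suc j))" and "i \<le> s"
  shows "\<exists>h\<in>B. \<forall>j\<le>i. h (a (int j)) = f j"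
  using f \<open>i \<le> s\<close>
proof (induction i)
  case 0
  then show ?case using vertex by auto
next
  case (Suc i)
  then obtain h where h: "h \<in> B" "\<And>j. j \<le> i \<Longrightarrow> h (a (int j)) = f j" by force
  have hA: "h \<in> A" using h(1) B(1) by blast
  \<comment> \<open>The inverse is taken in \<open>A\<close>, because \<open>B\<close> is only
    assumed to be closed under composition.\<close>
  obtain h' where h': "h' \<in> A" "h \<circ> h' = id" "h' \<circ> h = id" using inv_A[OF hA] by blast
  have hh: "h (h' v) = v" "h' (h v) = v" for v using h'(2,3) by (metis comp_apply id_apply)+
  define w where "w = h' (f (Suc i))"
  have hw: "h w = f (Suc i)" by (simp add: w_def hh)
  have "E (f i) (f (Suc i))" using Suc.prems(1)[of i] by simp
  then have Ew: "E (a (int i)) w" using adj_A[OF h'(1), of "f i" "f (Suc i)"] h(2)[of i] hh(2)[of "a (int i)"]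
    by (simp add: w_def)
  have "\<exists>k\<in>B. fixes_arc k 0 (int i) \<and> k (a (int i + 1)) = w \<or> w = a (int i + 1)"
  proof (cases "i = 0")
    case True
    then obtain k where "k \<in> B" "k (a 0) = a 0" "k (a 1) = w" using nbr Ew by auto
    then have "fixes_arc k 0 (int i)"
      unfolding fixes_arc_def True using B(1) by (auto dest: order_antisym)
    with \<open>k \<in> B\<close> \<open>k (a 1) = w\<close> show ?thesis using True by auto
  next
    case False
    then obtain k where k: "k \<in> B" "fixes_arc k 0 (int i)" "k (a (int i + 1)) \<noteq> a (int i + 1)"
      using moves[of i] Suc.prems by auto
    have kA: "k \<in> A" using k B by blast
    have ki: "k (a (int i)) = a (int i)" "k (a (int i - 1)) = a (int i - 1)"
      using fixes_arcD[OF k(2), of "int i"] fixes_arcD[OF k(2), of "int i - 1"] False by auto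
    have "E (a (int i)) (k (a (int i + 1)))" using adj_A[OF kA line_adj[of "int i"]] ki by simp
    moreover have "a (int i - 1) \<noteq> k (a (int i + 1))"
      using inj_A[OF kA, of "a (int i - 1)" "a (int i + 1)"] ki line_arc[of "int i"] by auto
    moreover have "w \<noteq> a (int i - 1)"
    proof
      assume "w = a (int i - 1)"
      then have "f (Suc i) = h (a (int (i - 1)))" using hw False by (simp add: of_nat_diff)
      also have "\<dots> = f (i - 1)" using h(2) by simp
      finally show False using Suc.prems(2)[of "i - 1"] False by simp
    qed
    ultimately have "w = k (a (int i + 1)) \<or> w = a (int i + 1)"
      using cubic[OF line_adj'[of "int i"] line_adj[of "int i"] _ Ew] k(3) line_arc[of "int i"] by metis
    then show ?thesis using k by auto
  qed
  then show ?case
  proof (elim bexE disjE conjE)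
    fix k assume k: "k \<in> B" "fixes_arc k 0 (int i)" "k (a (int i + 1)) = w"
    have "(h \<circ> k) (a (int j)) = f j" if "j \<le> Suc i" for j
    proof (cases "j = Suc i")
      case True
      then show ?thesis using k(3) hw by (simp add: add.commute)
    next
      case False
      then show ?thesis using that h(2)[of j] fixes_arcD[OF k(2), of "int j"] by simp
    qed
    then show ?thesis using B(2)[OF h(1) k(1)] by blast
  next
    assume w: "w = a (int i + 1)"
    have "h (a (int j)) = f j" if "j \<le> Suc i" for j
      using that h(2)[of j] hw w by (cases "j = Suc i") (auto simp: add.commute)
    then show ?thesis using h(1) by blast
  qed
qed

end

section \<open>The full automorphism group\<close>

context cubic_amalgam
begin

definition acts :: "('a set \<Rightarrow> 'a set) set" where
  "acts = {act e y | e y. e \<in> {\<one>, p} \<and> y \<in> carrier G}"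

lemma actsI: "\<lbrakk>e \<in> {\<one>, p}; y \<in> carrier G\<rbrakk> \<Longrightarrow> act e y \<in> acts"
  unfolding acts_def by blast

lemma line_3: "line 3 = vx (g \<otimes> (a \<otimes> (g \<otimes> (a \<otimes> (g \<otimes> a)))))"
proof -
  have "k [^] (2::int) = g \<otimes> (a \<otimes> (g \<otimes> a))" using k_pow[of 1] by (simp add: int_pow_1)
  then show ?thesis using k_pow[of 2] by (simp add: line_def)
qed

lemma acts_three_arc_transitive:
  assumes "f 0 \<in> V" "\<And>j. j < i \<Longrightarrow> (f j, f (Suc j)) \<in> parcs \<Gamma>" "\<And>j. Suc j < i \<Longrightarrow> f j \<noteq> f (Suc (Suc j))"
    and "i \<le> 3"
  shows "\<exists>h\<in>acts. \<forall>j\<le>i. h (line (int j)) = f j"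
proof (rule arc_transitive_subset[where s = 3])
  show "acts \<subseteq> total_aut \<Gamma>" using act_total_aut unfolding acts_def by blast
  show "h \<circ> k \<in> acts" if hk: "h \<in> acts" "k \<in> acts" for h k
  proof -
    obtain e y f z where h: "h = act e y" "e \<in> {\<one>, p}" "y \<in> carrier G"
      and k: "k = act f z" "f \<in> {\<one>, p}" "z \<in> carrier G"
      using hk unfolding acts_def by blast
    show ?thesis unfolding h(1) k(1) using h k by (subst act_comp) (auto intro!: actsI ep_closed simp: rels)
  qed
  show "\<exists>h\<in>acts. h (line 0) = f 0"
  proof -
    obtain x where x: "x \<in> carrier G" "f 0 = vx x" using assms(1) V_eq by blast
    then have "act \<one> x (line 0) = f 0" by (simp add: line_values act_vx)
    then show ?thesis using actsI[of \<one> x] x by blast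
  qed
  show "\<exists>h\<in>acts. h (line 0) = line 0 \<and> h (line 1) = w" if w: "(line 0, w) \<in> parcs \<Gamma>" for w
  proof -
    have "\<exists>l\<in>L. w = vx (g \<otimes> l)"
    proof -
      obtain l where "l \<in> L" "w = vx (g \<otimes> (l \<otimes> \<one>))"
        using w arcs_iff[of \<one> w] by (auto simp: line_values)
      then show ?thesis using L_carrier[of l] by auto
    qed
    then obtain l where l: "l \<in> L" "w = vx (g \<otimes> l)" by blast
    have lc: "l \<in> carrier G" using l L_carrier by blast
    have "act \<one> (a \<otimes> (a \<otimes> l)) (line 0) = line 0" "act \<one> (a \<otimes> (a \<otimes> l)) (line 1) = w"
      using lc l by (simp_all add: line_values act_vx vx_eq rels L_closed)
    then show ?thesis using actsI[of \<one> "a \<otimes> (a \<otimes> l)"] lc by auto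
  qed
  show "\<exists>h\<in>acts. fixes_arc h 0 (int m) \<and> h (line (int m + 1)) \<noteq> line (int m + 1)"
    if m: "1 \<le> m" "m < 3" for m
  proof -
    consider "m = 1" | "m = 2" using m by linarith
    then show ?thesis
    proof cases
      case 1
      let ?h = "act \<one> (a \<otimes> (a \<otimes> (b \<otimes> a)))"
      have "fixes_arc ?h 0 1" unfolding fixes_arc_def
      proof (intro conjI allI impI)
        fix t :: int assume "0 \<le> t \<and> t \<le> 1"
        then consider "t = 0" | "t = 1" by linarith
        then show "?h (line t) = line t"
          by cases (simp_all add: act_vx line_values vx_eq rels bL L_closed)
      qed (simp add: act_total_aut)
      moreover have "?h (line 2) \<noteq> line 2"
        by (simp add: act_vx line_values vx_eq rels bL gag)
      ultimately show ?thesis using actsI[of \<one> "a \<otimes> (a \<otimes> (b \<otimes> a))"] by (auto simp: 1)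
    next
      case 2
      let ?h = "act p (a \<otimes> (a \<otimes> (b \<otimes> (a \<otimes> p))))"
      have "fixes_arc ?h 0 2" unfolding fixes_arc_def
      proof (intro conjI allI impI)
        fix t :: int assume "0 \<le> t \<and> t \<le> 2"
        then consider "t = 0" | "t = 1" | "t = 2" by linarith
        then show "?h (line t) = line t"
          by cases (simp_all add: act_vx line_values vx_eq rels bL L_closed)
      qed (simp add: act_total_aut)
      moreover have "?h (line 3) \<noteq> line 3"
        by (simp add: act_vx line_3 vx_eq rels bL gag)
      ultimately show ?thesis using actsI[of p "a \<otimes> (a \<otimes> (b \<otimes> (a \<otimes> p)))"] by (auto simp: 2)
    qed
  qed
qed (use assms in auto)

text \<open>Some element of \<open>acts\<close> agrees with a given automorphism on one 3-arc; the
  quotient of the two fixes that arc and is trivial.\<close>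

lemma total_aut_eq: "total_aut \<Gamma> = acts"
proof
  show "acts \<subseteq> total_aut \<Gamma>" using act_total_aut unfolding acts_def by blast
  show "total_aut \<Gamma> \<subseteq> acts"
  proof
    fix h assume h: "h \<in> total_aut \<Gamma>"
    have lV: "line i \<in> V" for i by (simp add: line_def)
    have "h permutes V" using h by (simp add: total_aut_def)
    then have "h (line 0) \<in> V" using lV permutes_in_image by metis
    moreover have "(h (line (int j)), h (line (int (Suc j)))) \<in> parcs \<Gamma>" for j
      using adj_A[OF h line_adj[of "int j"]] by (simp add: add.commute)
    moreover have "h (line (int j)) \<noteq> h (line (int (Suc (Suc j))))" for j
      using inj_A[OF h, of "line (int j)" "line (int (Suc (Suc j)))"] line_arc[of "int j + 1"]
      by (auto simp: algebra_simps)
    ultimately obtain k where k: "k \<in> acts" "\<And>j. j \<le> 3 \<Longrightarrow> k (line (int j)) = h (line (int j))"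
      using acts_three_arc_transitive[of "\<lambda>j. h (line (int j))" 3] by auto
    obtain e y where ey: "e \<in> {\<one>, p}" "y \<in> carrier G" "k = act e y" using k(1) unfolding acts_def by blast
    let ?k' = "act e (inv y)"
    have kk: "k (?k' v) = v" "?k' (k v) = v" for v
      using act_inverse[OF ey(1,2)] unfolding ey(3) by (metis comp_apply id_apply)+
    have "?k' \<circ> h = id"
    proof (rule fixes_three_arc_imp_id)
      show "?k' \<circ> h \<in> total_aut \<Gamma>" using comp_total_aut[OF act_total_aut h] ey by simp
      show "(?k' \<circ> h) (line i) = line i" if "0 \<le> i" "i \<le> 3" for i
        using k(2)[of "nat i"] kk(2)[of "line i"] that by simp
    qed
    then have "h = k" using kk(1) by (metis comp_apply id_apply ext)
    then show "h \<in> acts" using k by simp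
  qed
qed

text \<open>Four vertices suffice: \<open>L\<close> shows that \<open>e \<otimes> y\<close> lies in
  \<open>L\<close>, \<open>L g\<close> leaves only \<open>\<one>\<close> and \<open>b\<close>,
  \<open>L g a\<close> excludes \<open>b\<close>, and \<open>L g a g a\<close> excludes
  \<open>e = p\<close>.\<close>

lemma act_faithful:
  assumes e: "e \<in> {\<one>, p}" and y: "y \<in> carrier G" and id: "act e y = id"
  shows "e = \<one> \<and> y = \<one>"
proof -
  have fx: "e \<otimes> (x \<otimes> y) \<otimes> inv x \<in> L" if "x \<in> carrier G" for x
    using fun_cong[OF id, of "vx x"] that y e ep[OF e] by (simp add: act_vx vx_eq)
  define l where "l = e \<otimes> y"
  have l: "l \<in> L" using fx[of \<one>] y ep[OF e] by (simp add: l_def)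
  have lc: "l \<in> carrier G" using l L_carrier by blast
  have yl: "y = e \<otimes> l" using ep[OF e] y by (simp add: l_def m_assoc[symmetric])
  have pe: "p \<otimes> (x \<otimes> (p \<otimes> l)) = p \<otimes> (x \<otimes> (l \<otimes> p))" for x using p_L[OF l] by simp
  have "g \<otimes> (l \<otimes> inv g) \<in> L"
  proof (cases "e = \<one>")
    case True
    then show ?thesis using fx[of g] yl lc by (simp add: m_assoc)
  next
    case False
    then have "e = p" using e by simp
    then show ?thesis using fx[of g] yl lc by (simp add: rels bL)
  qed
  then have "l = \<one> \<or> l = b" by (rule g_L[OF l])
  moreover have "l \<noteq> b"
  proof
    assume lb: "l = b"
    show False
    proof (cases "e = \<one>")
      case True
      then show ?thesis using fx[of "g \<otimes> a"] yl gag by (simp add: lb rels bL)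
    next
      case False
      then have "e = p" using e by simp
      then show ?thesis using fx[of "g \<otimes> a"] yl gag by (simp add: lb rels bL)
    qed
  qed
  ultimately have l1: "l = \<one>" by blast
  moreover have "e = \<one>"
  proof (rule ccontr)
    assume "e \<noteq> \<one>"
    then have "e = p" using e by simp
    then show False using fx[of "g \<otimes> (a \<otimes> (g \<otimes> a))"] yl gag by (simp add: l1 rels bL)
  qed
  ultimately show ?thesis using yl by simp
qed

section \<open>Parity with respect to \<open>K\<close>, and permutation groups given by
  pairs\<close>

lemma K_carrier: "x \<in> K \<Longrightarrow> x \<in> carrier G"
  using subgroup_K subgroup.subset by blast

lemma K_mult: "\<lbrakk>x \<in> carrier G; y \<in> carrier G\<rbrakk> \<Longrightarrow> x \<otimes> y \<in> K \<longleftrightarrow> (x \<in> K \<longleftrightarrow> y \<in> K)"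
proof -
  assume c: "x \<in> carrier G" "y \<in> carrier G"
  have i: "inv z \<in> K" if "z \<in> K" for z using subgroup_K that by (simp add: subgroup.m_inv_closed)
  have m: "z \<otimes> w \<in> K" if "z \<in> K" "w \<in> K" for z w using subgroup_K that by (simp add: subgroup.m_closed)
  have "y \<in> K" if "x \<in> K" "x \<otimes> y \<in> K"
    using m[OF i[OF that(1)] that(2)] c by (simp add: m_assoc[symmetric])
  moreover have "x \<in> K" if "y \<in> K" "x \<otimes> y \<in> K"
    using m[OF that(2) i[OF that(1)]] c by (simp add: m_assoc)
  ultimately show ?thesis using m K_index c by blast
qed

lemma K_one [simp]: "\<one> \<in> K"
  using subgroup_K by (simp add: subgroup.one_closed)

lemma K_inv: "x \<in> carrier G \<Longrightarrow> inv x \<in> K \<longleftrightarrow> x \<in> K"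
  using K_mult[of x "inv x"] by simp

lemma vx_parity: "\<lbrakk>x \<in> carrier G; y \<in> carrier G; vx x = vx y\<rbrakk> \<Longrightarrow> x \<in> K \<longleftrightarrow> y \<in> K"
  using vx_eq[of x y] L_K K_mult[of x "inv y"] K_inv[of y] by auto

text \<open>Products and inverses are computed in \<open>{\<one>, p} \<times> G\<close> instead of
  among permutations. This serves all vertices and a single half alike, and on a half no
  faithfulness has to be known.\<close>

definition pair_group :: "('a \<times> 'a) set \<Rightarrow> 'a set set \<Rightarrow> bool" where
  "pair_group X S \<longleftrightarrow> S \<subseteq> V \<and> X \<subseteq> {\<one>, p} \<times> carrier G \<and> (\<one>, \<one>) \<in> X \<and>
     (\<forall>e y f z. (e, y) \<in> X \<and> (f, z) \<in> X \<longrightarrow> (e \<otimes> f, y \<otimes> z) \<in> X) \<and>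
     (\<forall>e y. (e, y) \<in> X \<longrightarrow> (e, inv y) \<in> X) \<and> (\<forall>e y v. (e, y) \<in> X \<and> v \<in> S \<longrightarrow> act e y v \<in> S)"

definition rep :: "'a set set \<Rightarrow> 'a \<times> 'a \<Rightarrow> 'a set \<Rightarrow> 'a set" where
  "rep S u = restrict (act (fst u) (snd u)) S"

lemma pair_groupD:
  assumes "pair_group X S" "(e, y) \<in> X"
  shows "e \<in> {\<one>, p}" "y \<in> carrier G" "(e, inv y) \<in> X" "v \<in> S \<Longrightarrow> act e y v \<in> S"
  using assms unfolding pair_group_def by blast+

text \<open>\<open>sym_group\<close> multiplies from left to right, which undoes the reversal in
  \<open>act_comp\<close>, so \<open>rep S\<close> respects products in their given order.\<close>

lemma rep_mult:
  assumes X: "pair_group X S" and u: "(e, y) \<in> X" "(f, z) \<in> X"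
  shows "rep S (e, y) \<otimes>\<^bsub>sym_group S\<^esub> rep S (f, z) = rep S (e \<otimes> f, y \<otimes> z)"
proof -
  note D = pair_groupD[OF X u(1)] pair_groupD[OF X u(2)]
  have "act f z \<circ> act e y = act (e \<otimes> f) (y \<otimes> z)"
    using act_comp[OF D(5) D(1) D(6) D(2)] D(1,5) by (auto simp: rels)
  then have "act f z (act e y v) = act (e \<otimes> f) (y \<otimes> z) v" for v by (metis comp_apply)
  then show ?thesis using D(4)
    by (auto simp: sym_group_def rep_def compose_def fun_eq_iff)
qed

lemma rep_one: "rep S (\<one>, \<one>) = \<one>\<^bsub>sym_group S\<^esub>"
  by (simp add: rep_def sym_group_def act_one id_def)

lemma rep_subgroup:
  assumes X: "pair_group X S" shows "subgroup (rep S ` X) (sym_group S)"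
    and "(e, y) \<in> X \<Longrightarrow> inv\<^bsub>perm_group S (rep S ` X)\<^esub> rep S (e, y) = rep S (e, inv y)"
proof -
  interpret S: group "sym_group S" by (rule group_sym_group)
  have inverse: "rep S (e, y) \<otimes>\<^bsub>sym_group S\<^esub> rep S (e, inv y) = \<one>\<^bsub>sym_group S\<^esub>"
      "rep S (e, inv y) \<otimes>\<^bsub>sym_group S\<^esub> rep S (e, y) = \<one>\<^bsub>sym_group S\<^esub>" if u: "(e, y) \<in> X" for e y
    using rep_mult[OF X u pair_groupD(3)[OF X u]] rep_mult[OF X pair_groupD(3)[OF X u] u]
      pair_groupD(1,2)[OF X u] ep by (auto simp: rep_one)
  have car: "rep S (e, y) \<in> carrier (sym_group S)" if u: "(e, y) \<in> X" for e y
  proof -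
    note D = pair_groupD[OF X u] pair_groupD(4)[OF X pair_groupD(3)[OF X u]]
    have i: "act e (inv y) (act e y v) = v" "act e y (act e (inv y) v) = v" for v
      using act_inverse[OF D(1,2)] by (metis comp_apply id_apply)+
    have "bij_betw (act e y) S S"
      by (rule bij_betwI[where g = "act e (inv y)"]) (use D(4,5) i in auto)
    then have "bij_betw (rep S (e, y)) S S" by (subst bij_betw_cong[of _ _ "act e y"]) (auto simp: rep_def)
    then show ?thesis by (simp add: sym_group_def Bij_def) (simp add: rep_def)
  qed
  have inv_eq: "inv\<^bsub>sym_group S\<^esub> rep S (e, y) = rep S (e, inv y)" if u: "(e, y) \<in> X" for e y
    using S.inv_equality[OF inverse(2)[OF u] car[OF u] car[OF pair_groupD(3)[OF X u]]] .
  show sub: "subgroup (rep S ` X) (sym_group S)"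
  proof (rule S.subgroupI)
    show "rep S ` X \<subseteq> carrier (sym_group S)" using car by auto
    show "rep S ` X \<noteq> {}" using X by (auto simp: pair_group_def)
    show "inv\<^bsub>sym_group S\<^esub> h \<in> rep S ` X" if "h \<in> rep S ` X" for h
      using that inv_eq pair_groupD(3)[OF X] by auto
    show "h \<otimes>\<^bsub>sym_group S\<^esub> k \<in> rep S ` X" if hk: "h \<in> rep S ` X" "k \<in> rep S ` X" for h k
    proof -
      obtain e y f z where u: "h = rep S (e, y)" "(e, y) \<in> X" "k = rep S (f, z)" "(f, z) \<in> X"
        using hk by auto
      have "(e \<otimes> f, y \<otimes> z) \<in> X" using X u unfolding pair_group_def by blast
      then show ?thesis using rep_mult[OF X u(2,4)] u by auto
    qed
  qed
  show "inv\<^bsub>perm_group S (rep S ` X)\<^esub> rep S (e, y) = rep S (e, inv y)" if u: "(e, y) \<in> X"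
    using S.m_inv_consistent[OF sub, of "rep S (e, y)"] u inv_eq[OF u] by auto
qed

definition all_pairs :: "('a \<times> 'a) set" where
  "all_pairs = {\<one>, p} \<times> carrier G"

text \<open>These pairs form \<open>A\<^sup>+\<close>: a pair with \<open>e \<otimes> y \<in> K\<close> preserves the two halves.\<close>

definition even_pairs :: "('a \<times> 'a) set" where
  "even_pairs = {(e, y). e \<in> {\<one>, p} \<and> y \<in> carrier G \<and> e \<otimes> y \<in> K}"

definition half :: "bool \<Rightarrow> 'a set set" where
  "half e = {vx x | x. x \<in> carrier G \<and> (x \<in> K) = e}"

lemma act_V: "\<lbrakk>e \<in> {\<one>, p}; y \<in> carrier G; v \<in> V\<rbrakk> \<Longrightarrow> act e y v \<in> V"
  using ep[of e] unfolding V_eq by (auto simp: act_vx)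

lemma pair_group_all: "pair_group all_pairs V"
  unfolding pair_group_def all_pairs_def using ep_closed by (auto simp: act_V rels)

lemma ep_K: "\<lbrakk>e \<in> {\<one>, p}; y \<in> carrier G\<rbrakk> \<Longrightarrow> e \<otimes> y \<in> K \<longleftrightarrow> (y \<in> K \<longleftrightarrow> e = \<one>)"
  using K_mult[of e y] p_K by auto

lemma pair_group_even: "S = V \<or> S = half c \<Longrightarrow> pair_group even_pairs S"
proof -
  assume S: "S = V \<or> S = half c"
  have p1: "p \<noteq> \<one>" using p_K by auto
  have "S \<subseteq> V" using S by (auto simp: half_def)
  moreover have "(e \<otimes> f, y \<otimes> z) \<in> even_pairs" if "(e, y) \<in> even_pairs" "(f, z) \<in> even_pairs" for e y f z
  proof -
    have u: "e \<in> {\<one>, p}" "y \<in> carrier G" "f \<in> {\<one>, p}" "z \<in> carrier G"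
      "y \<in> K \<longleftrightarrow> e = \<one>" "z \<in> K \<longleftrightarrow> f = \<one>"
      using that by (auto simp: even_pairs_def ep_K)
    have "e \<otimes> f = \<one> \<longleftrightarrow> (e = \<one> \<longleftrightarrow> f = \<one>)" using u(1,3) p1 pp by auto
    then show ?thesis using u ep_closed[OF u(1,3)] by (simp add: even_pairs_def ep_K K_mult)
  qed
  moreover have "(e, inv y) \<in> even_pairs" if "(e, y) \<in> even_pairs" for e y
    using that by (auto simp: even_pairs_def ep_K K_inv)
  moreover have "act e y v \<in> S" if u: "(e, y) \<in> even_pairs" "v \<in> S" for e y v
  proof (cases "S = V")
    case True
    then show ?thesis using u act_V by (auto simp: even_pairs_def)
  next
    case False
    then obtain x where x: "x \<in> carrier G" "(x \<in> K) = c" "v = vx x" using S u by (auto simp: half_def)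
    have e: "e \<in> {\<one>, p}" "y \<in> carrier G" "e \<otimes> y \<in> K" using u by (auto simp: even_pairs_def)
    have eq: "act e y v = vx (e \<otimes> (x \<otimes> y))" using e(1,2) x(1,3) by (simp add: act_vx)
    have ec: "e \<in> carrier G" using ep[OF e(1)] by blast
    have "(e \<otimes> (x \<otimes> y) \<in> K) = c"
      using e(3) x(2) K_mult[OF ec e(2)] K_mult[OF x(1) e(2)] K_mult[OF ec m_closed[OF x(1) e(2)]]
      by blast
    moreover have "e \<otimes> (x \<otimes> y) \<in> carrier G" using ec x(1) e(2) by simp
    ultimately have "act e y v \<in> half c" unfolding eq half_def by blast
    then show ?thesis using False S by blast
  qed
  moreover have "even_pairs \<subseteq> {\<one>, p} \<times> carrier G" "(\<one>, \<one>) \<in> even_pairs"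
    by (auto simp: even_pairs_def)
  ultimately show ?thesis unfolding pair_group_def by blast
qed

lemma graph_aut_eq: "graph_aut \<Gamma> = rep V ` all_pairs"
proof -
  have "graph_aut \<Gamma> = (\<lambda>h. restrict h V) ` total_aut \<Gamma>"
    using graph_aut_total restrict_total_aut by blast
  also have "\<dots> = rep V ` all_pairs"
    unfolding total_aut_eq acts_def rep_def all_pairs_def by force
  finally show ?thesis .
qed

lemma rep_inj: "inj_on (rep V) all_pairs"
proof (rule inj_onI)
  fix u v assume uv: "u \<in> all_pairs" "v \<in> all_pairs" and eq: "rep V u = rep V v"
  obtain e y f z where u: "u = (e, y)" "e \<in> {\<one>, p}" "y \<in> carrier G" and v: "v = (f, z)" "f \<in> {\<one>, p}" "z \<in> carrier G"
    using uv by (auto simp: all_pairs_def)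
  have "act e y w = act f z w" for w
    using fun_cong[OF eq, of w] act_outside[of w] u v by (cases "w \<in> V") (auto simp: rep_def)
  then have "act e y = act f z" by blast
  then have "act e (inv y) \<circ> act f z = id" using act_inverse(2)[OF u(2,3)] by simp
  then have "act (e \<otimes> f) (z \<otimes> inv y) = id" using act_comp u v by simp
  then have "e \<otimes> f = \<one> \<and> z \<otimes> inv y = \<one>"
    using act_faithful[OF ep_closed[OF u(2) v(2)], of "z \<otimes> inv y"] u v by simp
  then have "e \<otimes> f = f \<otimes> f" "z \<otimes> inv y = y \<otimes> inv y"
    using u v ep[OF v(2)] by simp_all
  then have "e = f" "z = y" using u(3) v(3) ep[OF u(2)] ep[OF v(2)]
    by (metis inv_closed right_cancel)+
  then show "u = v" using u v by simp
qed

lemma right_mult_rep: "y \<in> carrier G \<Longrightarrow> right_mult_action G L y = rep V (\<one>, y)"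
proof
  fix v assume y: "y \<in> carrier G"
  have V: "V = rcosets L" by (simp add: \<Gamma>_def coset_graph_def)
  show "right_mult_action G L y v = rep V (\<one>, y) v"
  proof (cases "v \<in> V")
    case True
    then obtain x where x: "x \<in> carrier G" "v = vx x" using V_eq by blast
    have "v #> y = vx (x \<otimes> y)"
      using x y L_carrier by (simp add: vx_def coset_mult_assoc subsetI)
    then show ?thesis using True x y by (simp add: right_mult_action_def rep_def V[symmetric] act_vx)
  next
    case False
    then show ?thesis by (simp add: right_mult_action_def rep_def V[symmetric])
  qed
qed

section \<open>The embedding of \<open>G\<close>, transitivity on 3-arcs, and normal
  subgroups\<close>

lemma group_Aut: "group (Aut \<Gamma>)"
  unfolding graph_aut_eq
  by (rule group.subgroup_imp_group[OF group_sym_group rep_subgroup(1)[OF pair_group_all]])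

lemma all_pairs_mem: "(e, y) \<in> all_pairs \<longleftrightarrow> e \<in> {\<one>, p} \<and> y \<in> carrier G"
  by (simp add: all_pairs_def)

lemma embedding_mon: "right_mult_action G L \<in> mon G (Aut \<Gamma>)"
  unfolding mon_def
proof (intro CollectI conjI homI)
  show "right_mult_action G L y \<in> carrier (Aut \<Gamma>)" if "y \<in> carrier G" for y
    using that by (simp add: right_mult_rep graph_aut_eq all_pairs_mem)
  show "right_mult_action G L (y \<otimes> z) = right_mult_action G L y \<otimes>\<^bsub>Aut \<Gamma>\<^esub> right_mult_action G L z"
    if "y \<in> carrier G" "z \<in> carrier G" for y z
    using that rep_mult[OF pair_group_all, of \<one> y \<one> z] by (simp add: right_mult_rep all_pairs_mem)
  show "inj_on (right_mult_action G L) (carrier G)"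
  proof (rule inj_onI)
    fix y z assume "y \<in> carrier G" "z \<in> carrier G" "right_mult_action G L y = right_mult_action G L z"
    then show "y = z" using inj_onD[OF rep_inj, of "(\<one>, y)" "(\<one>, z)"]
      by (simp add: right_mult_rep all_pairs_mem)
  qed
qed

lemma embedding_subgroup: "subgroup (right_mult_action G L ` carrier G) (Aut \<Gamma>)"
proof -
  interpret h: group_hom G "Aut \<Gamma>" "right_mult_action G L"
    using embedding_mon group_Aut by (intro group_hom.intro group_hom_axioms.intro is_group) (auto simp: mon_def)
  show ?thesis by (rule h.img_is_subgroup)
qed

text \<open>A coset of the image of \<open>G\<close> is determined by the first component of its
  pairs, \<open>\<one>\<close> or \<open>p\<close>; injectivity of \<open>rep V\<close> keeps the
  two apart.\<close>

lemma embedding_index: "card (rcosets\<^bsub>Aut \<Gamma>\<^esub> (right_mult_action G L ` carrier G)) = 2"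
proof -
  define R where "R e = rep V ` ({e} \<times> carrier G)" for e
  have H: "right_mult_action G L ` carrier G = R \<one>" by (force simp: R_def right_mult_rep)
  have coset: "R \<one> #>\<^bsub>Aut \<Gamma>\<^esub> rep V (e, y) = R e" if ey: "(e, y) \<in> all_pairs" for e y
  proof -
    have e: "e \<in> {\<one>, p}" "y \<in> carrier G" "e \<in> carrier G" using ey ep by (auto simp: all_pairs_mem)
    have "R \<one> #>\<^bsub>Aut \<Gamma>\<^esub> rep V (e, y) = (\<lambda>z. rep V (\<one>, z) \<otimes>\<^bsub>sym_group V\<^esub> rep V (e, y)) ` carrier G"
      by (auto simp: r_coset_def R_def)
    also have "\<dots> = (\<lambda>z. rep V (e, z \<otimes> y)) ` carrier G"
      using e by (intro image_cong refl) (simp add: rep_mult[OF pair_group_all] all_pairs_mem)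
    also have "\<dots> = (\<lambda>z. rep V (e, z)) ` ((\<lambda>z. z \<otimes> y) ` carrier G)" by (simp add: image_image)
    also have "(\<lambda>z. z \<otimes> y) ` carrier G = carrier G"
    proof (intro equalityI subsetI)
      fix x assume "x \<in> carrier G"
      then show "x \<in> (\<lambda>z. z \<otimes> y) ` carrier G"
        using e(2) by (intro image_eqI[of _ _ "x \<otimes> inv y"]) (simp_all add: m_assoc)
    qed (use e(2) in auto)
    also have "(\<lambda>z. rep V (e, z)) ` carrier G = R e" by (auto simp: R_def)
    finally show ?thesis .
  qed
  have "rcosets\<^bsub>Aut \<Gamma>\<^esub> (R \<one>) = (\<lambda>u. R \<one> #>\<^bsub>Aut \<Gamma>\<^esub> rep V u) ` all_pairs"
    by (auto simp: RCOSETS_def graph_aut_eq)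
  also have "\<dots> = R ` fst ` all_pairs"
    using coset by (force simp: image_image)
  also have "fst ` all_pairs = {\<one>, p}" unfolding all_pairs_def by (force intro: one_closed)
  finally have eq: "rcosets\<^bsub>Aut \<Gamma>\<^esub> (R \<one>) = {R \<one>, R p}" by simp
  have "R \<one> \<noteq> R p"
  proof
    assume "R \<one> = R p"
    moreover have "rep V (\<one>, \<one>) \<in> R \<one>" by (simp add: R_def)
    ultimately obtain y where "y \<in> carrier G" "rep V (\<one>, \<one>) = rep V (p, y)" unfolding R_def by auto
    then have "\<one> = p" using inj_onD[OF rep_inj, of "(\<one>, \<one>)" "(p, y)"] by (simp add: all_pairs_mem)
    then show False using p_K K_one by metis
  qed
  then show ?thesis unfolding H eq by simp
qed

lemma arc_transitive_\<Gamma>: "arc_transitive \<Gamma> (graph_aut \<Gamma>) 3"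
  unfolding arc_transitive_def
proof (intro conjI ballI allI impI)
  show "connected (with_proj \<Gamma>)" using connected by (simp add: \<Gamma>_def)
  have "s_arc \<Gamma> 3 (map (\<lambda>j. line (int j)) [0..<4])"
    unfolding s_arc_def
  proof (intro conjI allI impI)
    show "set (map (\<lambda>j. line (int j)) [0..<4]) \<subseteq> V" by (auto simp: line_def)
    show "(map (\<lambda>j. line (int j)) [0..<4] ! j, map (\<lambda>j. line (int j)) [0..<4] ! (j + 1)) \<in> parcs \<Gamma>"
      if "j < 3" for j
      using that line_adj[of "int j"] by (simp add: add.commute)
    show "map (\<lambda>j. line (int j)) [0..<4] ! (j - 1) \<noteq> map (\<lambda>j. line (int j)) [0..<4] ! (j + 1)"
      if j: "1 \<le> j \<and> j + 1 \<le> 3" for j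
    proof -
      consider "j = 1" | "j = 2" using j by linarith
      then show ?thesis using line_arc[of 1] line_arc[of 2] by cases simp_all
    qed
  qed simp
  then show "\<exists>vs. s_arc \<Gamma> 3 vs" by blast
next
  fix i vs ws assume i: "i \<in> {1..3}" and "s_arc \<Gamma> i vs \<and> s_arc \<Gamma> i ws"
  then have vs: "s_arc \<Gamma> i vs" and ws: "s_arc \<Gamma> i ws" by auto
  have ex: "\<exists>h\<in>acts. \<forall>j\<le>i. h (line (int j)) = us ! j" if us: "s_arc \<Gamma> i us" for us
  proof (rule acts_three_arc_transitive)
    show "us ! 0 \<in> V" using us by (auto simp: s_arc_def intro!: subsetD[of "set us" V])
    show "(us ! j, us ! Suc j) \<in> parcs \<Gamma>" if "j < i" for j using us that by (simp add: s_arc_def)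
    show "us ! j \<noteq> us ! Suc (Suc j)" if "Suc j < i" for j
    proof -
      have "1 \<le> Suc j \<and> Suc j + 1 \<le> i" using that by simp
      then have "us ! (Suc j - 1) \<noteq> us ! (Suc j + 1)" using us unfolding s_arc_def by blast
      then show ?thesis by simp
    qed
  qed (use i in simp)
  obtain h where h: "h \<in> acts" "\<And>j. j \<le> i \<Longrightarrow> h (line (int j)) = vs ! j" using ex[OF vs] by blast
  obtain k where k: "k \<in> acts" "\<And>j. j \<le> i \<Longrightarrow> k (line (int j)) = ws ! j" using ex[OF ws] by blast
  have hk: "h \<in> total_aut \<Gamma>" "k \<in> total_aut \<Gamma>" using h k by (simp_all add: total_aut_eq)
  obtain h' where h': "h' \<in> total_aut \<Gamma>" "h' \<circ> h = id" using inv_total_aut[OF hk(1)] by blast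
  have hh: "h' (h v) = v" for v using h'(2) by (metis comp_apply id_apply)
  have len: "length vs = i + 1" "length ws = i + 1" "set vs \<subseteq> V" using vs ws by (auto simp: s_arc_def)
  have "map (restrict (k \<circ> h') V) vs = ws"
  proof (rule nth_equalityI)
    fix j assume "j < length (map (restrict (k \<circ> h') V) vs)"
    then have j: "j \<le> i" "vs ! j \<in> V" using len nth_mem[of j vs] by auto
    have "h' (vs ! j) = line (int j)" using hh[of "line (int j)"] h(2)[OF j(1)] by simp
    then show "map (restrict (k \<circ> h') V) vs ! j = ws ! j" using j len k(2)[OF j(1)] by simp
  qed (use len in simp)
  moreover have "restrict (k \<circ> h') V \<in> graph_aut \<Gamma>"
    by (rule restrict_total_aut[OF comp_total_aut[OF hk(2) h'(1)]])
  ultimately show "\<exists>h\<in>graph_aut \<Gamma>. map h vs = ws" by blast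
qed

lemma rep_apply: "\<lbrakk>S \<subseteq> V; vx x \<in> S; e \<in> {\<one>, p}; x \<in> carrier G; y \<in> carrier G\<rbrakk> \<Longrightarrow>
    rep S (e, y) (vx x) = vx (e \<otimes> (x \<otimes> y))"
  by (simp add: rep_def act_vx)

text \<open>The orbits of \<open>N\<close> have the form \<open>{L x, L p x}\<close>, and those of
  \<open>\<one>\<close>, \<open>g\<close> and \<open>g \<otimes> a\<close> are already
  three.\<close>

lemma not_biquasiprimitive: "\<not> biquasiprimitive V (graph_aut \<Gamma>)"
proof
  assume bq: "biquasiprimitive V (graph_aut \<Gamma>)"
  define N where "N = rep V ` ({\<one>, p} \<times> {\<one>})"
  interpret A: group "Aut \<Gamma>" by (rule group_Aut)
  have N: "pair_group ({\<one>, p} \<times> {\<one>}) V"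
    unfolding pair_group_def using ep_closed by (auto simp: act_V rels)
  interpret S: group "sym_group V" by (rule group_sym_group)
  have sub: "subgroup N (Aut \<Gamma>)"
  proof (rule S.subgroup_incl)
    show "subgroup N (sym_group V)" unfolding N_def by (rule rep_subgroup(1)[OF N])
    show "subgroup (graph_aut \<Gamma>) (sym_group V)"
      unfolding graph_aut_eq by (rule rep_subgroup(1)[OF pair_group_all])
    show "N \<subseteq> graph_aut \<Gamma>" unfolding N_def graph_aut_eq by (auto simp: all_pairs_def)
  qed
  have normal: "N \<lhd> Aut \<Gamma>"
    unfolding A.normal_inv_iff
  proof (intro conjI ballI sub)
    fix x h assume "x \<in> carrier (Aut \<Gamma>)" "h \<in> N"
    then obtain e y f where x: "x = rep V (e, y)" "(e, y) \<in> all_pairs" and h: "h = rep V (f, \<one>)" "f \<in> {\<one>, p}"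
      unfolding N_def by (auto simp: graph_aut_eq)
    have e: "e \<in> {\<one>, p}" "y \<in> carrier G" using x(2) by (auto simp: all_pairs_mem)
    have "x \<otimes>\<^bsub>Aut \<Gamma>\<^esub> h \<otimes>\<^bsub>Aut \<Gamma>\<^esub> inv\<^bsub>Aut \<Gamma>\<^esub> x = rep V (e \<otimes> f \<otimes> e, y \<otimes> \<one> \<otimes> inv y)"
      using rep_subgroup(2)[OF pair_group_all x(2)] e h(2) ep_closed
      by (simp add: x(1) h(1) graph_aut_eq[symmetric] rep_mult[OF pair_group_all] all_pairs_mem)
    also have "e \<otimes> f \<otimes> e = f" using e(1) h(2) by (auto simp: rels)
    finally show "x \<otimes>\<^bsub>Aut \<Gamma>\<^esub> h \<otimes>\<^bsub>Aut \<Gamma>\<^esub> inv\<^bsub>Aut \<Gamma>\<^esub> x \<in> N" using e h(2) by (auto simp: N_def)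
  qed
  have "rep V (p, \<one>) \<noteq> rep V (\<one>, \<one>)"
    using inj_onD[OF rep_inj, of "(p, \<one>)" "(\<one>, \<one>)"] p_K K_one by (auto simp: all_pairs_mem)
  then have "N \<noteq> {\<one>\<^bsub>sym_group V\<^esub>}" unfolding N_def rep_one[symmetric] by auto
  then have fin: "finite (orbits (perm_group V N) V (\<lambda>h. h))" "card (orbits (perm_group V N) V (\<lambda>h. h)) \<le> 2"
    using bq normal unfolding biquasiprimitive_def by blast+
  define O' where "O' x = {vx x, vx (p \<otimes> x)}" for x
  have orbit: "orbit (perm_group V N) (\<lambda>h. h) (vx x) = O' x" if "x \<in> carrier G" for x
  proof -
    have "orbit (perm_group V N) (\<lambda>h. h) (vx x) = (\<lambda>h. h (vx x)) ` N"
      by (auto simp: orbit_def)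
    also have "\<dots> = O' x" using that by (auto simp: N_def rep_apply O'_def)
    finally show ?thesis .
  qed
  have sub: "{O' \<one>, O' g, O' (g \<otimes> a)} \<subseteq> orbits (perm_group V N) V (\<lambda>h. h)"
    unfolding orbits_def using orbit[of \<one>] orbit[of g] orbit[of "g \<otimes> a"] by (auto intro!: exI vx_V)
  have aK: "a \<in> K" using L_K ab_carrier(3) by blast
  then have gL: "g \<notin> L" "g \<otimes> a \<notin> L" using L_K g_K K_mult[of g a] by auto
  \<comment> \<open>Parity cannot separate \<open>vx g\<close> from \<open>vx p\<close>, but
    \<open>p\<close> commutes with every element of \<open>L\<close>, whereas commuting with
    \<open>g \<otimes> p\<close> would force \<open>b = \<one>\<close>.\<close>
  have gpL: "g \<otimes> p \<notin> L"
  proof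
    assume h: "g \<otimes> p \<in> L"
    have "p \<otimes> (g \<otimes> p) = (g \<otimes> p) \<otimes> p" by (rule p_L[OF h])
    then have "b \<otimes> g = \<one> \<otimes> g" by (simp add: rels)
    then show False using b_ne right_cancel[of g b \<one>] by simp
  qed
  have "vx g \<noteq> vx \<one>" "vx g \<noteq> vx p" "vx (g \<otimes> a) \<noteq> vx \<one>" "vx (g \<otimes> a) \<noteq> vx p"
    using gL gpL L_closed(1)[of "g \<otimes> (p \<otimes> a)" "a \<otimes> a"] by (auto simp: vx_eq rels)
  moreover have "vx (g \<otimes> a) \<noteq> vx g" using gag by (simp add: vx_eq rels bL)
  \<comment> \<open>Left multiplication by \<open>p\<close> exchanges the halves:
    \<open>g \<otimes> a\<close> lies outside \<open>K\<close> and \<open>p \<otimes> g\<close>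
    inside.\<close>
  moreover have "vx (g \<otimes> a) \<noteq> vx (p \<otimes> g)"
  proof
    assume "vx (g \<otimes> a) = vx (p \<otimes> g)"
    then have "g \<otimes> a \<in> K \<longleftrightarrow> p \<otimes> g \<in> K" by (intro vx_parity) simp_all
    then show False using K_mult[of g a] K_mult[of p g] aK g_K p_K by simp
  qed
  ultimately have "vx g \<notin> O' \<one>" "vx (g \<otimes> a) \<notin> O' \<one>" "vx (g \<otimes> a) \<notin> O' g"
    unfolding O'_def by simp_all
  moreover have "vx g \<in> O' g" "vx (g \<otimes> a) \<in> O' (g \<otimes> a)" by (simp_all add: O'_def)
  ultimately have "O' \<one> \<noteq> O' g" "O' \<one> \<noteq> O' (g \<otimes> a)" "O' g \<noteq> O' (g \<otimes> a)" by metis+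
  then have "card {O' \<one>, O' g, O' (g \<otimes> a)} = 3" by simp
  then show False using card_mono[OF fin(1) sub] fin(2) by simp
qed

text \<open>If \<open>(e, y)\<close> fixes \<open>L x\<close>, then
  \<open>e x y x\<^sup>-\<^sup>1\<close> lies in \<open>L\<close>, hence in \<open>K\<close>, and
  parity gives \<open>e \<otimes> y \<in> K\<close>. Conversely, all conjugates of \<open>a\<close>
  fix vertices, so minimality brings in the whole of \<open>K\<close>, and \<open>act p p\<close>,
  which fixes \<open>L\<close>, supplies the pairs with first component \<open>p\<close>.\<close>

lemma plus_subgroup_eq: "plus_subgroup V (graph_aut \<Gamma>) = rep V ` even_pairs"
proof
  interpret A: group "Aut \<Gamma>" by (rule group_Aut)
  interpret S: group "sym_group V" by (rule group_sym_group)
  let ?st = "\<Union>v\<in>V. stabilizer (Aut \<Gamma>) (\<lambda>h. h) v"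
  have EA: "even_pairs \<subseteq> all_pairs" by (auto simp: even_pairs_def all_pairs_def)
  have subE: "subgroup (rep V ` even_pairs) (Aut \<Gamma>)"
  proof (rule S.subgroup_incl)
    show "subgroup (rep V ` even_pairs) (sym_group V)" by (rule rep_subgroup(1)[OF pair_group_even]) simp
    show "subgroup (graph_aut \<Gamma>) (sym_group V)"
      unfolding graph_aut_eq by (rule rep_subgroup(1)[OF pair_group_all])
    show "rep V ` even_pairs \<subseteq> graph_aut \<Gamma>" unfolding graph_aut_eq using EA by blast
  qed
  have st: "rep V (e, y) \<in> ?st \<longleftrightarrow> (\<exists>x\<in>carrier G. e \<otimes> (x \<otimes> (y \<otimes> inv x)) \<in> L)"
    if ey: "e \<in> {\<one>, p}" "y \<in> carrier G" for e y
  proof -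
    have "rep V (e, y) \<in> ?st \<longleftrightarrow> (\<exists>x\<in>carrier G. rep V (e, y) (vx x) = vx x)"
      using ey by (auto simp: stabilizer_def graph_aut_eq all_pairs_mem V_eq)
    also have "\<dots> \<longleftrightarrow> (\<exists>x\<in>carrier G. e \<otimes> (x \<otimes> (y \<otimes> inv x)) \<in> L)"
      using ey ep[OF ey(1)] by (intro bex_cong refl) (simp add: rep_apply vx_eq m_assoc)
    finally show ?thesis .
  qed
  show "plus_subgroup V (graph_aut \<Gamma>) \<subseteq> rep V ` even_pairs"
    unfolding plus_subgroup_def
  proof (rule A.generate_subgroup_incl[OF _ subE], rule subsetI)
    fix h assume h: "h \<in> ?st"
    then have "h \<in> graph_aut \<Gamma>" by (auto simp: stabilizer_def)
    then obtain e y where ey: "h = rep V (e, y)" "e \<in> {\<one>, p}" "y \<in> carrier G"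
      by (auto simp: graph_aut_eq all_pairs_def)
    then obtain x where x: "x \<in> carrier G" "e \<otimes> (x \<otimes> (y \<otimes> inv x)) \<in> L" using h st by blast
    have ec: "e \<in> carrier G" using ep ey by blast
    have "e \<otimes> (x \<otimes> (y \<otimes> inv x)) \<in> K" using x(2) L_K by blast
    then have "e \<otimes> y \<in> K"
      using K_mult[OF ec, of "x \<otimes> (y \<otimes> inv x)"] K_mult[OF x(1), of "y \<otimes> inv x"] K_mult[OF ey(3), of "inv x"]
        K_inv[OF x(1)] K_mult[OF ec ey(3)] x(1) ey(3) by auto
    then show "h \<in> rep V ` even_pairs" using ey by (auto simp: even_pairs_def)
  qed
  define Q where "Q = plus_subgroup V (graph_aut \<Gamma>)"
  have stQ: "?st \<subseteq> Q" unfolding Q_def plus_subgroup_def by (blast intro: generate.incl)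
  have Qsub: "subgroup Q (Aut \<Gamma>)"
    unfolding Q_def plus_subgroup_def by (rule A.generate_is_subgroup) (auto simp: stabilizer_def)
  have Qm: "rep V (e \<otimes> f, y \<otimes> z) \<in> Q" if "rep V (e, y) \<in> Q" "rep V (f, z) \<in> Q" "e \<in> {\<one>, p}" "f \<in> {\<one>, p}"
    "y \<in> carrier G" "z \<in> carrier G" for e f y z
    using subgroup.m_closed[OF Qsub that(1,2)] that(3-6) by (simp add: rep_mult[OF pair_group_all] all_pairs_mem)
  have Qi: "rep V (e, inv y) \<in> Q" if "rep V (e, y) \<in> Q" "e \<in> {\<one>, p}" "y \<in> carrier G" for e y
    using subgroup.m_inv_closed[OF Qsub that(1)] that(2,3) rep_subgroup(2)[OF pair_group_all, of e y]
    by (simp add: graph_aut_eq all_pairs_mem)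
  \<comment> \<open>Quantifying over all conjugates makes \<open>M\<close> normal without knowing that \<open>Q\<close> is.\<close>
  define M where "M = {y \<in> K. \<forall>x\<in>carrier G. rep V (\<one>, x \<otimes> y \<otimes> inv x) \<in> Q}"
  have MK: "M \<subseteq> K" by (auto simp: M_def)
  have Mn: "x \<otimes> m \<otimes> inv x \<in> M" if "x \<in> carrier G" "m \<in> M" for x m
  proof -
    have mc: "m \<in> carrier G" using that MK K_carrier by blast
    have "z \<otimes> (x \<otimes> m \<otimes> inv x) \<otimes> inv z = (z \<otimes> x) \<otimes> m \<otimes> inv (z \<otimes> x)" if "z \<in> carrier G" for z
      using that \<open>x \<in> carrier G\<close> mc by (simp add: m_assoc inv_mult_group)
    moreover have "x \<otimes> m \<otimes> inv x \<in> K"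
      using that mc MK K_mult[of "x \<otimes> m" "inv x"] K_mult[of x m] K_inv[of x] by auto
    ultimately show ?thesis using that by (auto simp: M_def)
  qed
  have "M = K"
  proof (rule minimal_normal)
    show "subgroup M G"
    proof (rule subgroupI)
      show "M \<subseteq> carrier G" using MK K_carrier by blast
      have "rep V (\<one>, \<one>) \<in> Q" using subgroup.one_closed[OF Qsub] by (simp add: rep_one)
      then have "\<one> \<in> M" by (simp add: M_def)
      then show "M \<noteq> {}" by blast
    next
      fix m assume m: "m \<in> M"
      then have mc: "m \<in> carrier G" using MK K_carrier by blast
      have "x \<otimes> inv m \<otimes> inv x = inv (x \<otimes> m \<otimes> inv x)" if "x \<in> carrier G" for x
        using that mc by (simp add: m_assoc inv_mult_group)
      then show "inv m \<in> M" using m mc by (auto simp: M_def K_inv intro!: Qi)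
    next
      fix m n assume m: "m \<in> M" and n: "n \<in> M"
      then have c: "m \<in> carrier G" "n \<in> carrier G" using MK K_carrier by blast+
      have "rep V (\<one>, x \<otimes> (m \<otimes> n) \<otimes> inv x) \<in> Q" if x: "x \<in> carrier G" for x
      proof -
        have "inv x \<otimes> (x \<otimes> (n \<otimes> inv x)) = n \<otimes> inv x" using x c by (simp add: m_assoc[symmetric])
        then have "x \<otimes> (m \<otimes> n) \<otimes> inv x = (x \<otimes> m \<otimes> inv x) \<otimes> (x \<otimes> n \<otimes> inv x)"
          using x c by (simp add: m_assoc)
        moreover have "rep V (\<one>, x \<otimes> m \<otimes> inv x) \<in> Q" "rep V (\<one>, x \<otimes> n \<otimes> inv x) \<in> Q"
          using m n x by (auto simp: M_def)
        ultimately show ?thesis using Qm[of \<one> "x \<otimes> m \<otimes> inv x" \<one> "x \<otimes> n \<otimes> inv x"] x c by simp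
      qed
      then show "m \<otimes> n \<in> M" using m n c by (simp add: M_def K_mult)
    qed
    have "a \<in> M"
    proof -
      have "rep V (\<one>, x \<otimes> a \<otimes> inv x) \<in> Q" if x: "x \<in> carrier G" for x
      proof (rule subsetD[OF stQ], subst st)
        show "\<exists>z\<in>carrier G. \<one> \<otimes> (z \<otimes> (x \<otimes> a \<otimes> inv x \<otimes> inv z)) \<in> L"
        proof
          have "inv x \<otimes> (x \<otimes> a \<otimes> inv x \<otimes> inv (inv x)) = a"
            using x by (simp add: m_assoc) (simp add: m_assoc[symmetric])
          then show "\<one> \<otimes> (inv x \<otimes> (x \<otimes> a \<otimes> inv x \<otimes> inv (inv x))) \<in> L" by simp
        qed (use x in simp)
      qed (use x in auto)
      then show ?thesis using L_K by (auto simp: M_def)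
    qed
    then show "M \<noteq> {\<one>}" using a_ne by blast
    show "x \<otimes> m \<otimes> inv x \<in> M" if "x \<in> K" "m \<in> M" for x m using Mn that K_carrier by blast
    show "p \<otimes> m \<otimes> p \<in> M" if "m \<in> M" for m using Mn[OF p_carrier that] by (simp add: invs)
  qed (rule MK)
  then have KQ: "rep V (\<one>, y) \<in> Q" if "y \<in> K" for y
  proof -
    have "rep V (\<one>, \<one> \<otimes> y \<otimes> inv \<one>) \<in> Q"
    proof -
      have "y \<in> M" using that \<open>M = K\<close> by simp
      then show ?thesis unfolding M_def by blast
    qed
    then show ?thesis using K_carrier[OF that] by simp
  qed
  have pQ: "rep V (p, p) \<in> Q"
    by (rule subsetD[OF stQ], subst st) (auto intro!: bexI[of _ \<one>] simp: rels)
  show "rep V ` even_pairs \<subseteq> plus_subgroup V (graph_aut \<Gamma>)"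
  proof
    fix h assume "h \<in> rep V ` even_pairs"
    then obtain e y where ey: "h = rep V (e, y)" "e \<in> {\<one>, p}" "y \<in> carrier G" "e \<otimes> y \<in> K"
      by (auto simp: even_pairs_def)
    show "h \<in> plus_subgroup V (graph_aut \<Gamma>)"
    proof (cases "e = \<one>")
      case True
      then show ?thesis using KQ ey by (simp add: Q_def)
    next
      case False
      then have e: "e = p" using ey(2) by simp
      \<comment> \<open>The pair \<open>(p, y)\<close> is split as \<open>(p, p)\<close> times
        \<open>(\<one>, p \<otimes> y)\<close>, whose second factor comes from
        \<open>K\<close>.\<close>
      have "rep V (p \<otimes> \<one>, p \<otimes> (p \<otimes> y)) \<in> Q" using Qm[OF pQ KQ[of "p \<otimes> y"]] ey(3,4) e by simp
      then show ?thesis using ey by (simp add: Q_def e rels)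
    qed
  qed
qed

text \<open>Membership in \<open>\<Delta>\<close> and membership of representatives in
  \<open>K\<close> both alternate along arcs, so by connectedness they agree everywhere up to the
  value \<open>c\<close> at \<open>L\<close>.\<close>

lemma bipartite_half_cases:
  assumes "bipartite_half \<Gamma> \<Delta>" shows "\<exists>c. \<Delta> = half c"
proof -
  have D: "\<Delta> \<subseteq> V" "\<And>v w. (v, w) \<in> parcs \<Gamma> \<Longrightarrow> v \<in> \<Delta> \<longleftrightarrow> w \<notin> \<Delta>"
    using assms unfolding bipartite_half_def by blast+
  define c where "c \<longleftrightarrow> vx \<one> \<in> \<Delta>"
  define W where "W = {vx x | x. x \<in> carrier G \<and> (vx x \<in> \<Delta> \<longleftrightarrow> (x \<in> K) = c)}"
  have VW: "V \<subseteq> W"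
  proof (rule closed_V)
    show "vx \<one> \<in> W" unfolding W_def c_def using K_one by blast
    fix v w assume "v \<in> W" and vw: "(v, w) \<in> parcs \<Gamma>"
    then obtain x where x: "v = vx x" "x \<in> carrier G" "vx x \<in> \<Delta> \<longleftrightarrow> (x \<in> K) = c" unfolding W_def by blast
    then obtain l where l: "l \<in> L" "w = vx (g \<otimes> (l \<otimes> x))" using vw arcs_iff by blast
    have lc: "l \<in> carrier G" "l \<in> K" using l L_carrier L_K by auto
    have "g \<otimes> (l \<otimes> x) \<in> K \<longleftrightarrow> x \<notin> K" using lc x(2) g_K by (simp add: K_mult)
    then have "vx (g \<otimes> (l \<otimes> x)) \<in> \<Delta> \<longleftrightarrow> (g \<otimes> (l \<otimes> x) \<in> K) = c"
      using D(2)[OF vw, unfolded x(1) l(2)] x(3) by argo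
    moreover have "g \<otimes> (l \<otimes> x) \<in> carrier G" using lc x(2) by simp
    ultimately show "w \<in> W" unfolding W_def l(2)
      by (intro CollectI exI[of _ "g \<otimes> (l \<otimes> x)"] conjI refl)
  qed
  have "\<Delta> = half c"
  proof
    show "\<Delta> \<subseteq> half c" using D(1) VW unfolding W_def half_def by blast
    show "half c \<subseteq> \<Delta>"
    proof
      fix v assume "v \<in> half c"
      then obtain x where x: "v = vx x" "x \<in> carrier G" "(x \<in> K) = c" unfolding half_def by blast
      then have "vx x \<in> W" using VW by auto
      then obtain z where "vx x = vx z" "z \<in> carrier G" "vx z \<in> \<Delta> \<longleftrightarrow> (z \<in> K) = c" unfolding W_def by blast
      then show "v \<in> \<Delta>" using vx_parity[of x z] x by auto
    qed
  qed
  then show ?thesis by blast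
qed

text \<open>Let \<open>M\<close> be the part of \<open>N\<close> coming from \<open>K\<close>. If it
  were trivial, \<open>N\<close> would contain some \<open>(p, y)\<close> with \<open>y\<close>
  outside \<open>K\<close>; its commutators with \<open>K\<close> fall into \<open>M\<close>, so
  \<open>y\<close> would centralise \<open>K\<close>, against \<open>faithful_K\<close>. Hence
  \<open>M = K\<close> by minimality, and \<open>K\<close> alone is transitive on each half.\<close>

lemma quasiprimitive_half:
  "quasiprimitive (half c) (induced_on (half c) (plus_subgroup V (graph_aut \<Gamma>)))"
proof -
  define S where "S = half c"
  have SV: "S \<subseteq> V" by (auto simp: S_def half_def)
  have X: "pair_group even_pairs S" by (rule pair_group_even[of S c]) (simp add: S_def)
  have I: "induced_on S (plus_subgroup V (graph_aut \<Gamma>)) = rep S ` even_pairs"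
    unfolding induced_on_def plus_subgroup_eq image_image
    by (intro image_cong refl) (simp add: rep_def restrict_restrict Int_absorb1[OF SV])
  let ?I = "rep S ` even_pairs"
  interpret B: group "perm_group S ?I"
    by (rule group.subgroup_imp_group[OF group_sym_group rep_subgroup(1)[OF X]])
  have p1: "p \<noteq> \<one>" using p_K by auto
  have KE: "(\<one>, y) \<in> even_pairs" if "y \<in> K" for y using that K_carrier by (auto simp: even_pairs_def)
  have trans: "transitive_on S H" if H: "\<And>y. y \<in> K \<Longrightarrow> rep S (\<one>, y) \<in> H" for H
    unfolding transitive_on_def
  proof (intro ballI)
    fix v w assume "v \<in> S" "w \<in> S"
    then obtain x z where x: "v = vx x" "x \<in> carrier G" "w = vx z" "z \<in> carrier G" "(x \<in> K) = c" "(z \<in> K) = c"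
      unfolding S_def half_def by blast
    have "inv x \<otimes> z \<in> K" using x by (simp add: K_mult K_inv)
    moreover have "rep S (\<one>, inv x \<otimes> z) v = w"
      using rep_apply[OF SV, of x \<one> "inv x \<otimes> z"] x \<open>v \<in> S\<close> by (simp add: m_assoc[symmetric])
    ultimately show "\<exists>h\<in>H. h v = w" using H by blast
  qed
  show ?thesis
    unfolding S_def[symmetric] I quasiprimitive_def transitive_perm_group_def
  proof (intro conjI allI impI)
    show "subgroup ?I (sym_group S)" by (rule rep_subgroup(1)[OF X])
    show "transitive_on S ?I" using KE by (intro trans) blast
    fix N assume N: "N \<lhd> perm_group S ?I \<and> N \<noteq> {\<one>\<^bsub>sym_group S\<^esub>}"
    then interpret N: normal N "perm_group S ?I" by blast
    have Nm: "rep S (e \<otimes> f, y \<otimes> z) \<in> N" if "rep S (e, y) \<in> N" "rep S (f, z) \<in> N"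
      "(e, y) \<in> even_pairs" "(f, z) \<in> even_pairs" for e f y z
      using N.m_closed[OF that(1,2)] by (simp add: rep_mult[OF X that(3,4)])
    have Ni: "rep S (e, inv y) \<in> N" if "rep S (e, y) \<in> N" "(e, y) \<in> even_pairs" for e y
      using N.m_inv_closed[OF that(1)] by (simp add: rep_subgroup(2)[OF X that(2)])
    have Nc: "rep S (e \<otimes> f \<otimes> e, y \<otimes> z \<otimes> inv y) \<in> N" if fz: "rep S (f, z) \<in> N" "(f, z) \<in> even_pairs"
      and ey: "(e, y) \<in> even_pairs" for e f y z
    proof -
      have m: "(e \<otimes> f, y \<otimes> z) \<in> even_pairs" "(e, inv y) \<in> even_pairs"
        using X ey fz(2) unfolding pair_group_def by blast+
      have "rep S (e, y) \<otimes>\<^bsub>perm_group S ?I\<^esub> rep S (f, z) \<otimes>\<^bsub>perm_group S ?I\<^esub>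
          inv\<^bsub>perm_group S ?I\<^esub> rep S (e, y) \<in> N"
        by (rule N.inv_op_closed2[OF _ fz(1)]) (use ey in simp)
      then show ?thesis
        by (simp add: rep_subgroup(2)[OF X ey] rep_mult[OF X ey fz(2)] rep_mult[OF X m])
    qed
    define M where "M = {y \<in> K. rep S (\<one>, y) \<in> N}"
    have MK: "M \<subseteq> K" by (auto simp: M_def)
    have M_sub: "subgroup M G"
    proof (rule subgroupI)
      show "M \<subseteq> carrier G" using MK K_carrier by blast
      show "M \<noteq> {}" using N.one_closed rep_one[of S] by (auto simp: M_def intro!: exI[of _ \<one>])
      show "inv m \<in> M" if "m \<in> M" for m
        using that Ni[of \<one> m] KE[of m] K_carrier[of m] by (auto simp: M_def K_inv)
      show "m \<otimes> n \<in> M" if "m \<in> M" "n \<in> M" for m n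
        using that Nm[of \<one> m \<one> n] KE K_carrier by (auto simp: M_def K_mult)
    qed
    have M_K: "x \<otimes> m \<otimes> inv x \<in> M" if "x \<in> K" "m \<in> M" for x m
      using that Nc[of \<one> m \<one> x] KE K_carrier[of x] K_carrier[of m] by (auto simp: M_def K_mult K_inv)
    have M_p: "p \<otimes> m \<otimes> p \<in> M" if "m \<in> M" for m
    proof -
      have mc: "m \<in> carrier G" "m \<in> K" using that K_carrier by (auto simp: M_def)
      have "(p, p) \<in> even_pairs" by (simp add: even_pairs_def rels)
      then have "rep S (p \<otimes> \<one> \<otimes> p, p \<otimes> m \<otimes> inv p) \<in> N" using Nc[of \<one> m p p] that KE by (auto simp: M_def)
      moreover have "p \<otimes> \<one> \<otimes> p = \<one>" by (simp add: rels)
      moreover have "p \<otimes> m \<otimes> p \<in> K" using mc K_mult[of "p \<otimes> m" p] K_mult[of p m] p_K by auto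
      ultimately show ?thesis by (simp add: M_def invs)
    qed
    have "M \<noteq> {\<one>}"
    proof
      assume M1: "M = {\<one>}"
      have sub: "N \<subseteq> ?I" using N.subset by simp
      obtain n where n: "n \<in> N" "n \<noteq> rep S (\<one>, \<one>)"
        using N N.one_closed by (auto simp: rep_one)
      then obtain e y where ey: "n = rep S (e, y)" "(e, y) \<in> even_pairs" using sub by auto
      have e: "e \<in> {\<one>, p}" "y \<in> carrier G" "e \<otimes> y \<in> K" using ey(2) by (auto simp: even_pairs_def)
      show False
      proof (cases "e = \<one>")
        case True
        then have "y \<in> M" using n ey e by (simp add: M_def)
        then show False using M1 True n ey by simp
      next
        case False
        then have ep': "e = p" using e by simp
        have yK: "y \<notin> K" using ep_K[OF e(1,2)] e(3) False by simp
        have "y \<otimes> x = x \<otimes> y" if x: "x \<in> K" for x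
        proof -
          have xc: "x \<in> carrier G" by (rule K_carrier[OF x])
          have "rep S (\<one> \<otimes> p \<otimes> \<one>, x \<otimes> y \<otimes> inv x) \<in> N"
            using Nc[of p y \<one> x] n ey ep' KE[OF x] by simp
          then have 1: "rep S (p, x \<otimes> y \<otimes> inv x) \<in> N" by simp
          have "(p, x \<otimes> y \<otimes> inv x) \<in> even_pairs"
            using xc e(2) x yK p_K by (simp add: even_pairs_def K_mult K_inv)
          moreover have "rep S (p, inv y) \<in> N" "(p, inv y) \<in> even_pairs"
            using Ni[of p y] n ey ep' pair_groupD(3)[OF X] by auto
          ultimately have "rep S (p \<otimes> p, x \<otimes> y \<otimes> inv x \<otimes> inv y) \<in> N" using Nm[OF 1] by simp
          then have "x \<otimes> y \<otimes> inv x \<otimes> inv y \<in> M"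
            using xc e(2) x yK by (simp add: M_def pp K_mult K_inv)
          then have "x \<otimes> y \<otimes> inv x \<otimes> inv y = \<one>" using M1 by blast
          then have "x \<otimes> y \<otimes> inv x = \<one> \<otimes> y"
            using inv_solve_right'[of \<one> "x \<otimes> y \<otimes> inv x" y] xc e(2) by simp
          then show ?thesis
            using inv_solve_right'[of y "x \<otimes> y" x] xc e(2) by simp
        qed
        then show False using faithful_K[OF e(2) yK] by blast
      qed
    qed
    then have "M = K" using minimal_normal[OF M_sub MK _ M_K M_p] by blast
    then show "transitive_on S N" by (intro trans) (auto simp: M_def)
  qed
qed

theorem coset_graph_conclusion:
  "right_mult_action G L \<in> mon G (Aut \<Gamma>)
    \<and> subgroup (right_mult_action G L ` carrier G) (Aut \<Gamma>)
    \<and> card (rcosets\<^bsub>Aut \<Gamma>\<^esub> (right_mult_action G L ` carrier G)) = 2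
    \<and> arc_transitive \<Gamma> (graph_aut \<Gamma>) 3
    \<and> \<not> biquasiprimitive V (graph_aut \<Gamma>)
    \<and> (\<forall>\<Delta>. bipartite_half \<Gamma> \<Delta> \<longrightarrow>
          quasiprimitive \<Delta> (induced_on \<Delta> (plus_subgroup V (graph_aut \<Gamma>))))"
  using embedding_mon embedding_subgroup embedding_index arc_transitive_\<Gamma> not_biquasiprimitive
    bipartite_half_cases quasiprimitive_half by blast

end

section \<open>The simple groups \<open>PSL(2, 2\<^sup>f)\<close>\<close>

abbreviation T_mult_syntax (infixl \<open>\<otimes>\<^sub>T\<close> 70) where "x \<otimes>\<^sub>T y \<equiv> x \<otimes>\<^bsub>T_group\<^esub> y"

abbreviation G_mult_syntax (infixl \<open>\<otimes>\<^sub>G\<close> 70) where "x \<otimes>\<^sub>G y \<equiv> x \<otimes>\<^bsub>G_group\<^esub> y"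

lemma T_mult: "x \<otimes>\<^sub>T y = y \<circ> x"
  by (auto simp: T_group_def sym_group_def compose_def)

lemma T_one: "\<one>\<^bsub>T_group\<^esub> = id"
  by (auto simp: T_group_def sym_group_def)

lemma mobius_T: "p * s - q * r \<noteq> 0 \<Longrightarrow> mobius p q r s \<in> carrier T_group"
  by (auto simp: T_group_def)

lemma T_cases:
  assumes "x \<in> carrier T_group"
  obtains p q r s where "x = mobius p q r s" "p * s - q * r \<noteq> 0"
  using assms by (auto simp: T_group_def)

lemma mobius_scale:
  assumes "c \<noteq> 0" shows "mobius (c * p) (c * q) (c * r) (c * s) = mobius p q r s"
proof
  fix v
  have "c * r * x + c * s = c * (r * x + s)" "c * p * x + c * q = c * (p * x + q)" for x
    by (simp_all add: algebra_simps)
  then show "mobius (c * p) (c * q) (c * r) (c * s) v = mobius p q r s v"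
    using assms by (cases v) auto
qed

lemma mobius_one: "mobius 1 0 0 1 = id"
  by (rule mobius_scalar) simp

context
  assumes char2: "(1::'a::{field,finite}) + 1 = 0"
begin

lemma char2_add: "x + x = (0::'a)"
proof -
  have "x + x = x * (1 + 1)" by (simp only: distrib_left mult_1_right)
  then show ?thesis by (simp only: char2 mult_zero_right)
qed

lemma char2_minus: "- x = (x::'a)"
  using char2_add[of x] by (simp add: eq_neg_iff_add_eq_0[symmetric])

lemma char2_diff: "x - y = x + (y::'a)"
  using char2_minus[of y] by (metis add_uminus_conv_diff)

text \<open>In characteristic 2 the difference of two squares is the square of the difference, so
  squaring is injective, hence surjective on a finite field. \<open>T_simple\<close> uses such
  square roots to obtain all scalings.\<close>

lemma char2_square_surj: "\<exists>y. y * y = (x::'a)"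
proof -
  have "inj (\<lambda>y::'a. y * y)"
  proof (rule injI)
    fix y z :: 'a assume "y * y = z * z"
    then have "(y - z) * (y + z) = 0" by (simp add: algebra_simps)
    then show "y = z" by (auto simp: char2_diff[symmetric])
  qed
  then have "surj (\<lambda>y::'a. y * y)" by (rule finite_UNIV_inj_surj[OF finite])
  then show ?thesis by (metis surjD)
qed

lemma translation_involution: "mobius 1 t 0 1 \<circ> mobius 1 t 0 1 = (id :: 'a option \<Rightarrow> _)"
  by (subst mobius_comp) (simp_all add: char2_add mobius_one)

lemma inversion_involution: "mobius 0 1 1 0 \<circ> mobius 0 1 1 0 = (id :: 'a option \<Rightarrow> _)"
  by (subst mobius_comp) (simp_all add: mobius_one)

lemma scaling_inverse:
  assumes "c \<noteq> (0::'a)" shows "mobius (1 / c) 0 0 1 \<circ> mobius c 0 0 1 = id"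
  using assms by (subst mobius_comp) (simp_all add: mobius_one)

text \<open>A nontrivial normal subgroup contains an element sending \<open>\<infinity>\<close> to \<open>0\<close>; its commutator with the
  scaling by \<open>c\<close> is affine with multiplier \<open>1 / c\<^sup>2 \<noteq> 1\<close>, and commutators of the latter with
  translations give all translations.\<close>

lemma T_simple:
  fixes N :: "('a option \<Rightarrow> 'a option) set"
  assumes c: "c \<noteq> (0::'a)" "c \<noteq> 1"
    and sub: "N \<subseteq> carrier T_group"
    and comp: "\<And>x y. \<lbrakk>x \<in> N; y \<in> N\<rbrakk> \<Longrightarrow> x \<circ> y \<in> N"
    and inverse: "\<And>x y. \<lbrakk>x \<in> N; y \<in> carrier T_group; y \<circ> x = id\<rbrakk> \<Longrightarrow> y \<in> N"
    and conj: "\<And>x y n. \<lbrakk>n \<in> N; x \<in> carrier T_group; y \<in> carrier T_group; y \<circ> x = id\<rbrakk> \<Longrightarrow> y \<circ> n \<circ> x \<in> N"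
    and n: "n \<in> N" "n \<noteq> id"
  shows "N = carrier T_group"
proof -
  have UT: "mobius 1 t 0 1 \<in> carrier T_group" for t :: 'a by (rule mobius_T) simp
  have DT: "mobius e 0 0 1 \<in> carrier T_group" if "e \<noteq> 0" for e :: 'a by (rule mobius_T) (use that in simp)
  have WT: "mobius 0 1 1 0 \<in> (carrier T_group :: ('a option \<Rightarrow> _) set)" by (rule mobius_T) simp
  obtain v where v: "n v \<noteq> v" using n(2) by (metis ext id_apply)
  have "\<exists>n1\<in>N. n1 None \<noteq> None"
  proof (cases v)
    case None
    then show ?thesis using v n by blast
  next
    case (Some w)
    have d: "w * 0 - 1 * 1 \<noteq> (0::'a)" by simp
    \<comment> \<open>\<open>mobius w 1 1 0\<close> sends \<open>None\<close> to
      \<open>Some w\<close>, a point moved by \<open>n\<close>, so conjugation by it yields an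
      element that moves \<open>None\<close>.\<close>
    have i: "mobius 0 (-1) (-1) w \<circ> mobius w 1 1 0 = id" by (rule mobius_inverse(1)[OF d])
    have i2: "mobius w 1 1 0 \<circ> mobius 0 (-1) (-1) w = id" by (rule mobius_inverse(2)[OF d])
    have m: "mobius 0 (-1) (-1) w \<circ> n \<circ> mobius w 1 1 0 \<in> N"
      by (rule conj[OF n(1) _ _ i]) (auto intro!: mobius_T)
    have "mobius 0 (-1) (-1) w (n (Some w)) \<noteq> None"
    proof
      assume h: "mobius 0 (-1) (-1) w (n (Some w)) = None"
      have "n (Some w) = (mobius w 1 1 0 \<circ> mobius 0 (-1) (-1) w) (n (Some w))" using i2 by simp
      also have "\<dots> = mobius w 1 1 0 None" using h by (metis comp_apply)
      finally show False using v Some by simp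
    qed
    then have "(mobius 0 (-1) (-1) w \<circ> n \<circ> mobius w 1 1 0) None \<noteq> None" by simp
    with m show ?thesis by blast
  qed
  then obtain n1 where n1: "n1 \<in> N" "n1 None \<noteq> None" by blast
  then obtain t where t: "n1 None = Some t" by blast
  \<comment> \<open>In characteristic 2 the translation by \<open>t\<close> is its own inverse; it
    fixes \<open>None\<close> and takes \<open>Some t\<close> to \<open>Some 0\<close>.\<close>
  define n2 where "n2 = mobius 1 t 0 1 \<circ> n1 \<circ> mobius 1 t 0 1"
  have n2N: "n2 \<in> N" unfolding n2_def by (rule conj[OF n1(1) UT UT translation_involution])
  have n2_None: "n2 None = Some 0" by (simp add: n2_def t char2_add)
  obtain p q r s where n2: "n2 = mobius p q r s" "p * s - q * r \<noteq> 0"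
    using n2N sub by (blast elim: T_cases)
  have r: "r \<noteq> 0" and p: "p = 0" using n2_None by (auto simp: n2(1) split: if_splits)
  have q: "q \<noteq> 0" using n2(2) p by auto
  have d2: "0 * s - q * r \<noteq> 0" using q r by simp
  have n2': "n2 = mobius 0 q r s" using n2(1) p by simp
  have i2: "mobius s (-q) (-r) 0 \<circ> n2 = id" unfolding n2' by (rule mobius_inverse(1)[OF d2])
  have i2N: "mobius s (-q) (-r) 0 \<in> N"
    by (rule inverse[OF n2N _ i2], rule mobius_T) (use q r in simp)
  have Di: "mobius (1 / c) 0 0 1 \<circ> mobius c 0 0 1 = id" by (rule scaling_inverse[OF c(1)])
  define e where "e = 1 / (c * c)"
  have e1: "e \<noteq> 1"
  proof
    assume "e = 1"
    then have "c * c = 1" using c by (simp add: e_def field_simps)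
    then have "(c - 1) * (c + 1) = 0" by (simp add: algebra_simps)
    then show False using c(2) char2_diff[of c 1] by auto
  qed
  have e0: "e \<noteq> 0" using c by (simp add: e_def)
  define m where "m = mobius (1 / c) 0 0 1 \<circ> mobius s (-q) (-r) 0 \<circ> mobius c 0 0 1 \<circ> n2"
  have mN: "m \<in> N" unfolding m_def by (rule comp[OF conj[OF i2N DT DT Di] n2N]) (use c in auto)
  obtain k where k: "m = mobius e k 0 1"
  proof -
    define d where "d = - r * c * q"
    have "mobius c 0 0 1 \<circ> n2 = mobius 0 (c * q) r s"
      unfolding n2' by (subst mobius_comp) (use c q r in auto)
    then have "mobius s (-q) (-r) 0 \<circ> (mobius c 0 0 1 \<circ> n2) = mobius (- q * r) (s * c * q - q * s) 0 (- r * c * q)"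
      by (simp, subst mobius_comp) (use c q r in \<open>auto simp: algebra_simps\<close>)
    then have "m = mobius (1 / c) 0 0 1 \<circ> mobius (- q * r) (s * c * q - q * s) 0 (- r * c * q)"
      by (simp add: m_def comp_assoc)
    also have "\<dots> = mobius (- q * r / c) ((s * c * q - q * s) / c) 0 (- r * c * q)"
      by (subst mobius_comp) (use c q r in auto)
    also have "\<dots> = mobius (d * ((- q * r / c) / d)) (d * (((s * c * q - q * s) / c) / d)) (d * 0) (d * 1)"
      using c q r by (simp add: d_def mult.commute)
    also have "\<dots> = mobius ((- q * r / c) / d) (((s * c * q - q * s) / c) / d) 0 1"
      by (rule mobius_scale) (use c q r in \<open>simp add: d_def\<close>)
    also have "(- q * r / c) / d = e" using c q r by (simp add: e_def d_def field_simps)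
    finally show ?thesis by (rule that)
  qed
  have UN': "mobius 1 (e * t + t) 0 1 \<in> N" for t
  proof -
    have dm: "e * 1 - k * 0 \<noteq> 0" using e0 by simp
    have im: "mobius 1 (- k) (- 0) e \<circ> m = id" unfolding k by (rule mobius_inverse(1)[OF dm])
    have imN: "mobius 1 (- k) (- 0) e \<in> N" by (rule inverse[OF mN _ im], rule mobius_T) (use e0 in simp)
    \<comment> \<open>The commutator of \<open>m\<close> with a translation, bracketed as
      \<open>m\<close> times a conjugate of its inverse, which makes membership in \<open>N\<close>
      visible. The translation parts \<open>k\<close> cancel.\<close>
    have "m \<circ> (mobius 1 t 0 1 \<circ> mobius 1 (- k) (- 0) e \<circ> mobius 1 t 0 1) \<in> N"
      by (rule comp[OF mN conj[OF imN UT UT translation_involution]])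
    moreover have "mobius 1 (- k) (- 0) e \<circ> mobius 1 t 0 1 = mobius 1 (t - k) 0 e"
      by (subst mobius_comp) (use e0 in auto)
    then have "mobius 1 t 0 1 \<circ> mobius 1 (- k) (- 0) e \<circ> mobius 1 t 0 1 = mobius 1 (t - k + t * e) 0 e"
      unfolding comp_assoc by (simp, subst mobius_comp) (use e0 in auto)
    then have "m \<circ> (mobius 1 t 0 1 \<circ> mobius 1 (- k) (- 0) e \<circ> mobius 1 t 0 1) =
        mobius e (e * (t - k + t * e) + k * e) 0 e"
      unfolding k by (simp, subst mobius_comp) (use e0 in auto)
    moreover have "\<dots> = mobius (e * 1) (e * (e * t + t)) (e * 0) (e * 1)"
      by (simp add: algebra_simps)
    moreover have "\<dots> = mobius 1 (e * t + t) 0 1" by (rule mobius_scale[OF e0])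
    ultimately show ?thesis by simp
  qed
  have UN: "mobius 1 t 0 1 \<in> N" for t
  proof -
    have "e + 1 \<noteq> 0" using e1 char2_diff[of e 1] by (metis eq_iff_diff_eq_0)
    moreover have "e * (t / (e + 1)) + t / (e + 1) = (e + 1) * (t / (e + 1))"
      by (simp only: distrib_right mult_1_left)
    ultimately have "e * (t / (e + 1)) + t / (e + 1) = t" by simp
    then show ?thesis using UN'[of "t / (e + 1)"] by simp
  qed
  have VN: "mobius 1 0 t 1 \<in> N" for t
  proof -
    have "mobius 0 1 1 0 \<circ> mobius 1 t 0 1 \<circ> mobius 0 1 1 0 \<in> N"
      by (rule conj[OF UN WT WT inversion_involution])
    also have "mobius 1 t 0 1 \<circ> mobius 0 1 1 0 = mobius t 1 1 0" by (subst mobius_comp) auto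
    then have "mobius 0 1 1 0 \<circ> mobius 1 t 0 1 \<circ> mobius 0 1 1 0 = mobius 1 0 t 1"
      unfolding comp_assoc by (simp, subst mobius_comp) auto
    finally show ?thesis .
  qed
  have WN: "mobius 0 1 1 0 \<in> N"
  proof -
    have two: "(2::'a) = 0" using char2 by simp
    have "mobius 1 1 0 1 \<circ> (mobius 1 0 1 1 \<circ> mobius 1 1 0 1) \<in> N" by (intro comp UN VN)
    also have "mobius 1 0 1 1 \<circ> mobius 1 1 0 1 = mobius 1 1 1 (0::'a)"
      by (subst mobius_comp) (auto simp: two)
    also have "mobius 1 1 0 1 \<circ> mobius 1 1 1 (0::'a) = mobius 0 1 1 0"
      by (subst mobius_comp) (auto simp: two)
    finally show ?thesis .
  qed
  have DN: "mobius x 0 0 1 \<in> N" if x: "x \<noteq> 0" for x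
  proof -
    \<comment> \<open>The inversion times its conjugate by a scaling is the diagonal matrix with
      entries \<open>1 / y\<close> and \<open>y\<close>, which acts as multiplication by
      \<open>1 / (y * y)\<close>.\<close>
    obtain y where y: "y * y = 1 / x" using char2_square_surj by blast
    then have y0: "y \<noteq> 0" using x by auto
    have "mobius (1 / y) 0 0 1 \<circ> mobius 0 1 1 0 \<circ> mobius y 0 0 1 \<circ> mobius 0 1 1 0 \<in> N"
      by (rule comp[OF conj[OF WN DT DT scaling_inverse] WN]) (use y0 in auto)
    also have "mobius (1 / y) 0 0 1 \<circ> mobius 0 1 1 0 \<circ> mobius y 0 0 1 \<circ> mobius 0 1 1 0 =
        mobius (1 / y) 0 0 1 \<circ> (mobius 0 1 1 0 \<circ> (mobius y 0 0 1 \<circ> mobius 0 1 1 0))"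
      by (simp add: comp_assoc)
    also have "mobius y 0 0 1 \<circ> mobius 0 1 1 0 = mobius 0 y 1 0" by (subst mobius_comp) (use y0 in auto)
    also have "mobius 0 1 1 0 \<circ> mobius 0 y 1 0 = mobius 1 0 0 y" by (subst mobius_comp) (use y0 in auto)
    also have "mobius (1 / y) 0 0 1 \<circ> mobius 1 0 0 y = mobius (1 / y) 0 0 y"
      by (subst mobius_comp) (use y0 in auto)
    also have "\<dots> = mobius (y * (1 / (y * y))) (y * 0) (y * 0) (y * 1)" using y0 by simp
    also have "\<dots> = mobius (1 / (y * y)) 0 0 1" by (rule mobius_scale[OF y0])
    also have "1 / (y * y) = x" using y x by simp
    finally show ?thesis .
  qed
  have AN: "mobius x y 0 1 \<in> N" if "x \<noteq> 0" for x y
  proof -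
    have "mobius 1 y 0 1 \<circ> mobius x 0 0 1 \<in> N" by (rule comp[OF UN DN[OF that]])
    also have "mobius 1 y 0 1 \<circ> mobius x 0 0 1 = mobius x y 0 1" by (subst mobius_comp) (use that in auto)
    finally show ?thesis .
  qed
  have "x \<in> N" if x: "x \<in> carrier T_group" for x
  proof -
    obtain p q r s where x: "x = mobius p q r s" "p * s - q * r \<noteq> 0" using x by (rule T_cases)
    show ?thesis
    proof (cases "r = 0")
      case True
      then have s: "s \<noteq> 0" "p \<noteq> 0" using x by auto
      then have "x = mobius (s * (p / s)) (s * (q / s)) (s * 0) (s * 1)" using x True by simp
      also have "\<dots> = mobius (p / s) (q / s) 0 1" by (rule mobius_scale[OF s(1)])
      finally show ?thesis using AN s by simp
    next
      case False
      \<comment> \<open>Bruhat decomposition: translation, inversion, affine map. Up to sign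
        \<open>d\<close> is the determinant divided by \<open>r\<close>, and scaling the product
        matrix by it restores the entries \<open>p, q, r, s\<close>.\<close>
      define d where "d = q - p * s / r"
      have d: "d \<noteq> 0"
      proof
        assume "d = 0"
        then have "q * r = p * s" using False by (simp add: d_def field_simps)
        then show False using x by simp
      qed
      have "mobius 1 (p / r) 0 1 \<circ> (mobius 0 1 1 0 \<circ> mobius (r / d) (s / d) 0 1) \<in> N"
        by (intro comp UN WN AN) (use False d in simp)
      also have "mobius 0 1 1 0 \<circ> mobius (r / d) (s / d) 0 1 = mobius 0 1 (r / d) (s / d)"
        by (subst mobius_comp) (use False d in auto)
      also have "mobius 1 (p / r) 0 1 \<circ> \<dots> = mobius (p / d) (1 + p / r * (s / d)) (r / d) (s / d)"
        by (subst mobius_comp) (use False d in auto)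
      also have "\<dots> = mobius (d * (p / d)) (d * (1 + p / r * (s / d))) (d * (r / d)) (d * (s / d))"
        by (rule mobius_scale[OF d, symmetric])
      also have "d * (1 + p / r * (s / d)) = q" using d False by (simp add: distrib_left) (simp add: d_def)
      finally show ?thesis using x d by simp
    qed
  qed
  then show ?thesis using sub by blast
qed

end

lemma (in group) conj_commute: "\<lbrakk>x \<in> carrier G; m \<in> carrier G; x \<otimes> m = m \<otimes> x\<rbrakk> \<Longrightarrow> x \<otimes> m \<otimes> inv x = m"
  by (simp add: m_assoc)

section \<open>Relations in \<open>T\<close> and the normal structure of \<open>G\<close>\<close>

lemma a_T: "a_elt \<in> carrier T_group" and b_T: "b_elt \<in> carrier T_group" and u_T: "u_elt t \<in> carrier T_group"
  unfolding a_elt_def b_elt_def u_elt_def by (rule mobius_T; simp)+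

lemma T_relations:
  assumes char2: "(1::'a::{field,finite}) + 1 = 0"
  defines "a \<equiv> a_elt :: 'a option \<Rightarrow> _" and "b \<equiv> b_elt"
  shows "a \<otimes>\<^sub>T (a \<otimes>\<^sub>T a) = \<one>\<^bsub>T_group\<^esub>" "b \<otimes>\<^sub>T b = \<one>\<^bsub>T_group\<^esub>"
    "a \<otimes>\<^sub>T b = b \<otimes>\<^sub>T (a \<otimes>\<^sub>T a)" "a \<noteq> \<one>\<^bsub>T_group\<^esub>" "b \<noteq> \<one>\<^bsub>T_group\<^esub>"
    "u_elt t \<otimes>\<^sub>T u_elt t = (\<one>\<^bsub>T_group\<^esub> :: 'a option \<Rightarrow> _)"
    "u_elt t \<otimes>\<^sub>T b = b \<otimes>\<^sub>T u_elt t"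
proof -
  have two: "(2::'a) = 0" using char2 by simp
  have aa: "a \<circ> a = mobius 0 1 1 1"
    unfolding a_def a_elt_def by (subst mobius_comp) (simp_all add: two)
  have "a \<circ> a \<circ> a = mobius 1 0 0 1"
    unfolding aa unfolding a_def a_elt_def by (subst mobius_comp) (simp_all add: two)
  then show "a \<otimes>\<^sub>T (a \<otimes>\<^sub>T a) = \<one>\<^bsub>T_group\<^esub>" by (simp add: T_mult T_one mobius_one)
  show "b \<otimes>\<^sub>T b = \<one>\<^bsub>T_group\<^esub>" "u_elt t \<otimes>\<^sub>T u_elt t = (\<one>\<^bsub>T_group\<^esub> :: 'a option \<Rightarrow> _)"
    by (simp_all add: T_mult T_one b_def b_elt_def u_elt_def translation_involution[OF char2])
  have "b \<circ> a = mobius 0 1 1 0"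
    unfolding a_def a_elt_def b_def b_elt_def by (subst mobius_comp) (simp_all add: two)
  moreover have "a \<circ> a \<circ> b = mobius 0 1 1 0"
    unfolding aa unfolding b_def b_elt_def by (subst mobius_comp) (simp_all add: two)
  ultimately show "a \<otimes>\<^sub>T b = b \<otimes>\<^sub>T (a \<otimes>\<^sub>T a)" by (simp add: T_mult)
  have "a None \<noteq> id None" "b (Some 0) \<noteq> id (Some 0)"
    by (simp_all add: a_def a_elt_def b_def b_elt_def)
  then show "a \<noteq> \<one>\<^bsub>T_group\<^esub>" "b \<noteq> \<one>\<^bsub>T_group\<^esub>" unfolding T_one by auto
  have "b \<circ> u_elt t = mobius 1 (t + 1) 0 1" "u_elt t \<circ> b = mobius 1 (1 + t) 0 1"
    unfolding b_def b_elt_def u_elt_def by (subst mobius_comp; simp)+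
  then show "u_elt t \<otimes>\<^sub>T b = b \<otimes>\<^sub>T u_elt t" by (simp add: T_mult add.commute)
qed

lemma (in group) generate_S3:
  assumes "a \<in> carrier G" "b \<in> carrier G" "a \<otimes> (a \<otimes> a) = \<one>" "b \<otimes> b = \<one>" "a \<otimes> b = b \<otimes> (a \<otimes> a)"
  shows "generate G {a, b} = {\<one>, a, a \<otimes> a, b, b \<otimes> a, b \<otimes> (a \<otimes> a)}" (is "_ = ?S")
proof
  have r: "a \<otimes> (a \<otimes> (a \<otimes> x)) = x" "b \<otimes> (b \<otimes> x) = x" "a \<otimes> (b \<otimes> x) = b \<otimes> (a \<otimes> (a \<otimes> x))"
    if "x \<in> carrier G" for x
  proof -
    have "a \<otimes> (a \<otimes> (a \<otimes> x)) = (a \<otimes> (a \<otimes> a)) \<otimes> x" "b \<otimes> (b \<otimes> x) = (b \<otimes> b) \<otimes> x"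
      "a \<otimes> (b \<otimes> x) = (a \<otimes> b) \<otimes> x" "b \<otimes> (a \<otimes> (a \<otimes> x)) = (b \<otimes> (a \<otimes> a)) \<otimes> x"
      using assms(1,2) that by (simp_all add: m_assoc del: assms)
    then show "a \<otimes> (a \<otimes> (a \<otimes> x)) = x" "b \<otimes> (b \<otimes> x) = x" "a \<otimes> (b \<otimes> x) = b \<otimes> (a \<otimes> (a \<otimes> x))"
      using assms that by simp_all
  qed
  have i: "inv a = a \<otimes> a" "inv b = b"
    by (rule inv_equality; simp add: assms m_assoc)+
  note rr = assms r i m_assoc inv_mult_group
  have "subgroup ?S G"
  proof (rule subgroupI)
    show "?S \<subseteq> carrier G" using assms by auto
    show "inv x \<in> ?S" if "x \<in> ?S" for x using that by (elim insertE) (simp_all add: rr)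
    show "x \<otimes> y \<in> ?S" if "x \<in> ?S" "y \<in> ?S" for x y using that by (elim insertE) (simp_all add: rr)
  qed simp
  then show "generate G {a, b} \<subseteq> ?S" by (rule generate_subgroup_incl[rotated]) simp
  have "a \<in> generate G {a, b}" "b \<in> generate G {a, b}" "\<one> \<in> generate G {a, b}"
    by (auto intro: generate.incl generate.one)
  then show "?S \<subseteq> generate G {a, b}" by (auto intro: generate.eng)
qed

lemma G_mult: "((x, y), e) \<otimes>\<^sub>G ((x', y'), d) =
    ((x \<otimes>\<^sub>T (if e then y' else x'), y \<otimes>\<^sub>T (if e then x' else y')), e \<noteq> d)"
  by (simp add: G_group_def swap_extension_def DirProd_def)

lemma G_one: "\<one>\<^bsub>G_group\<^esub> = ((\<one>\<^bsub>T_group\<^esub>, \<one>\<^bsub>T_group\<^esub>), False)"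
  by (simp add: G_group_def swap_extension_def DirProd_def)

lemma G_carrier: "((x, y), e) \<in> carrier G_group \<longleftrightarrow> x \<in> carrier T_group \<and> y \<in> carrier T_group"
  by (simp add: G_group_def swap_extension_def DirProd_def)

lemma G_inv_False:
  assumes "x \<in> carrier T_group" "y \<in> carrier T_group"
  shows "inv\<^bsub>G_group\<^esub> ((x, y), False) = ((inv\<^bsub>T_group\<^esub> x, inv\<^bsub>T_group\<^esub> y), False)"
proof -
  interpret T: group T_group by (rule group_T)
  interpret G: group G_group by (rule group_G)
  show ?thesis using assms by (intro G.inv_equality) (simp_all add: G_mult G_one G_carrier)
qed

lemma G_cases:
  assumes "z \<in> carrier G_group"
  obtains x y e where "z = ((x, y), e)" "x \<in> carrier T_group" "y \<in> carrier T_group"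
  using assms by (cases z) (auto simp: G_carrier)

lemma T_normal_trivial_or_all:
  fixes N :: "('a::{field,finite} option \<Rightarrow> 'a option) set"
  assumes char2: "(1::'a) + 1 = 0" and c: "c \<noteq> (0::'a)" "c \<noteq> 1"
    and N: "subgroup N T_group" "\<And>x n. \<lbrakk>x \<in> carrier T_group; n \<in> N\<rbrakk> \<Longrightarrow> x \<otimes>\<^sub>T n \<otimes>\<^sub>T inv\<^bsub>T_group\<^esub> x \<in> N"
    and ne: "N \<noteq> {\<one>\<^bsub>T_group\<^esub>}"
  shows "N = carrier T_group"
proof -
  interpret T: group "T_group :: ('a option \<Rightarrow> 'a option) monoid" by (rule group_T)
  have sub: "N \<subseteq> carrier T_group" by (rule subgroup.subset[OF N(1)])
  obtain n where n: "n \<in> N" "n \<noteq> id" using ne subgroup.one_closed[OF N(1)] by (auto simp: T_one)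
  have iv: "y = inv\<^bsub>T_group\<^esub> x" if "x \<in> carrier T_group" "y \<in> carrier T_group" "y \<circ> x = id"
    for x y :: "'a option \<Rightarrow> 'a option"
  proof -
    have "x \<otimes>\<^sub>T y = \<one>\<^bsub>T_group\<^esub>" using that by (simp add: T_mult T_one)
    then have "inv\<^bsub>T_group\<^esub> y = x" using that(1,2) by (intro T.inv_equality)
    then show ?thesis using T.inv_inv[OF that(2)] by simp
  qed
  show ?thesis
  proof (rule T_simple[OF char2 c sub _ _ _ n])
    show "x \<circ> y \<in> N" if "x \<in> N" "y \<in> N" for x y
      using subgroup.m_closed[OF N(1) that(2,1)] by (simp add: T_mult)
    show "y \<in> N" if "x \<in> N" "y \<in> carrier T_group" "y \<circ> x = id" for x y
      using iv[of x y] that sub subgroup.m_inv_closed[OF N(1) that(1)] by auto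
    show "y \<circ> n \<circ> x \<in> N" if "n \<in> N" "x \<in> carrier T_group" "y \<in> carrier T_group" "y \<circ> x = id" for x y n
      using iv[OF that(2-4)] N(2)[OF that(2,1)] by (simp add: T_mult comp_assoc)
  qed
qed

definition base_group :: "'a::field G_elem set" where
  "base_group = {z \<in> carrier G_group. \<not> snd z}"

lemma base_group_iff: "((x, y), e) \<in> base_group \<longleftrightarrow> x \<in> carrier T_group \<and> y \<in> carrier T_group \<and> \<not> e"
  by (auto simp: base_group_def G_carrier)

text \<open>Let \<open>N\<close> be the intersection of \<open>M\<close> with the first factor. If
  it is trivial, take an element \<open>(x, y)\<close> of \<open>M\<close> with \<open>x\<close>
  nontrivial; its commutators with \<open>(z, 1)\<close> lie in that factor, so \<open>x\<close> is
  central in \<open>T\<close>. By simplicity the centre is then all of \<open>T\<close>, although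
  \<open>a\<close> and \<open>b\<close> do not commute. Hence \<open>N = T\<close>, and the swap
  gives the second factor.\<close>

lemma base_group_minimal_normal:
  fixes M :: "'a::{field,finite} G_elem set"
  assumes char2: "(1::'a) + 1 = 0" and c: "c \<noteq> (0::'a)" "c \<noteq> 1"
    and M: "subgroup M G_group" "M \<subseteq> base_group" "M \<noteq> {\<one>\<^bsub>G_group\<^esub>}"
    and conj: "\<And>x m. \<lbrakk>x \<in> base_group; m \<in> M\<rbrakk> \<Longrightarrow> x \<otimes>\<^sub>G m \<otimes>\<^sub>G inv\<^bsub>G_group\<^esub> x \<in> M"
    and swap: "\<And>m. m \<in> M \<Longrightarrow> pi_elt \<otimes>\<^sub>G m \<otimes>\<^sub>G pi_elt \<in> M"
  shows "M = base_group"
proof -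
  interpret T: group "T_group :: ('a option \<Rightarrow> 'a option) monoid" by (rule group_T)
  interpret G: group "G_group :: 'a G_elem monoid" by (rule group_G)
  let ?one = "\<one>\<^bsub>T_group\<^esub> :: 'a option \<Rightarrow> 'a option"
  note Mm = subgroup.m_closed[OF M(1)] and Mi = subgroup.m_inv_closed[OF M(1)]
  have sw: "((y, x), False) \<in> M" if "((x, y), False) \<in> M" for x y
  proof -
    have "x \<in> carrier T_group" "y \<in> carrier T_group" using that M(2) by (auto simp: base_group_iff)
    then show ?thesis using swap[OF that] by (simp add: pi_elt_def G_mult DirProd_def)
  qed
  have cj: "((z \<otimes>\<^sub>T x \<otimes>\<^sub>T inv\<^bsub>T_group\<^esub> z, y), False) \<in> M"
    if "((x, y), False) \<in> M" "z \<in> carrier T_group" for x y z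
  proof -
    have "x \<in> carrier T_group" "y \<in> carrier T_group" using that M(2) by (auto simp: base_group_iff)
    then show ?thesis using conj[OF _ that(1), of "((z, ?one), False)"] that(2)
      by (simp add: base_group_iff G_mult G_inv_False)
  qed
  define N where "N = {x. ((x, ?one), False) \<in> M}"
  have Nc: "N \<subseteq> carrier T_group" using M(2) by (auto simp: N_def base_group_iff)
  have Nsub: "subgroup N T_group"
  proof (rule T.subgroupI[OF Nc])
    show "N \<noteq> {}" using subgroup.one_closed[OF M(1)] by (auto simp: N_def G_one)
    show "inv\<^bsub>T_group\<^esub> x \<in> N" if "x \<in> N" for x
      using Mi[of "((x, ?one), False)"] that Nc by (auto simp: N_def G_inv_False)
    show "x \<otimes>\<^sub>T y \<in> N" if "x \<in> N" "y \<in> N" for x y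
      using Mm[of "((x, ?one), False)" "((y, ?one), False)"] that by (simp add: N_def G_mult)
  qed
  have Nconj: "x \<otimes>\<^sub>T n \<otimes>\<^sub>T inv\<^bsub>T_group\<^esub> x \<in> N" if "x \<in> carrier T_group" "n \<in> N" for x n
    using cj that by (simp add: N_def)
  have "N \<noteq> {?one}"
  proof
    assume N1: "N = {?one}"
    obtain m where m: "m \<in> M" "m \<noteq> \<one>\<^bsub>G_group\<^esub>" using M(3) subgroup.one_closed[OF M(1)] by blast
    then have "m \<in> base_group" using M(2) by blast
    then obtain x y where "m = ((x, y), False)" by (cases m) (auto simp: base_group_iff)
    then have "((x, y), False) \<in> M" "x \<noteq> ?one \<or> y \<noteq> ?one" using m by (auto simp: G_one)
    then obtain x y where xy: "((x, y), False) \<in> M" "x \<noteq> ?one" using sw by blast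
    have xyc: "x \<in> carrier T_group" "y \<in> carrier T_group" using xy M(2) by (auto simp: base_group_iff)
    have comm: "z \<otimes>\<^sub>T x = x \<otimes>\<^sub>T z" if z: "z \<in> carrier T_group" for z
    proof -
      have "((z \<otimes>\<^sub>T x \<otimes>\<^sub>T inv\<^bsub>T_group\<^esub> z \<otimes>\<^sub>T inv\<^bsub>T_group\<^esub> x, ?one), False) \<in> M"
        using Mm[OF cj[OF xy(1) z] Mi[OF xy(1)]] xyc by (simp add: G_inv_False G_mult)
      then have "z \<otimes>\<^sub>T x \<otimes>\<^sub>T inv\<^bsub>T_group\<^esub> z \<otimes>\<^sub>T inv\<^bsub>T_group\<^esub> x = ?one"
        using N1 by (auto simp: N_def)
      then have "z \<otimes>\<^sub>T x \<otimes>\<^sub>T inv\<^bsub>T_group\<^esub> z = ?one \<otimes>\<^sub>T x"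
        using T.inv_solve_right'[of ?one "z \<otimes>\<^sub>T x \<otimes>\<^sub>T inv\<^bsub>T_group\<^esub> z" x] z xyc by simp
      then show ?thesis using T.inv_solve_right'[of x "z \<otimes>\<^sub>T x" z] z xyc by simp
    qed
    define Z :: "('a option \<Rightarrow> 'a option) set" where "Z = {w \<in> carrier T_group. \<forall>z\<in>carrier T_group. z \<otimes>\<^sub>T w = w \<otimes>\<^sub>T z}"
    have "Z = carrier T_group"
    proof (rule T_normal_trivial_or_all[OF char2 c])
      show "subgroup Z T_group"
      proof (rule T.subgroupI)
        show "Z \<subseteq> carrier T_group" "Z \<noteq> {}" by (auto simp: Z_def intro: exI[of _ ?one])
        show "inv\<^bsub>T_group\<^esub> w \<in> Z" if "w \<in> Z" for w
        proof -
          have w: "w \<in> carrier T_group" "\<And>z. z \<in> carrier T_group \<Longrightarrow> z \<otimes>\<^sub>T w = w \<otimes>\<^sub>T z"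
            using that by (auto simp: Z_def)
          have "z \<otimes>\<^sub>T inv\<^bsub>T_group\<^esub> w = inv\<^bsub>T_group\<^esub> w \<otimes>\<^sub>T z" if z: "z \<in> carrier T_group" for z
          proof -
            have "inv\<^bsub>T_group\<^esub> (w \<otimes>\<^sub>T inv\<^bsub>T_group\<^esub> z) = inv\<^bsub>T_group\<^esub> (inv\<^bsub>T_group\<^esub> z \<otimes>\<^sub>T w)"
              using w(2)[of "inv\<^bsub>T_group\<^esub> z"] z by simp
            then show ?thesis using w(1) z by (simp add: T.inv_mult_group)
          qed
          then show ?thesis using w(1) by (simp add: Z_def)
        qed
        show "v \<otimes>\<^sub>T w \<in> Z" if "v \<in> Z" "w \<in> Z" for v w
        proof -
          have vw: "v \<in> carrier T_group" "w \<in> carrier T_group"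
            "\<And>z. z \<in> carrier T_group \<Longrightarrow> z \<otimes>\<^sub>T v = v \<otimes>\<^sub>T z"
            "\<And>z. z \<in> carrier T_group \<Longrightarrow> z \<otimes>\<^sub>T w = w \<otimes>\<^sub>T z"
            using that by (auto simp: Z_def)
          have "z \<otimes>\<^sub>T (v \<otimes>\<^sub>T w) = v \<otimes>\<^sub>T w \<otimes>\<^sub>T z" if z: "z \<in> carrier T_group" for z
          proof -
            have "z \<otimes>\<^sub>T (v \<otimes>\<^sub>T w) = (z \<otimes>\<^sub>T v) \<otimes>\<^sub>T w"
              using vw(1,2) z by (simp add: T.m_assoc)
            also have "\<dots> = v \<otimes>\<^sub>T (z \<otimes>\<^sub>T w)"
              using vw(1,2) z by (simp only: vw(3)[OF z] T.m_assoc)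
            also have "\<dots> = v \<otimes>\<^sub>T w \<otimes>\<^sub>T z"
              using vw(1,2) z by (simp only: vw(4)[OF z] T.m_assoc)
            finally show ?thesis .
          qed
          then show ?thesis using vw(1,2) by (simp add: Z_def)
        qed
      qed
      show "z \<otimes>\<^sub>T w \<otimes>\<^sub>T inv\<^bsub>T_group\<^esub> z \<in> Z" if "z \<in> carrier T_group" "w \<in> Z" for z w
        using that T.conj_commute[of z w] by (auto simp: Z_def)
      have "x \<in> Z" using comm xyc by (simp add: Z_def)
      then show "Z \<noteq> {?one}" using xy(2) by blast
    qed
    moreover have car: "a_elt \<in> carrier (T_group :: ('a option \<Rightarrow> 'a option) monoid)"
      "b_elt \<in> carrier (T_group :: ('a option \<Rightarrow> 'a option) monoid)" by (rule a_T b_T)+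
    ultimately have "b_elt \<otimes>\<^sub>T a_elt = a_elt \<otimes>\<^sub>T (b_elt :: 'a option \<Rightarrow> _)"
      by (auto simp: Z_def)
    also have "\<dots> = b_elt \<otimes>\<^sub>T (a_elt \<otimes>\<^sub>T a_elt)" by (rule T_relations[OF char2])
    finally have "a_elt = a_elt \<otimes>\<^sub>T (a_elt :: 'a option \<Rightarrow> _)" using car by simp
    then show False using car T_relations(4)[OF char2] by simp
  qed
  then have N: "N = carrier T_group"
    using T_normal_trivial_or_all[OF char2 c Nsub] Nconj by blast
  have "z \<in> M" if zb: "z \<in> base_group" for z
  proof -
    obtain x y where z: "z = ((x, y), False)" "x \<in> carrier T_group" "y \<in> carrier T_group"
      using zb by (cases z) (auto simp: base_group_iff)
    have "((x, ?one), False) \<in> M" "((?one, y), False) \<in> M" using z N sw by (auto simp: N_def)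
    from Mm[OF this] show ?thesis using z by (simp add: G_mult)
  qed
  then show ?thesis using M(2) by blast
qed

text \<open>The sum of all field elements is unchanged when \<open>1\<close> is added to each of
  them, so the cardinality vanishes in the field.\<close>

lemma char2_of_card:
  assumes "CARD('a::{field,finite}) = 2 ^ f" shows "(1::'a) + 1 = 0"
proof -
  have "bij (\<lambda>x::'a. x + 1)" by (rule bij_betw_byWitness[where f' = "\<lambda>x. x - 1"]) auto
  then have "(\<Sum>x\<in>UNIV. x) = (\<Sum>x\<in>UNIV. x + (1::'a))"
    by (intro sum.reindex_bij_betw[symmetric])
  also have "\<dots> = (\<Sum>x\<in>UNIV. x) + of_nat (CARD('a))" by (simp add: sum.distrib)
  finally have "(2::'a) ^ f = 0" using assms by simp
  then show ?thesis by simp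
qed

section \<open>The sign obstruction over the field with two elements\<close>

lemma permutation_T: "(x :: 'a::{field,finite} option \<Rightarrow> _) \<in> carrier T_group \<Longrightarrow> permutation x"
  using subgroup.subset[OF subgroup_T] by (fastforce simp: permutation T_group_def sym_group_def Bij_def)

text \<open>For \<open>f = 1\<close> the permutation \<open>b\<close> is odd, so \<open>L\<close> and \<open>g\<^sub>\<alpha>\<close> lie in the kernel of the
  following character, while \<open>\<pi>\<close> does not.\<close>

definition sign_character :: "'a::field G_elem \<Rightarrow> int" where
  "sign_character z = sign (fst (fst z)) * sign (snd (fst z)) * (if snd z then -1 else 1)"

lemma sign_character_mult:
  fixes z w :: "'a::{field,finite} G_elem"
  assumes "z \<in> carrier G_group" "w \<in> carrier G_group"
  shows "sign_character (z \<otimes>\<^sub>G w) = sign_character z * sign_character w"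
proof -
  obtain x y e where z: "z = ((x, y), e)" "x \<in> carrier T_group" "y \<in> carrier T_group"
    using assms(1) by (rule G_cases)
  obtain x' y' d where w: "w = ((x', y'), d)" "x' \<in> carrier T_group" "y' \<in> carrier T_group"
    using assms(2) by (rule G_cases)
  show ?thesis
    using permutation_T[OF z(2)] permutation_T[OF z(3)] permutation_T[OF w(2)] permutation_T[OF w(3)]
    by (simp add: z(1) w(1) G_mult T_mult sign_compose sign_character_def)
qed

lemma pi_carrier: "pi_elt \<in> carrier (G_group :: 'a::field G_elem monoid)"
proof -
  interpret T: group "T_group :: ('a option \<Rightarrow> 'a option) monoid" by (rule group_T)
  show ?thesis by (simp add: pi_elt_def G_carrier DirProd_def)
qed

lemma g_elt_eq:
  fixes \<alpha> :: "'a::field"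
  shows "g_elt \<alpha> = ((u_elt \<alpha>, b_elt \<otimes>\<^sub>T u_elt \<alpha>), True)"
proof -
  interpret T: group "T_group :: ('a option \<Rightarrow> 'a option) monoid" by (rule group_T)
  have "(b_elt :: 'a option \<Rightarrow> _) \<in> carrier T_group" "u_elt \<alpha> \<in> carrier T_group" by (rule b_T u_T)+
  then show ?thesis by (simp add: g_elt_def pi_elt_def G_mult DirProd_def)
qed

lemma g_carrier:
  fixes \<alpha> :: "'a::field"
  shows "g_elt \<alpha> \<in> carrier G_group"
proof -
  interpret T: group "T_group :: ('a option \<Rightarrow> 'a option) monoid" by (rule group_T)
  have "(b_elt :: 'a option \<Rightarrow> _) \<in> carrier T_group" "u_elt \<alpha> \<in> carrier T_group" by (rule b_T u_T)+
  then show ?thesis by (simp add: g_elt_eq G_carrier)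
qed

text \<open>Arcs preserve the set \<open>W\<close> of cosets with representatives in the kernel of
  \<open>sign_character\<close>. This set contains \<open>L\<close> but not the coset of
  \<open>\<pi>\<close>.\<close>

lemma not_connected_card_2:
  fixes \<alpha> :: "'a::{field,finite}"
  assumes "CARD('a) = 2"
  shows "\<not> connected (with_proj (Gamma \<alpha>))"
proof
  assume conn: "connected (with_proj (Gamma \<alpha>))"
  interpret G: group "G_group :: 'a G_elem monoid" by (rule group_G)
  have "{0, 1} = (UNIV :: 'a set)" by (rule card_subset_eq) (use assms in auto)
  then have UN: "x = 0 \<or> x = (1::'a)" for x by blast
  have two: "(1::'a) + 1 = 0" using char2_of_card[of 1] assms by simp
  have "b_elt = transpose (Some (0::'a)) (Some 1)"
  proof
    fix v show "b_elt v = transpose (Some (0::'a)) (Some 1) v"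
    proof (cases v)
      case (Some x)
      then show ?thesis using UN[of x] two by (auto simp: b_elt_def)
    qed (simp add: b_elt_def transpose_def)
  qed
  then have sb: "sign (b_elt :: 'a option \<Rightarrow> _) = -1"
    using sign_swap_id[of "Some (0::'a)" "Some 1"] by simp
  let ?H = "{z \<in> carrier G_group. sign_character z = 1} :: 'a G_elem set"
  have one: "sign_character (\<one>\<^bsub>G_group\<^esub> :: 'a G_elem) = 1"
    by (simp add: G_one T_one sign_character_def)
  have sinv: "sign_character (inv\<^bsub>G_group\<^esub> z) = sign_character z" if "z \<in> carrier G_group" for z :: "'a G_elem"
  proof -
    have "sign_character (inv\<^bsub>G_group\<^esub> z) * sign_character z = 1"
      using sign_character_mult[of "inv\<^bsub>G_group\<^esub> z" z] that one by simp
    then show ?thesis by (auto simp: sign_character_def sign_def split: if_splits)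
  qed
  have H: "subgroup ?H G_group"
  proof (rule G.subgroupI)
    show "?H \<noteq> {}" using one by blast
  qed (auto simp: sign_character_mult sinv)
  have LH: "L_subgroup \<subseteq> ?H"
    unfolding L_subgroup_def
  proof (rule G.generate_subgroup_incl[OF _ H])
    show "{((a_elt, a_elt), False), ((b_elt, b_elt), False)} \<subseteq> ?H"
      using L_generators by (auto simp: sign_character_def sign_idempotent)
  qed
  have sL: "subgroup L_subgroup (G_group :: 'a G_elem monoid)"
    unfolding L_subgroup_def by (rule G.generate_is_subgroup[OF L_generators])
  have gH: "g_elt \<alpha> \<in> ?H"
  proof -
    have "sign (b_elt \<otimes>\<^sub>T u_elt \<alpha>) = sign (u_elt \<alpha>) * sign (b_elt :: 'a option \<Rightarrow> _)"
    proof -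
      have "permutation (b_elt :: 'a option \<Rightarrow> _)" "permutation (u_elt \<alpha>)"
        by (rule permutation_T[OF b_T] permutation_T[OF u_T])+
      then show ?thesis by (simp add: T_mult sign_compose)
    qed
    then have "sign_character (g_elt \<alpha>) = sign (u_elt \<alpha>) * sign (u_elt \<alpha>)"
      by (simp add: g_elt_eq sign_character_def sb)
    then show ?thesis using g_carrier[of \<alpha>] by (simp add: sign_idempotent)
  qed
  have coset: "x \<in> ?H \<longleftrightarrow> y \<in> ?H" if xy: "L_subgroup #>\<^bsub>G_group\<^esub> x = L_subgroup #>\<^bsub>G_group\<^esub> y"
    "x \<in> carrier G_group" "y \<in> carrier G_group" for x y
  proof -
    have "x \<in> L_subgroup #>\<^bsub>G_group\<^esub> y" using G.rcos_self[OF xy(2) sL] xy(1) by simp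
    then obtain l where l: "l \<in> L_subgroup" "x = l \<otimes>\<^sub>G y" by (auto simp: r_coset_def)
    then have "l \<in> ?H" using LH by blast
    then show ?thesis using xy(2,3) l(2) by (simp add: sign_character_mult)
  qed
  define W where "W = {L_subgroup #>\<^bsub>G_group\<^esub> x | x. x \<in> ?H}"
  have arc: "v \<in> W \<longleftrightarrow> w \<in> W" if vw: "(v, w) \<in> parcs (Gamma \<alpha>)" for v w
  proof -
    obtain x1 x2 where x: "v = L_subgroup #>\<^bsub>G_group\<^esub> x1" "w = L_subgroup #>\<^bsub>G_group\<^esub> x2"
      "x1 \<in> carrier G_group" "x2 \<in> carrier G_group"
      "x2 \<otimes>\<^sub>G inv\<^bsub>G_group\<^esub> x1 \<in> double_coset G_group L_subgroup (g_elt \<alpha>)"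
      using vw unfolding Gamma_def coset_graph_def by auto
    obtain l m where lm: "l \<in> L_subgroup" "m \<in> L_subgroup"
      "x2 \<otimes>\<^sub>G inv\<^bsub>G_group\<^esub> x1 = l \<otimes>\<^sub>G g_elt \<alpha> \<otimes>\<^sub>G m"
      using x(5) unfolding double_coset_def r_coset_def set_mult_def by blast
    have "l \<in> ?H" "m \<in> ?H" using lm LH by blast+
    then have "x2 \<otimes>\<^sub>G inv\<^bsub>G_group\<^esub> x1 \<in> ?H"
      unfolding lm(3) using gH by (intro subgroup.m_closed[OF H])
    then have "sign_character x2 * sign_character x1 = 1"
      using x(3,4) by (simp add: sign_character_mult sinv)
    then have "sign_character x1 = 1 \<longleftrightarrow> sign_character x2 = 1" by auto
    moreover have "L_subgroup #>\<^bsub>G_group\<^esub> y \<in> W \<longleftrightarrow> sign_character y = 1" if "y \<in> carrier G_group" for y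
      using coset[of y] that unfolding W_def by blast
    ultimately show ?thesis using x by simp
  qed
  have "pverts (Gamma \<alpha>) \<subseteq> W"
  proof (rule connected_closed[OF conn])
    show "L_subgroup #>\<^bsub>G_group\<^esub> \<one>\<^bsub>G_group\<^esub> \<in> pverts (Gamma \<alpha>)"
      by (auto simp: Gamma_def coset_graph_def RCOSETS_def)
    have "\<one>\<^bsub>G_group\<^esub> \<in> ?H" using one by simp
    then show "L_subgroup #>\<^bsub>G_group\<^esub> \<one>\<^bsub>G_group\<^esub> \<in> W" unfolding W_def by blast
  qed (use arc in blast)
  moreover have "L_subgroup #>\<^bsub>G_group\<^esub> pi_elt \<in> pverts (Gamma \<alpha>)"
    using pi_carrier by (auto simp: Gamma_def coset_graph_def RCOSETS_def)
  ultimately obtain x where "L_subgroup #>\<^bsub>G_group\<^esub> pi_elt = L_subgroup #>\<^bsub>G_group\<^esub> x" "x \<in> ?H"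
    unfolding W_def by blast
  then have "sign_character (pi_elt :: 'a G_elem) = 1" using coset[of pi_elt x] pi_carrier by blast
  then show False by (simp add: pi_elt_def sign_character_def DirProd_def T_one)
qed

section \<open>The concrete groups satisfy the abstract assumptions\<close>

lemma cubic_amalgam_G:
  fixes \<alpha> :: "'a::{field,finite}"
  assumes char2: "(1::'a) + 1 = 0" and c: "c \<noteq> (0::'a)" "c \<noteq> 1"
    and conn: "connected (with_proj (Gamma \<alpha>))"
  shows "cubic_amalgam G_group L_subgroup ((a_elt, a_elt), False) ((b_elt, b_elt), False)
    (g_elt \<alpha>) pi_elt base_group"
proof -
  interpret T: group "T_group :: ('a option \<Rightarrow> 'a option) monoid" by (rule group_T)
  interpret G: group "G_group :: 'a G_elem monoid" by (rule group_G)
  note rel = T_relations[OF char2]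
  let ?a = "a_elt :: 'a option \<Rightarrow> 'a option" and ?b = "b_elt :: 'a option \<Rightarrow> 'a option"
  let ?A = "((?a, ?a), False)" and ?B = "((?b, ?b), False)" and ?u = "u_elt \<alpha>"
  have car: "?a \<in> carrier T_group" "?b \<in> carrier T_group" "?u \<in> carrier T_group"
    by (rule a_T b_T u_T)+
  have AB: "?A \<in> carrier G_group" "?B \<in> carrier G_group" using car by (simp_all add: G_carrier)
  have r: "?A \<otimes>\<^sub>G (?A \<otimes>\<^sub>G ?A) = \<one>\<^bsub>G_group\<^esub>" "?B \<otimes>\<^sub>G ?B = \<one>\<^bsub>G_group\<^esub>"
    "?A \<otimes>\<^sub>G ?B = ?B \<otimes>\<^sub>G (?A \<otimes>\<^sub>G ?A)"
    by (simp_all add: G_mult G_one rel)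
  have L_eq: "L_subgroup = {\<one>\<^bsub>G_group\<^esub>, ?A, ?A \<otimes>\<^sub>G ?A, ?B, ?B \<otimes>\<^sub>G ?A,
      ?B \<otimes>\<^sub>G (?A \<otimes>\<^sub>G ?A)}"
    unfolding L_subgroup_def by (rule G.generate_S3[OF AB r])
  have L_diag: "\<exists>x\<in>carrier T_group. l = ((x, x), False)" if "l \<in> L_subgroup" for l :: "'a G_elem"
    using that car unfolding L_eq by (auto simp: G_mult G_one)
  have uu: "?u \<otimes>\<^sub>T (?u \<otimes>\<^sub>T x) = x" "?b \<otimes>\<^sub>T (?b \<otimes>\<^sub>T x) = x"
    "?u \<otimes>\<^sub>T (?b \<otimes>\<^sub>T x) = ?b \<otimes>\<^sub>T (?u \<otimes>\<^sub>T x)"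
    if "x \<in> carrier T_group" for x
    using rel(2,6,7) car that by (metis T.m_assoc T.l_one)+
  have ua: "?a \<otimes>\<^sub>T (?a \<otimes>\<^sub>T (?a \<otimes>\<^sub>T x)) = x"
    "?a \<otimes>\<^sub>T (?b \<otimes>\<^sub>T x) = ?b \<otimes>\<^sub>T (?a \<otimes>\<^sub>T (?a \<otimes>\<^sub>T x))"
    if "x \<in> carrier T_group" for x
    using rel(1,3) car that by (metis T.m_assoc T.l_one T.m_closed)+
  note gs = g_elt_eq G_mult G_one pi_elt_def DirProd_def car rel uu ua T.m_assoc
  have aa: "?a \<otimes>\<^sub>T ?a \<noteq> ?a" "?a \<noteq> ?a \<otimes>\<^sub>T ?a"
    using rel(4) car by (metis T.l_cancel_one)+
  \<comment> \<open>In the symmetric group of degree 3 an involution is centralised only by itself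
    and the identity.\<close>
  have central: "x = \<one>\<^bsub>T_group\<^esub> \<or> x = ?b"
    if "((x, x), False) \<in> L_subgroup" "x \<otimes>\<^sub>T ?b = ?b \<otimes>\<^sub>T x" for x
    using that unfolding L_eq by (elim insertE) (simp_all add: gs aa)
  have inv_g: "inv\<^bsub>G_group\<^esub> g_elt \<alpha> = ?B \<otimes>\<^sub>G g_elt \<alpha>"
    by (rule G.inv_equality) (simp_all add: gs G_carrier)
  show ?thesis
  proof (intro cubic_amalgam.intro cubic_amalgam_axioms.intro)
    show "group (G_group :: 'a G_elem monoid)" by (rule group_G)
    show "finite (carrier (G_group :: 'a G_elem monoid))" by (rule finite)
    show "subgroup L_subgroup (G_group :: 'a G_elem monoid)"
      unfolding L_subgroup_def by (rule G.generate_is_subgroup[OF L_generators])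
    show "L_subgroup = {\<one>\<^bsub>G_group\<^esub>, ?A, ?A \<otimes>\<^sub>G ?A, ?B, ?B \<otimes>\<^sub>G ?A,
      ?B \<otimes>\<^sub>G (?A \<otimes>\<^sub>G ?A)}" by (rule L_eq)
    show "g_elt \<alpha> \<in> carrier G_group" by (rule g_carrier)
    show "(pi_elt :: 'a G_elem) \<in> carrier G_group" by (rule pi_carrier)
    show "?A \<otimes>\<^sub>G (?A \<otimes>\<^sub>G ?A) = \<one>\<^bsub>G_group\<^esub>" "?B \<otimes>\<^sub>G ?B = \<one>\<^bsub>G_group\<^esub>"
      "?A \<otimes>\<^sub>G ?B = ?B \<otimes>\<^sub>G (?A \<otimes>\<^sub>G ?A)" by (rule r)+
    show "?A \<noteq> \<one>\<^bsub>G_group\<^esub>" "?B \<noteq> \<one>\<^bsub>G_group\<^esub>" by (simp_all add: G_one rel)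
    show "g_elt \<alpha> \<otimes>\<^sub>G g_elt \<alpha> = ?B" by (simp add: gs)
    show "pi_elt \<otimes>\<^sub>G pi_elt = (\<one>\<^bsub>G_group\<^esub> :: 'a G_elem)" by (simp add: gs)
    show "pi_elt \<otimes>\<^sub>G l = l \<otimes>\<^sub>G pi_elt" if "l \<in> L_subgroup" for l :: "'a G_elem"
      using L_diag[OF that] by (auto simp: gs)
    show "pi_elt \<otimes>\<^sub>G g_elt \<alpha> = ?B \<otimes>\<^sub>G (g_elt \<alpha> \<otimes>\<^sub>G pi_elt)"
      by (simp add: gs)
    show "l = \<one>\<^bsub>G_group\<^esub> \<or> l = ?B"
      if l: "l \<in> L_subgroup" "g_elt \<alpha> \<otimes>\<^sub>G (l \<otimes>\<^sub>G inv\<^bsub>G_group\<^esub> g_elt \<alpha>) \<in> L_subgroup" for l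
    proof -
      obtain x where x: "x \<in> carrier T_group" "l = ((x, x), False)" using L_diag[OF l(1)] by blast
      obtain y where "g_elt \<alpha> \<otimes>\<^sub>G (l \<otimes>\<^sub>G inv\<^bsub>G_group\<^esub> g_elt \<alpha>) = ((y, y), False)"
        using L_diag[OF l(2)] by blast
      \<comment> \<open>The two components of the conjugate of \<open>(x, x)\<close> differ by
        conjugation with \<open>b\<close>, so it is diagonal only if \<open>x\<close> commutes with
        \<open>b\<close>.\<close>
      then have "?u \<otimes>\<^sub>T (x \<otimes>\<^sub>T ?u) =
          ?b \<otimes>\<^sub>T (?u \<otimes>\<^sub>T (x \<otimes>\<^sub>T (?b \<otimes>\<^sub>T ?u)))"
        unfolding inv_g using x by (simp add: gs)
      also have "\<dots> = ?u \<otimes>\<^sub>T (?b \<otimes>\<^sub>T x \<otimes>\<^sub>T ?b \<otimes>\<^sub>T ?u)"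
        using x(1) by (simp add: gs)
      finally have "x = ?b \<otimes>\<^sub>T x \<otimes>\<^sub>T ?b" using x(1) car by simp
      then have "x \<otimes>\<^sub>T ?b = ?b \<otimes>\<^sub>T x \<otimes>\<^sub>T ?b \<otimes>\<^sub>T ?b" by simp
      also have "\<dots> = ?b \<otimes>\<^sub>T x" using x(1) by (simp add: gs)
      finally show ?thesis using central[of x] l(1) x(2) by (auto simp: G_one)
    qed
    show "subgroup base_group (G_group :: 'a G_elem monoid)"
    proof (rule G.subgroupI)
      have "\<one>\<^bsub>G_group\<^esub> \<in> (base_group :: 'a G_elem set)" by (simp add: base_group_def)
      then show "base_group \<noteq> ({} :: 'a G_elem set)" by blast
    qed (simp_all add: base_group_def snd_inv_G subset_iff)
    show "L_subgroup \<subseteq> (base_group :: 'a G_elem set)" using L_diag by (force simp: base_group_iff)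
    show "g_elt \<alpha> \<notin> base_group" "(pi_elt :: 'a G_elem) \<notin> base_group"
      by (simp_all add: base_group_def g_elt_eq pi_elt_def)
    show "x \<otimes>\<^sub>G y \<in> base_group"
      if "x \<in> carrier G_group" "y \<in> carrier G_group" "x \<notin> base_group" "y \<notin> base_group" for x y :: "'a G_elem"
      using that by (simp add: base_group_def)
    show "M = base_group" if "subgroup M G_group" "M \<subseteq> base_group" "M \<noteq> {\<one>\<^bsub>G_group\<^esub>}"
      "\<And>x m. x \<in> base_group \<Longrightarrow> m \<in> M \<Longrightarrow> x \<otimes>\<^sub>G m \<otimes>\<^sub>G inv\<^bsub>G_group\<^esub> x \<in> M"
      "\<And>m. m \<in> M \<Longrightarrow> pi_elt \<otimes>\<^sub>G m \<otimes>\<^sub>G pi_elt \<in> M" for M :: "'a G_elem set"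
      by (rule base_group_minimal_normal[OF char2 c that])
    show False if y: "y \<in> carrier G_group" "y \<notin> base_group"
      and comm: "\<And>k. k \<in> base_group \<Longrightarrow> y \<otimes>\<^sub>G k = k \<otimes>\<^sub>G y" for y :: "'a G_elem"
    proof -
      obtain v w where vw: "y = ((v, w), True)" "v \<in> carrier T_group" "w \<in> carrier T_group"
        using y by (cases y) (auto simp: base_group_iff G_carrier)
      \<comment> \<open>An element outside the base group swaps the factors, so it cannot commute
        with an element that is nontrivial in only one of them.\<close>
      have "((?a, \<one>\<^bsub>T_group\<^esub>), False) \<in> base_group" using car by (simp add: base_group_iff)
      from comm[OF this] have "w \<otimes>\<^sub>T ?a = w" using vw by (simp add: G_mult)
      then show False using vw car rel(4) by simp
    qed
    show "connected (with_proj (coset_graph G_group L_subgroup (double_coset G_group L_subgroup (g_elt \<alpha>))))"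
      using conn by (simp add: Gamma_def)
  qed
qed

theorem theorem1p2:
  fixes f :: nat and \<alpha> :: "'a::{field, finite}"
  assumes "f \<ge> 1"
    and "CARD('a) = 2 ^ f"
    and "connected (with_proj (Gamma \<alpha>))"
  shows "G_action \<in> mon G_group (Aut (Gamma \<alpha>))
    \<and> subgroup (G_action ` carrier G_group) (Aut (Gamma \<alpha>))
    \<and> card (rcosets\<^bsub>Aut (Gamma \<alpha>)\<^esub> (G_action ` carrier G_group)) = 2
    \<and> arc_transitive (Gamma \<alpha>) (graph_aut (Gamma \<alpha>)) 3
    \<and> \<not> biquasiprimitive (pverts (Gamma \<alpha>)) (graph_aut (Gamma \<alpha>))
    \<and> (\<forall>\<Delta>. bipartite_half (Gamma \<alpha>) \<Delta> \<longrightarrow>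
          quasiprimitive \<Delta>
            (induced_on \<Delta> (plus_subgroup (pverts (Gamma \<alpha>)) (graph_aut (Gamma \<alpha>)))))"
proof -
  have char2: "(1::'a) + 1 = 0" by (rule char2_of_card[OF assms(2)])
  have "CARD('a) \<noteq> 2" using not_connected_card_2 assms(3) by blast
  then have "{0, 1} \<noteq> (UNIV :: 'a set)" by (metis card_2_iff zero_neq_one)
  \<comment> \<open>This is the multiplier of the scaling used in the simplicity argument; it exists
    because the field has more than two elements.\<close>
  then obtain c where c: "c \<noteq> (0::'a)" "c \<noteq> 1" by blast
  interpret C: cubic_amalgam "G_group :: 'a G_elem monoid" L_subgroup "((a_elt, a_elt), False)"
    "((b_elt, b_elt), False)" "g_elt \<alpha>" pi_elt base_group
    by (rule cubic_amalgam_G[OF char2 c assms(3)])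
  have eq: "Gamma \<alpha> = C.\<Gamma>" by (simp add: C.\<Gamma>_def Gamma_def)
  show ?thesis unfolding G_action_def eq by (rule C.coset_graph_conclusion)
qed

end
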